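(* Let $N$ be a matroid and let $L\subseteq E(N)$. Then $N\oplus_2U_{2,4}^{L}$ is frame if and only if the matroidal $(N,L)$ is frame.
   Context: A biased graph is a finite graph with a set of balanced cycles such that no theta subgraph contains exactly two balanced cycles; its frame matroid on the edge set has circuits the edge sets of balanced cycles, of two edge-disjoint unbalanced cycles sharing exactly one vertex, of two vertex-disjoint unbalanced cycles joined by a path, and of thetas with all cycles unbalanced. A matroid is frame if it is such a frame matroid. A matroidal $(N,L)$ ($L\subseteq E(N)$) is frame if some biased graph with frame matroid $N$ has every element of $L$ as an unbalanced loop. The 2-sum on $e_1,e_2$ of $M_1,M_2$ is the matroid on $(E(M_1)\cup E(M_2))\setminus\{e_1,e_2\}$ with circuits the circuits of $M_i$ avoiding $e_i$ and $(C_1\cup C_2)\setminus\{e_1,e_2\}$ for circuits $C_i\ni e_i$. $N\oplus_2U_{2,4}^{L}$ denotes the matroid obtained by taking a 2-sum of a separate copy of $U_{2,4}$ on each element of $L$. *)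

theory Defs
  imports Main
begin

section \<open>Matroids, presented by their circuits\<close>

record 'a matroid =
  ground :: "'a set"
  circuits :: "'a set set"

definition is_matroid :: "'a matroid \<Rightarrow> bool" where
  "is_matroid M \<longleftrightarrow>
     finite (ground M) \<and>
     circuits M \<subseteq> Pow (ground M) \<and>
     {} \<notin> circuits M \<and>
     (\<forall>C\<in>circuits M. \<forall>D\<in>circuits M. C \<subseteq> D \<longrightarrow> C = D) \<and>
     (\<forall>C\<in>circuits M. \<forall>D\<in>circuits M. \<forall>x\<in>C \<inter> D. C \<noteq> D \<longrightarrow>
        (\<exists>F\<in>circuits M. F \<subseteq> (C \<union> D) - {x}))"

definition uniform_matroid :: "nat \<Rightarrow> 'a set \<Rightarrow> 'a matroid" where
  "uniform_matroid r S = \<lparr>ground = S, circuits = {C. C \<subseteq> S \<and> card C = Suc r}\<rparr>"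

definition map_matroid :: "('a \<Rightarrow> 'b) \<Rightarrow> 'a matroid \<Rightarrow> 'b matroid" where
  "map_matroid f M = \<lparr>ground = f ` ground M, circuits = (\<lambda>C. f ` C) ` circuits M\<rparr>"

text \<open>The ground sets are meant to be disjoint.  If \<open>e1\<close> is a loop, the sets below need not be
  the circuits of a matroid: a loop on one side makes \<open>C - {e2}\<close> a member for every
  \<open>C\<close> containing \<open>e2\<close>.\<close>

definition two_sum :: "'a matroid \<Rightarrow> 'a \<Rightarrow> 'a matroid \<Rightarrow> 'a \<Rightarrow> 'a matroid" where
  "two_sum M1 e1 M2 e2 =
     \<lparr>ground = (ground M1 \<union> ground M2) - {e1, e2},
      circuits = {C \<in> circuits M1. e1 \<notin> C} \<union> {C \<in> circuits M2. e2 \<notin> C} \<union>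
        {(C1 \<union> C2) - {e1, e2} | C1 C2.
           C1 \<in> circuits M1 \<and> e1 \<in> C1 \<and> C2 \<in> circuits M2 \<and> e2 \<in> C2}\<rparr>"

text \<open>The elements of \<open>N\<close> are tagged by \<open>Inl\<close>; the copy of $U_{2,4}$ that belongs to \<open>e\<close>
  lives on \<open>Inr (e, 0), \<dots>, Inr (e, 3)\<close>, with \<open>Inr (e, 0)\<close> as its basepoint.\<close>

definition U24_copy :: "'a \<Rightarrow> ('a + 'a \<times> nat) matroid" where
  "U24_copy e = uniform_matroid 2 ((\<lambda>i. Inr (e, i)) ` {..<4})"

definition two_sum_U24_at ::
    "'a \<Rightarrow> ('a + 'a \<times> nat) matroid \<Rightarrow> ('a + 'a \<times> nat) matroid" where
  "two_sum_U24_at e M = two_sum M (Inl e) (U24_copy e) (Inr (e, 0))"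

definition two_sum_U24 :: "'a matroid \<Rightarrow> 'a set \<Rightarrow> ('a + 'a \<times> nat) matroid" where
  "two_sum_U24 N L = Finite_Set.fold two_sum_U24_at (map_matroid Inl N) L"

text \<open>The 2-sums at different elements commute, so the fold is well defined on finite sets.\<close>

lemma two_sum_U24_at_old:
  "X \<in> circuits M \<Longrightarrow> Inl e \<notin> X \<Longrightarrow> X \<in> circuits (two_sum_U24_at e M)"
  by (simp add: two_sum_U24_at_def two_sum_def)

lemma two_sum_U24_at_copy:
  "X \<in> circuits (U24_copy e) \<Longrightarrow> Inr (e, 0) \<notin> X \<Longrightarrow> X \<in> circuits (two_sum_U24_at e M)"
  by (simp add: two_sum_U24_at_def two_sum_def)

lemma two_sum_U24_at_glue:
  assumes "X = (C \<union> D) - {Inl e, Inr (e, 0)}" "C \<in> circuits M" "Inl e \<in> C"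
    "D \<in> circuits (U24_copy e)" "Inr (e, 0) \<in> D"
  shows "X \<in> circuits (two_sum_U24_at e M)"
proof -
  have "\<exists>C D. X = (C \<union> D) - {Inl e, Inr (e, 0)} \<and> C \<in> circuits M \<and> Inl e \<in> C \<and>
      D \<in> circuits (U24_copy e) \<and> Inr (e, 0) \<in> D"
    using assms by (intro exI conjI)
  then show ?thesis unfolding two_sum_U24_at_def two_sum_def by simp
qed

lemma two_sum_U24_at_cases:
  assumes "X \<in> circuits (two_sum_U24_at e M)"
  obtains (old) "X \<in> circuits M" "Inl e \<notin> X"
  | (copy) "X \<in> circuits (U24_copy e)" "Inr (e, 0) \<notin> X"
  | (glue) C D where "X = (C \<union> D) - {Inl e, Inr (e, 0)}" "C \<in> circuits M" "Inl e \<in> C"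
      "D \<in> circuits (U24_copy e)" "Inr (e, 0) \<in> D"
  using assms unfolding two_sum_U24_at_def two_sum_def by auto

lemma U24_copy_circuit_notin:
  assumes "D \<in> circuits (U24_copy e)"
  shows "Inl x \<notin> D" and "y \<noteq> e \<Longrightarrow> Inr (y, i) \<notin> D"
  using assms by (auto simp: U24_copy_def uniform_matroid_def)

lemma two_sum_U24_at_commute_aux:
  assumes "e \<noteq> f" and "X \<in> circuits (two_sum_U24_at f (two_sum_U24_at e M))"
  shows "X \<in> circuits (two_sum_U24_at e (two_sum_U24_at f M))"
  using assms(2)
proof (cases rule: two_sum_U24_at_cases)
  case X: old
  from X(1) show ?thesis
  proof (cases rule: two_sum_U24_at_cases)
    case old
    then show ?thesis using X by (intro two_sum_U24_at_old)
  next
    case copy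
    then show ?thesis by (rule two_sum_U24_at_copy)
  next
    case (glue C D)
    have "Inl f \<notin> C" using X(2) assms(1) glue(1) by simp
    then show ?thesis
      by (intro two_sum_U24_at_glue[OF glue(1) _ glue(3-5)] two_sum_U24_at_old glue(2))
  qed
next
  case copy
  then show ?thesis
    by (intro two_sum_U24_at_old two_sum_U24_at_copy U24_copy_circuit_notin(1))
next
  case X: (glue C D)
  have D: "Inl e \<notin> D" "Inr (e, 0) \<notin> D"
    using U24_copy_circuit_notin[OF X(4)] assms(1) by simp_all
  from X(2) show ?thesis
  proof (cases rule: two_sum_U24_at_cases)
    case old
    have "Inl e \<notin> X" using old(2) D X(1) by simp
    then show ?thesis
      by (intro two_sum_U24_at_old two_sum_U24_at_glue[OF X(1) old(1) X(3-5)])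
  next
    case copy
    then show ?thesis using X(3) U24_copy_circuit_notin(1)[OF copy(1)] by simp
  next
    case (glue A B)
    let ?Y = "(A \<union> D) - {Inl f, Inr (f, 0)}"
    have B: "Inl f \<notin> B" "Inr (f, 0) \<notin> B"
      using U24_copy_circuit_notin[OF glue(4)] assms(1) by simp_all
    have "Inl f \<in> A" using X(3) B(1) glue(1) by simp
    then have Y: "?Y \<in> circuits (two_sum_U24_at f M)"
      by (intro two_sum_U24_at_glue[OF refl glue(2) _ X(4,5)])
    have eY: "Inl e \<in> ?Y" using glue(3) assms(1) by simp
    have "X = (?Y \<union> B) - {Inl e, Inr (e, 0)}"
      unfolding X(1) glue(1) using B D by blast
    then show ?thesis by (rule two_sum_U24_at_glue[OF _ Y eY glue(4,5)])
  qed
qed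

lemma two_sum_U24_at_commute:
  "two_sum_U24_at f (two_sum_U24_at e M) = two_sum_U24_at e (two_sum_U24_at f M)"
proof (cases "e = f")
  case False
  have "circuits (two_sum_U24_at f (two_sum_U24_at e M))
          = circuits (two_sum_U24_at e (two_sum_U24_at f M))"
    using two_sum_U24_at_commute_aux[OF False] two_sum_U24_at_commute_aux[OF False[symmetric]]
    by (intro set_eqI iffI)
  moreover have "ground (two_sum_U24_at f (two_sum_U24_at e M))
          = ground (two_sum_U24_at e (two_sum_U24_at f M))"
    using False
    by (auto simp: two_sum_U24_at_def two_sum_def U24_copy_def uniform_matroid_def)
  ultimately show ?thesis by simp
qed simp

interpretation two_sum_U24: comp_fun_commute two_sum_U24_at
  by standard (simp add: fun_eq_iff two_sum_U24_at_commute)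

lemma two_sum_U24_empty [simp]: "two_sum_U24 N {} = map_matroid Inl N"
  by (simp add: two_sum_U24_def)

lemma two_sum_U24_insert [simp]:
  "finite L \<Longrightarrow> e \<notin> L \<Longrightarrow> two_sum_U24 N (insert e L) = two_sum_U24_at e (two_sum_U24 N L)"
  by (simp add: two_sum_U24_def)


section \<open>Biased graphs and frame matroids\<close>

text \<open>Loops (one end) and parallel edges are allowed.\<close>

record ('v, 'e) multigraph =
  verts :: "'v set"
  edges :: "'e set"
  ends :: "'e \<Rightarrow> 'v set"

definition finite_multigraph :: "('v, 'e) multigraph \<Rightarrow> bool" where
  "finite_multigraph G \<longleftrightarrow> finite (verts G) \<and> finite (edges G) \<and>
     (\<forall>e\<in>edges G. ends G e \<subseteq> verts G \<and> card (ends G e) \<in> {1, 2})"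

definition vertices_of :: "('v, 'e) multigraph \<Rightarrow> 'e set \<Rightarrow> 'v set" where
  "vertices_of G X = (\<Union>e\<in>X. ends G e)"

text \<open>A path is given by its vertex sequence and its edge sequence; a single vertex is a path.\<close>

definition is_path :: "('v, 'e) multigraph \<Rightarrow> 'v \<Rightarrow> 'v list \<Rightarrow> 'e list \<Rightarrow> 'v \<Rightarrow> bool" where
  "is_path G u vs es v \<longleftrightarrow>
     length vs = Suc (length es) \<and> hd vs = u \<and> last vs = v \<and> distinct vs \<and>
     set vs \<subseteq> verts G \<and> set es \<subseteq> edges G \<and>
     (\<forall>i<length es. ends G (es ! i) = {vs ! i, vs ! Suc i})"

text \<open>Cycles are identified with their edge sets. Loops are cycles of length 1, and pairs of
  parallel edges are cycles of length 2.\<close>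

definition is_cycle :: "('v, 'e) multigraph \<Rightarrow> 'e set \<Rightarrow> bool" where
  "is_cycle G C \<longleftrightarrow>
     (\<exists>vs es. es \<noteq> [] \<and> length vs = length es \<and> distinct vs \<and> distinct es \<and>
        set es \<subseteq> edges G \<and> C = set es \<and>
        (\<forall>i<length es. ends G (es ! i) = {vs ! i, vs ! (Suc i mod length es)}))"

text \<open>A theta consists of three internally disjoint paths between two distinct vertices. Edge
  disjointness has to be demanded separately because of paths consisting of one edge.\<close>

definition is_theta :: "('v, 'e) multigraph \<Rightarrow> 'e set \<Rightarrow> bool" where
  "is_theta G T \<longleftrightarrow>
     (\<exists>u v vs1 vs2 vs3 es1 es2 es3. u \<noteq> v \<and>
        is_path G u vs1 es1 v \<and> is_path G u vs2 es2 v \<and> is_path G u vs3 es3 v \<and>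
        set vs1 \<inter> set vs2 = {u, v} \<and> set vs1 \<inter> set vs3 = {u, v} \<and> set vs2 \<inter> set vs3 = {u, v} \<and>
        set es1 \<inter> set es2 = {} \<and> set es1 \<inter> set es3 = {} \<and> set es2 \<inter> set es3 = {} \<and>
        T = set es1 \<union> set es2 \<union> set es3)"

text \<open>\<open>B\<close> is the set of balanced cycles.\<close>

definition biased_graph :: "('v, 'e) multigraph \<Rightarrow> 'e set set \<Rightarrow> bool" where
  "biased_graph G B \<longleftrightarrow> finite_multigraph G \<and> (\<forall>C\<in>B. is_cycle G C) \<and>
     (\<forall>T. is_theta G T \<longrightarrow> card {C \<in> B. C \<subseteq> T} \<noteq> 2)"

definition unbalanced_cycle :: "('v, 'e) multigraph \<Rightarrow> 'e set set \<Rightarrow> 'e set \<Rightarrow> bool" where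
  "unbalanced_cycle G B C \<longleftrightarrow> is_cycle G C \<and> C \<notin> B"

definition tight_handcuff :: "('v, 'e) multigraph \<Rightarrow> 'e set set \<Rightarrow> 'e set \<Rightarrow> bool" where
  "tight_handcuff G B X \<longleftrightarrow>
     (\<exists>C1 C2. unbalanced_cycle G B C1 \<and> unbalanced_cycle G B C2 \<and> C1 \<inter> C2 = {} \<and>
        card (vertices_of G C1 \<inter> vertices_of G C2) = 1 \<and> X = C1 \<union> C2)"

text \<open>The joining path meets each of the two cycles in exactly one of its end vertices.\<close>

definition loose_handcuff :: "('v, 'e) multigraph \<Rightarrow> 'e set set \<Rightarrow> 'e set \<Rightarrow> bool" where
  "loose_handcuff G B X \<longleftrightarrow>
     (\<exists>C1 C2 u vs es v. unbalanced_cycle G B C1 \<and> unbalanced_cycle G B C2 \<and>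
        vertices_of G C1 \<inter> vertices_of G C2 = {} \<and> is_path G u vs es v \<and>
        vertices_of G C1 \<inter> set vs = {u} \<and> vertices_of G C2 \<inter> set vs = {v} \<and>
        X = C1 \<union> C2 \<union> set es)"

definition unbalanced_theta :: "('v, 'e) multigraph \<Rightarrow> 'e set set \<Rightarrow> 'e set \<Rightarrow> bool" where
  "unbalanced_theta G B X \<longleftrightarrow>
     is_theta G X \<and> (\<forall>C. is_cycle G C \<and> C \<subseteq> X \<longrightarrow> unbalanced_cycle G B C)"

definition frame_matroid :: "('v, 'e) multigraph \<Rightarrow> 'e set set \<Rightarrow> 'e matroid" where
  "frame_matroid G B =
     \<lparr>ground = edges G,
      circuits = {X. X \<in> B \<or> tight_handcuff G B X \<or> loose_handcuff G B X \<or>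
                     unbalanced_theta G B X}\<rparr>"

text \<open>A finite graph can have its vertices named by natural numbers.\<close>

definition is_frame :: "'a matroid \<Rightarrow> bool" where
  "is_frame M \<longleftrightarrow>
     (\<exists>(G :: (nat, 'a) multigraph) B. biased_graph G B \<and> frame_matroid G B = M)"

definition unbalanced_loop :: "('v, 'e) multigraph \<Rightarrow> 'e set set \<Rightarrow> 'e \<Rightarrow> bool" where
  "unbalanced_loop G B e \<longleftrightarrow> e \<in> edges G \<and> card (ends G e) = 1 \<and> {e} \<notin> B"

definition matroidal_is_frame :: "'a matroid \<Rightarrow> 'a set \<Rightarrow> bool" where
  "matroidal_is_frame N L \<longleftrightarrow>
     (\<exists>(G :: (nat, 'a) multigraph) B. biased_graph G B \<and> frame_matroid G B = N \<and>
        (\<forall>e\<in>L. unbalanced_loop G B e))"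

end

theory Submission
  imports Defs
begin

text \<open>An edge set is dependent in the frame matroid of a biased graph if and only if it contains a
  balanced cycle or a set of edges that outnumbers its vertices; so two biased graphs can be compared by
  counting vertices, without looking at handcuffs and thetas.

  If \<open>e\<close> is an unbalanced loop at \<open>v\<close>, three parallel edges from \<open>v\<close> to a new vertex
  represent the 2-sum with \<open>U\<^sub>2\<^sub>,\<^sub>4\<close> at \<open>e\<close>. Conversely, let \<open>P\<close> be the three
  elements of the copy of \<open>U\<^sub>2\<^sub>,\<^sub>4\<close> in a biased graph representing a 2-sum, and delete
  \<open>P\<close>. As \<open>P\<close> is a circuit, it spans two vertices, or it is a balanced triangle. No element of
  \<open>P\<close> is spanned by the other edges, which keeps the vertices of \<open>P\<close>, up to one, outside the
  unbalanced components. Hence two vertices of \<open>P\<close> can be identified without changing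
  the matroid on the remaining edges, and \<open>e\<close> becomes an unbalanced loop at the identified vertex or,
  for a triangle, at the third one.\<close>

section \<open>Cycles\<close>

text \<open>The axiom of a biased graph becomes a count too. Two cycles that share an edge and whose
  union has at most one more edge than vertices form a theta, and their symmetric difference is its
  third cycle. The axiom can therefore be compared between two graphs, like dependence, through
  vertex counts.

  The obstacle to treating the elements of \<open>L\<close> one at a time is twofold. After some of
  the 2-sums the structure is given by its circuits only, and a 2-sum at a loop can fail to be a
  matroid. Moreover, a graph built for one 2-sum has to preserve the unbalanced loops at the other
  elements. Hence the equivalence for a single 2-sum carries a set \<open>K\<close> of elements
  prescribed as unbalanced loops, and it is derived from the circuits alone. That these form an
  antichain and that \<open>e\<close> is not a loop of the matroid is read off whichever biased
  graph is given.\<close>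

lemma vertices_of_mono: "X \<subseteq> Y \<Longrightarrow> vertices_of G X \<subseteq> vertices_of G Y"
  by (auto simp: vertices_of_def)

lemma vertices_of_Un [simp]: "vertices_of G (X \<union> Y) = vertices_of G X \<union> vertices_of G Y"
  by (auto simp: vertices_of_def)

lemma vertices_of_empty [simp]: "vertices_of G {} = {}"
  by (simp add: vertices_of_def)

lemma vertices_of_insert [simp]:
  "vertices_of G (insert e X) = ends G e \<union> vertices_of G X"
  by (auto simp: vertices_of_def)

lemma card_ends:
  assumes "finite_multigraph G" "e \<in> edges G"
  shows "finite (ends G e)" "ends G e \<noteq> {}" "ends G e \<subseteq> verts G"
    "card (ends G e) = 1 \<or> card (ends G e) = 2"
  using assms by (auto simp: finite_multigraph_def intro: finite_subset)

lemma finite_edges_subset: "finite_multigraph G \<Longrightarrow> X \<subseteq> edges G \<Longrightarrow> finite X"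
  by (auto simp: finite_multigraph_def intro: finite_subset)

lemma finite_vertices_of:
  "finite_multigraph G \<Longrightarrow> X \<subseteq> edges G \<Longrightarrow> finite (vertices_of G X)"
  using finite_edges_subset[of G X] card_ends(1)[of G] by (auto simp: vertices_of_def)

lemma vertices_of_subset_verts:
  "finite_multigraph G \<Longrightarrow> X \<subseteq> edges G \<Longrightarrow> vertices_of G X \<subseteq> verts G"
  using card_ends(3)[of G] by (fastforce simp: vertices_of_def)

lemma vertices_of_eq_empty_iff:
  "finite_multigraph G \<Longrightarrow> X \<subseteq> edges G \<Longrightarrow> vertices_of G X = {} \<longleftrightarrow> X = {}"
  using card_ends(2)[of G] by (fastforce simp: vertices_of_def)

lemma card_vertices_of_mono:
  "finite_multigraph G \<Longrightarrow> Y \<subseteq> edges G \<Longrightarrow> X \<subseteq> Y \<Longrightarrow>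
     card (vertices_of G X) \<le> card (vertices_of G Y)"
  by (intro card_mono finite_vertices_of vertices_of_mono)

text \<open>The matrix of \<open>is_cycle\<close> with its two sequences exposed, because cycles
  have to be rotated and cut at chosen positions.\<close>

definition cycle_lists :: "('v, 'e) multigraph \<Rightarrow> 'v list \<Rightarrow> 'e list \<Rightarrow> bool" where
  "cycle_lists G vs es \<longleftrightarrow> es \<noteq> [] \<and> length vs = length es \<and> distinct vs \<and> distinct es \<and>
     set es \<subseteq> edges G \<and> (\<forall>i<length es. ends G (es ! i) = {vs ! i, vs ! (Suc i mod length es)})"

lemma is_cycle_iff_lists: "is_cycle G C \<longleftrightarrow> (\<exists>vs es. cycle_lists G vs es \<and> C = set es)"
  unfolding is_cycle_def cycle_lists_def by blast

lemma cycle_lists_vertices: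
  assumes "cycle_lists G vs es"
  shows "vertices_of G (set es) = set vs"
proof -
  let ?n = "length es"
  have n: "?n > 0" "length vs = ?n"
    and e: "\<And>i. i < ?n \<Longrightarrow> ends G (es ! i) = {vs ! i, vs ! (Suc i mod ?n)}"
    using assms by (auto simp: cycle_lists_def)
  show ?thesis
  proof
    show "vertices_of G (set es) \<subseteq> set vs"
    proof
      fix v assume "v \<in> vertices_of G (set es)"
      then obtain i where i: "i < ?n" "v \<in> ends G (es ! i)"
        by (auto simp: vertices_of_def in_set_conv_nth)
      have "Suc i mod ?n < ?n" using n by simp
      then show "v \<in> set vs" using i e[OF i(1)] n by auto
    qed
    show "set vs \<subseteq> vertices_of G (set es)"
    proof
      fix v assume "v \<in> set vs"
      then obtain i where "i < ?n" "v = vs ! i" using n by (auto simp: in_set_conv_nth)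
      then show "v \<in> vertices_of G (set es)" using e[of i] by (auto simp: vertices_of_def)
    qed
  qed
qed

lemma cycle_lists_rotate:
  assumes "cycle_lists G vs es"
  shows "cycle_lists G (rotate k vs) (rotate k es)"
proof -
  let ?n = "length es"
  have n: "?n > 0" "length vs = ?n"
    and e: "\<And>i. i < ?n \<Longrightarrow> ends G (es ! i) = {vs ! i, vs ! (Suc i mod ?n)}"
    using assms by (auto simp: cycle_lists_def)
  have "ends G (rotate k es ! i) = {rotate k vs ! i, rotate k vs ! (Suc i mod ?n)}" if i: "i < ?n" for i
  proof -
    have "Suc i mod ?n < ?n" using n by simp
    then have "rotate k vs ! (Suc i mod ?n) = vs ! ((k + Suc i) mod ?n)"
      using n by (simp add: nth_rotate mod_simps)
    moreover have "Suc ((k + i) mod ?n) mod ?n = (k + Suc i) mod ?n"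
      by (simp add: mod_simps)
    moreover have "(k + i) mod ?n < ?n" using n by simp
    ultimately show ?thesis using i n e[of "(k + i) mod ?n"] by (simp add: nth_rotate)
  qed
  then show ?thesis using assms by (simp add: cycle_lists_def)
qed

text \<open>Induction around a cycle: a property passed on to the cyclic successor spreads from one
  index to all of them.\<close>

lemma mod_closed_imp_all:
  fixes n :: nat
  assumes "i0 < n" "P i0" "\<And>i. i < n \<Longrightarrow> P i \<Longrightarrow> P (Suc i mod n)" "j < n"
  shows "P j"
proof -
  have P: "P ((i0 + k) mod n)" for k
  proof (induction k)
    case 0 then show ?case using assms by simp
  next
    case (Suc k)
    have "(i0 + k) mod n < n" using assms(1) by simp
    from assms(3)[OF this Suc] show ?case by (simp add: mod_simps)
  qed
  \<comment> \<open>The summand \<open>n\<close> keeps the number of steps from \<open>i0\<close> to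
    \<open>j\<close> from being truncated to 0 when \<open>j < i0\<close>.\<close>
  have "(i0 + (n + j - i0)) mod n = j" using assms(1,4) by simp
  then show ?thesis using P[of "n + j - i0"] by simp
qed

lemma is_cycle_card:
  assumes "is_cycle G C"
  shows "card (vertices_of G C) = card C" "C \<noteq> {}" "C \<subseteq> edges G" "finite C"
proof -
  obtain vs es where l: "cycle_lists G vs es" "C = set es"
    using assms by (auto simp: is_cycle_iff_lists)
  show "card (vertices_of G C) = card C"
    using cycle_lists_vertices[OF l(1)] l by (simp add: cycle_lists_def distinct_card)
  show "C \<noteq> {}" "C \<subseteq> edges G" "finite C" using l by (auto simp: cycle_lists_def)
qed

text \<open>Charge each chosen edge to its first vertex. Some chosen edge is followed by an unchosen
  one, and its second vertex stays uncharged. This inequality stands in for the fact that a proper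
  part of a cycle is a forest, and most of the later counts rest on it.\<close>

lemma is_cycle_proper_subset:
  assumes "is_cycle G C" "Z \<subset> C" "Z \<noteq> {}"
  shows "card Z < card (vertices_of G Z)"
proof -
  obtain vs es where l: "cycle_lists G vs es" "C = set es"
    using assms by (auto simp: is_cycle_iff_lists)
  let ?n = "length es"
  have n: "?n > 0" "length vs = ?n" "distinct vs" "distinct es"
    and e: "\<And>i. i < ?n \<Longrightarrow> ends G (es ! i) = {vs ! i, vs ! (Suc i mod ?n)}"
    using l by (auto simp: cycle_lists_def)
  define I where "I = {i. i < ?n \<and> es ! i \<in> Z}"
  have Z: "Z = (!) es ` I"
    using assms(2) l(2) by (auto simp: I_def in_set_conv_nth image_iff) (metis in_set_conv_nth subsetD)
  have finV: "finite (vertices_of G Z)"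
    using vertices_of_mono[of Z C G] assms(2) cycle_lists_vertices[OF l(1)] l(2)
    by (metis List.finite_set finite_subset psubset_imp_subset)
  have vI: "(!) vs ` I \<subseteq> vertices_of G Z"
    using e by (auto simp: I_def vertices_of_def)
  have injv: "inj_on ((!) vs) {..<?n}" and inje: "inj_on ((!) es) {..<?n}"
    using n by (simp_all add: inj_on_nth)
  have I: "I \<subseteq> {..<?n}" by (auto simp: I_def)
  \<comment> \<open>Otherwise \<open>I\<close> would be closed under the cyclic successor and would
    contain every index.\<close>
  have "\<exists>i<?n. i \<in> I \<and> Suc i mod ?n \<notin> I"
  proof (rule ccontr)
    assume h: "\<not> ?thesis"
    obtain i0 where i0: "i0 \<in> I" using assms(3) Z by auto
    have "j \<in> I" if "j < ?n" for j
      by (rule mod_closed_imp_all[of i0 ?n "\<lambda>i. i \<in> I"]) (use i0 I h that in auto)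
    then have "set es \<subseteq> Z" by (auto simp: I_def in_set_conv_nth)
    then show False using assms(2) l(2) by blast
  qed
  then obtain i where i: "i < ?n" "i \<in> I" "Suc i mod ?n \<notin> I" by blast
  have "vs ! (Suc i mod ?n) \<notin> (!) vs ` I"
    using inj_onD[OF injv, of "Suc i mod ?n"] i(3) I n(1) by fastforce
  moreover have "vs ! (Suc i mod ?n) \<in> vertices_of G Z"
    using e[OF i(1)] i(2) by (auto simp: I_def vertices_of_def)
  ultimately have "(!) vs ` I \<subset> vertices_of G Z" using vI by blast
  then have "card ((!) vs ` I) < card (vertices_of G Z)" by (rule psubset_card_mono[OF finV])
  moreover have "card ((!) vs ` I) = card Z"
    using card_image[OF inj_on_subset[OF injv I]] card_image[OF inj_on_subset[OF inje I]] Z by simp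
  ultimately show ?thesis by simp
qed

lemma is_cycle_subset_eq:
  assumes "is_cycle G C" "is_cycle G D" "D \<subseteq> C"
  shows "D = C"
  using is_cycle_proper_subset[OF assms(1), of D] is_cycle_card[OF assms(2)] assms(3) by fastforce

lemma is_cycle_subset_card_le:
  assumes "is_cycle G C" "Z \<subseteq> C"
  shows "card Z \<le> card (vertices_of G Z)"
  using is_cycle_proper_subset[OF assms(1), of Z] is_cycle_card[OF assms(1)] assms(2)
  by (cases "Z = C"; cases "Z = {}") fastforce+

text \<open>If \<open>f\<close> were the only edge of \<open>C\<close> at \<open>v\<close>, the rest
  of \<open>C\<close> would avoid \<open>v\<close> and have too few vertices for a nonempty proper
  part of a cycle. So the rest would be empty and \<open>f\<close> a loop, against
  \<open>card (ends G f) = 2\<close>.\<close>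

lemma is_cycle_degree_two:
  assumes "is_cycle G C" "finite_multigraph G" "f \<in> C" "v \<in> ends G f" "card (ends G f) = 2"
  shows "\<exists>g\<in>C. g \<noteq> f \<and> v \<in> ends G g"
proof (rule ccontr)
  assume h: "\<not> ?thesis"
  note c = is_cycle_card[OF assms(1)]
  have sub: "vertices_of G (C - {f}) \<subseteq> vertices_of G C - {v}"
    using h by (auto simp: vertices_of_def)
  have "v \<in> vertices_of G C" using assms by (auto simp: vertices_of_def)
  then have "card (vertices_of G (C - {f})) \<le> card C - 1"
    using card_mono[OF _ sub] finite_vertices_of[OF assms(2) c(3)] c(1) by simp
  moreover have "card (C - {f}) = card C - 1" using assms(3) c(4) by simp
  ultimately have "C - {f} = {}"
    using is_cycle_proper_subset[OF assms(1), of "C - {f}"] assms(3) by force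
  then have "C = {f}" using assms(3) by auto
  then show False using c(1) assms(5) by simp
qed

text \<open>\<open>h\<close> renames edges and \<open>\<pi>\<close> maps vertices. Injectivity of
  \<open>\<pi>\<close> is asked for on the vertices of \<open>C\<close> only, so that the lemma
  applies to the identification of two vertices not both on \<open>C\<close>.\<close>

lemma is_cycle_transport:
  assumes "is_cycle G C" "\<And>f. f \<in> C \<Longrightarrow> h f \<in> edges G' \<and> ends G' (h f) = \<pi> ` ends G f"
    "inj_on \<pi> (vertices_of G C)" "inj_on h C"
  shows "is_cycle G' (h ` C)"
proof -
  obtain vs es where l: "cycle_lists G vs es" "C = set es"
    using assms by (auto simp: is_cycle_iff_lists)
  have v: "vertices_of G C = set vs" using cycle_lists_vertices[OF l(1)] l(2) by simp
  have "ends G' (map h es ! i) = {map \<pi> vs ! i, map \<pi> vs ! (Suc i mod length es)}"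
    if "i < length es" for i
  proof -
    have "Suc i mod length es < length vs" using l that by (auto simp: cycle_lists_def)
    moreover have "es ! i \<in> C" using l(2) that by simp
    ultimately show ?thesis using that l assms(2)[of "es ! i"] by (auto simp: cycle_lists_def)
  qed
  then have "cycle_lists G' (map \<pi> vs) (map h es)"
    using l v assms by (auto simp: cycle_lists_def distinct_map)
  moreover have "h ` C = set (map h es)" using l(2) by simp
  ultimately show ?thesis unfolding is_cycle_iff_lists by blast
qed

section \<open>Paths and thetas\<close>

text \<open>\<open>is_path\<close> demands distinct vertices only, but then the two ends of an edge
  determine its position.\<close>

lemma is_path_distinct_edges:
  assumes "is_path G u vs es v"
  shows "distinct es"
proof -
  have "i = j" if "i < length es" "j < length es" "es ! i = es ! j" for i j
  proof -
    have "{vs ! i, vs ! Suc i} = {vs ! j, vs ! Suc j}"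
      using assms that unfolding is_path_def by metis
    then show ?thesis
      using assms that by (auto simp: is_path_def doubleton_eq_iff nth_eq_iff_index_eq)
  qed
  then show ?thesis by (auto simp: distinct_conv_nth)
qed

lemma is_path_nth_ends:
  assumes "is_path G u vs es v"
  shows "vs ! 0 = u" "vs ! length es = v"
proof -
  have "length vs = Suc (length es)" "hd vs = u" "last vs = v" using assms by (auto simp: is_path_def)
  moreover from this have "vs \<noteq> []" by auto
  ultimately show "vs ! 0 = u" "vs ! length es = v" by (simp_all add: hd_conv_nth last_conv_nth)
qed

lemma is_path_ends_in:
  assumes "is_path G u vs es v"
  shows "u \<in> set vs" "v \<in> set vs"
proof -
  have "length vs = Suc (length es)" "hd vs = u" "last vs = v" using assms by (auto simp: is_path_def)
  moreover from this have "vs \<noteq> []" by auto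
  ultimately show "u \<in> set vs" "v \<in> set vs" using hd_in_set last_in_set by blast+
qed

lemma is_path_vertices:
  assumes "is_path G u vs es v"
  shows "vertices_of G (set es) \<subseteq> set vs" "es \<noteq> [] \<Longrightarrow> vertices_of G (set es) = set vs"
proof -
  show 1: "vertices_of G (set es) \<subseteq> set vs"
  proof
    fix w assume "w \<in> vertices_of G (set es)"
    then obtain i where i: "i < length es" "w \<in> ends G (es ! i)"
      by (auto simp: vertices_of_def in_set_conv_nth)
    then have "w = vs ! i \<or> w = vs ! Suc i" "Suc i < length vs" using assms by (auto simp: is_path_def)
    then show "w \<in> set vs" by auto
  qed
  show "vertices_of G (set es) = set vs" if "es \<noteq> []"
  proof
    show "set vs \<subseteq> vertices_of G (set es)"
    proof
      fix w assume "w \<in> set vs"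
      then obtain i where i: "i \<le> length es" "w = vs ! i"
        using assms by (auto simp: is_path_def in_set_conv_nth less_Suc_eq_le)
      show "w \<in> vertices_of G (set es)"
      proof (cases "i < length es")
        case True
        then have "w \<in> ends G (es ! i)" using i assms by (simp add: is_path_def)
          then show ?thesis using True by (auto simp: vertices_of_def)
      next
        case False
        then have "Suc (length es - 1) = i" "length es - 1 < length es" using i that by (cases es; simp)+
        then have "w \<in> ends G (es ! (length es - 1))" using i assms by (simp add: is_path_def)
        then show ?thesis using that by (auto simp: vertices_of_def)
      qed
    qed
  qed (rule 1)
qed

lemma is_path_card:
  assumes "is_path G u vs es v"
  shows "card (set vs) = Suc (card (set es))"
proof -
  have "length vs = Suc (length es)" "distinct vs" using assms by (auto simp: is_path_def)
  then show ?thesis using is_path_distinct_edges[OF assms] by (simp add: distinct_card)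
qed

lemma card_nth_vimage:
  assumes "distinct es" "Z \<subseteq> set es"
  shows "card {i. i < length es \<and> es ! i \<in> Z} = card Z"
proof -
  have "bij_betw ((!) es) {i. i < length es \<and> es ! i \<in> Z} Z"
    unfolding bij_betw_def
  proof
    show "inj_on ((!) es) {i. i < length es \<and> es ! i \<in> Z}"
      using assms(1) by (auto intro!: inj_on_nth)
    show "(!) es ` {i. i < length es \<and> es ! i \<in> Z} = Z"
      using assms(2) by (auto simp: image_iff in_set_conv_nth) (metis in_set_conv_nth subsetD)
  qed
  then show ?thesis by (rule bij_betw_same_card)
qed

text \<open>An unchosen edge \<open>k\<close> cuts the path. Chosen edges before it are charged to
  their later end, those after it to their earlier end; the charged vertices are distinct and avoid
  both ends of the path.\<close>

lemma is_path_proper_subset: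
  assumes "is_path G u vs es v" "Z \<subset> set es"
  shows "card Z \<le> card (vertices_of G Z - {u, v})"
proof -
  obtain k where k: "k < length es" "es ! k \<notin> Z"
    using assms(2) by (auto simp: in_set_conv_nth psubset_eq) (metis in_set_conv_nth subsetI subset_antisym)
  define I where "I = {i. i < length es \<and> es ! i \<in> Z}"
  define g where "g i = vs ! (if i < k then Suc i else i)" for i
  have p: "length vs = Suc (length es)" "distinct vs"
    "\<And>i. i < length es \<Longrightarrow> ends G (es ! i) = {vs ! i, vs ! Suc i}"
    using assms(1) by (auto simp: is_path_def)
  note uv = is_path_nth_ends[OF assms(1)]
  have "k \<notin> I" using k by (simp add: I_def)
  have inj: "inj_on g I"
  proof (rule inj_onI)
    fix i j assume ij: "i \<in> I" "j \<in> I" "g i = g j"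
    then have l: "i < length es" "j < length es" "i \<noteq> k" "j \<noteq> k"
      using \<open>k \<notin> I\<close> by (auto simp: I_def)
    then have "(if i < k then Suc i else i) = (if j < k then Suc j else j)"
      using ij(3) p(1,2) k(1) by (auto simp: g_def nth_eq_iff_index_eq split: if_splits)
    then show "i = j" using l by (auto split: if_splits)
  qed
  have "g i \<in> vertices_of G Z - {u, v}" if "i \<in> I" for i
  proof -
    have i: "i < length es" "es ! i \<in> Z" "i \<noteq> k" using that k by (auto simp: I_def)
    have "g i \<in> ends G (es ! i)" using p(3)[OF i(1)] by (auto simp: g_def)
    then have "g i \<in> vertices_of G Z" using i(2) by (auto simp: vertices_of_def)
    moreover have "g i \<noteq> vs ! 0" "g i \<noteq> vs ! length es"
      using i k p(1,2) by (auto simp: g_def nth_eq_iff_index_eq)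
    ultimately show ?thesis using uv by simp
  qed
  then have "g ` I \<subseteq> vertices_of G Z - {u, v}" by blast
  moreover have "finite (vertices_of G Z)"
    using is_path_vertices(1)[OF assms(1)] vertices_of_mono[of Z "set es" G] assms(2)
    by (meson List.finite_set finite_subset order_trans psubset_imp_subset)
  ultimately have "card (g ` I) \<le> card (vertices_of G Z - {u, v})" by (intro card_mono) auto
  then show ?thesis
    using card_image[OF inj] card_nth_vimage[OF is_path_distinct_edges[OF assms(1)], of Z] assms(2)
    by (simp add: I_def)
qed

text \<open>Each chosen edge is charged to its first vertex, and the second vertex of the last
  chosen edge is left over.\<close>

lemma is_path_acyclic:
  assumes "is_path G u vs es v" "Z \<subseteq> set es" "Z \<noteq> {}"
  shows "card Z < card (vertices_of G Z)"
proof -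
  define I where "I = {i. i < length es \<and> es ! i \<in> Z}"
  have p: "length vs = Suc (length es)" "distinct vs"
    "\<And>i. i < length es \<Longrightarrow> ends G (es ! i) = {vs ! i, vs ! Suc i}"
    using assms(1) by (auto simp: is_path_def)
  have I: "finite I" "I \<noteq> {}" using assms(2,3) by (auto simp: I_def in_set_conv_nth) (metis in_set_conv_nth subsetD)
  define m where "m = Max I"
  have m: "m \<in> I" "Suc m \<notin> I"
    using Max_in[OF I] Max_ge[OF I(1), of "Suc m"] unfolding m_def by fastforce+
  have inj: "inj_on ((!) vs) (insert (Suc m) I)"
    using p m by (intro inj_on_nth) (auto simp: I_def)
  have "(!) vs ` insert (Suc m) I \<subseteq> vertices_of G Z"
    using p m(1) by (auto simp: I_def vertices_of_def)
  moreover have "finite (vertices_of G Z)"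
    using is_path_vertices(1)[OF assms(1)] vertices_of_mono[of Z "set es" G] assms(2)
    by (meson List.finite_set finite_subset order_trans)
  ultimately have "card ((!) vs ` insert (Suc m) I) \<le> card (vertices_of G Z)" by (intro card_mono)
  then have "Suc (card I) \<le> card (vertices_of G Z)" using card_image[OF inj] I m by simp
  then show ?thesis
    using card_nth_vimage[OF is_path_distinct_edges[OF assms(1)] assms(2)] by (simp add: I_def)
qed

lemma is_path_take:
  assumes "is_path G u vs es v" "i < length vs"
  shows "is_path G u (take (Suc i) vs) (take i es) (vs ! i)"
proof -
  have p: "length vs = Suc (length es)" "hd vs = u" "distinct vs" "set vs \<subseteq> verts G" "set es \<subseteq> edges G"
    "\<And>i. i < length es \<Longrightarrow> ends G (es ! i) = {vs ! i, vs ! Suc i}"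
    using assms(1) by (auto simp: is_path_def)
  have "last (take (Suc i) vs) = vs ! i" "hd (take (Suc i) vs) = u"
    using assms(2) p(1,2) by (simp_all add: take_Suc_conv_app_nth) (cases vs; cases i; simp)+
  moreover have "set (take (Suc i) vs) \<subseteq> verts G" "set (take i es) \<subseteq> edges G"
    using p(4,5) set_take_subset by fast+
  ultimately show ?thesis using p(1,3,6) assms(2) by (simp add: is_path_def)
qed

lemma is_path_drop:
  assumes "is_path G u vs es v" "i < length vs"
  shows "is_path G (vs ! i) (drop i vs) (drop i es) v"
proof -
  have p: "length vs = Suc (length es)" "last vs = v" "distinct vs" "set vs \<subseteq> verts G" "set es \<subseteq> edges G"
    "\<And>i. i < length es \<Longrightarrow> ends G (es ! i) = {vs ! i, vs ! Suc i}"
    using assms(1) by (auto simp: is_path_def)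
  have "set (drop i vs) \<subseteq> verts G" "set (drop i es) \<subseteq> edges G"
    using p(4,5) set_drop_subset by fast+
  then show ?thesis using p(1-3,6) assms(2) by (simp add: is_path_def hd_drop_conv_nth)
qed

lemma is_path_rev:
  assumes "is_path G u vs es v"
  shows "is_path G v (rev vs) (rev es) u"
proof -
  have p: "length vs = Suc (length es)"
    "\<And>i. i < length es \<Longrightarrow> ends G (es ! i) = {vs ! i, vs ! Suc i}"
    using assms by (auto simp: is_path_def)
  have "ends G (rev es ! i) = {rev vs ! i, rev vs ! Suc i}" if i: "i < length es" for i
  proof -
    have "length es - Suc i < length es" "Suc (length es - Suc i) = length es - i" using i by auto
    then show ?thesis using p i by (simp add: rev_nth insert_commute)
  qed
  then show ?thesis using assms by (auto simp: is_path_def hd_rev last_rev)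
qed

section \<open>Reachability and forests\<close>

text \<open>A closure suffices for splitting an edge set along components; a path with distinct
  vertices is extracted from it only where one is needed.\<close>

definition reach :: "('v, 'e) multigraph \<Rightarrow> 'e set \<Rightarrow> ('v \<times> 'v) set" where
  "reach G Y = {(s, t). \<exists>f\<in>Y. ends G f = {s, t}}\<^sup>*"

text \<open>A further step either extends the path or, when the new vertex already lies on it,
  truncates the path there.\<close>

lemma reach_path:
  assumes "(u, v) \<in> reach G Y" "Y \<subseteq> edges G" "u \<in> verts G" "finite_multigraph G"
  shows "\<exists>vs es. is_path G u vs es v \<and> set es \<subseteq> Y"
  using assms(1) unfolding reach_def
proof (induction rule: rtrancl_induct)
  case base
  have "is_path G u [u] [] u" using assms(3) by (simp add: is_path_def)
  then show ?case by force
next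
  case (step y z)
  then obtain vs es f where p: "is_path G u vs es y" "set es \<subseteq> Y" "f \<in> Y" "ends G f = {y, z}"
    by auto
  show ?case
  proof (cases "z \<in> set vs")
    case True
    then obtain i where "i < length vs" "z = vs ! i" by (auto simp: in_set_conv_nth)
    then show ?thesis using is_path_take[OF p(1), of i] p(2) set_take_subset[of i es] by blast
  next
    case False
    have "f \<in> edges G" using p assms by auto
    then have z: "z \<in> verts G" using card_ends(3)[OF assms(4), of f] p by auto
    have "is_path G u (vs @ [z]) (es @ [f]) z"
      using p z False \<open>f \<in> edges G\<close> is_path_nth_ends[OF p(1)]
      by (cases vs) (auto simp: is_path_def nth_append less_Suc_eq nth_Cons')
    then show ?thesis using p by (intro exI[of _ "vs @ [z]"] exI[of _ "es @ [f]"]) simp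
  qed
qed

lemma reach_refl: "(u, u) \<in> reach G Y" by (simp add: reach_def)

lemma reach_step:
  assumes "(u, s) \<in> reach G Y" "f \<in> Y" "s \<in> ends G f" "t \<in> ends G f"
    "finite_multigraph G" "Y \<subseteq> edges G"
  shows "(u, t) \<in> reach G Y"
proof (cases "s = t")
  case False
  have c: "card (ends G f) \<le> 2" "finite (ends G f)"
    using card_ends(1,4)[OF assms(5) subsetD[OF assms(6,2)]] by auto
  then have "ends G f = {s, t}"
    using card_seteq[OF c(2), of "{s, t}"] assms(3,4) False by simp
  then show ?thesis using assms(1,2) unfolding reach_def
    by (auto intro: rtrancl_into_rtrancl)
qed (use assms in simp)

text \<open>The case \<open>u = v\<close> is included: the path is then a single vertex and
  \<open>f\<close> a loop, which is a cycle of length 1.\<close>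

lemma is_cycle_close_path:
  assumes "is_path G u vs es v" "f \<in> edges G" "f \<notin> set es" "ends G f = {u, v}"
  shows "is_cycle G (insert f (set es))"
proof -
  note d = is_path_distinct_edges[OF assms(1)] and uv = is_path_nth_ends[OF assms(1)]
  have "ends G ((es @ [f]) ! i) = {vs ! i, vs ! (Suc i mod length (es @ [f]))}"
    if "i < length (es @ [f])" for i
  proof (cases "i < length es")
    case True
    then show ?thesis using assms(1) by (simp add: is_path_def nth_append)
  next
    case False
    then have "i = length es" using that by simp
    then show ?thesis using assms(4) uv by (simp add: insert_commute)
  qed
  then have "cycle_lists G vs (es @ [f])"
    using assms d by (simp add: cycle_lists_def is_path_def)
  moreover have "insert f (set es) = set (es @ [f])" by simp
  ultimately show ?thesis unfolding is_cycle_iff_lists by blast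
qed

text \<open>Deleting an edge \<open>f\<close> from a forest separates its ends, for a remaining path
  between them would close up with \<open>f\<close>. The other edges split into two parts with
  disjoint vertex sets, and each part has a vertex to spare.\<close>

lemma acyclic_card:
  assumes "finite_multigraph G" "Y \<subseteq> edges G" "Y \<noteq> {}" "\<And>C. C \<subseteq> Y \<Longrightarrow> \<not> is_cycle G C"
  shows "card Y < card (vertices_of G Y)"
  using assms(2-4)
proof (induction "card Y" arbitrary: Y rule: less_induct)
  case less
  note finY = finite_edges_subset[OF assms(1) less.prems(1)]
  obtain f where f: "f \<in> Y" using less.prems by auto
  have fe: "f \<in> edges G" using f less.prems by auto
  obtain u v where uv: "ends G f = {u, v}"
    using card_ends(4)[OF assms(1) fe] by (auto simp: card_1_singleton_iff card_2_iff)
  have uV: "u \<in> verts G" using card_ends(3)[OF assms(1) fe] uv by auto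
  let ?Y = "Y - {f}"
  have sub: "?Y \<subseteq> edges G" using less.prems by auto
  have nr: "(u, v) \<notin> reach G ?Y"
  proof
    assume "(u, v) \<in> reach G ?Y"
    from reach_path[OF this sub uV assms(1)] obtain vs es
      where p: "is_path G u vs es v" "set es \<subseteq> ?Y" by blast
    have "is_cycle G (insert f (set es))"
      by (rule is_cycle_close_path[OF p(1) fe]) (use p uv in auto)
    then show False using less.prems(3)[of "insert f (set es)"] p f by blast
  qed
  define R where "R = {w. (u, w) \<in> reach G ?Y}"
  define Y1 where "Y1 = {g \<in> ?Y. ends G g \<inter> R \<noteq> {}}"
  define Y2 where "Y2 = ?Y - Y1"
  have sub1: "Y1 \<subseteq> ?Y" and sub2: "Y2 \<subseteq> ?Y" by (auto simp: Y1_def Y2_def)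
  have V1: "insert u (vertices_of G Y1) \<subseteq> R"
    using reach_step[OF _ _ _ _ assms(1) sub] reach_refl
    by (fastforce simp: R_def Y1_def vertices_of_def)
  have V2: "insert v (vertices_of G Y2) \<inter> R = {}"
    using nr by (auto simp: R_def Y2_def Y1_def vertices_of_def)
  \<comment> \<open>Inserting the vertex \<open>w\<close>, an end of \<open>f\<close>, makes the
    bound hold also for an empty part, where that end is isolated once \<open>f\<close> is
    deleted.\<close>
  have IH: "Suc (card Z) \<le> card (insert w (vertices_of G Z))" if "Z \<subseteq> ?Y" for Z w
  proof (cases "Z = {}")
    case False
    have "card Z < card Y" using that f finY by (intro psubset_card_mono) auto
    from less.hyps[OF this] False that less.prems
    have "card Z < card (vertices_of G Z)" by blast
    also have "\<dots> \<le> card (insert w (vertices_of G Z))"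
      using finite_vertices_of[OF assms(1), of Z] that sub by (intro card_mono) auto
    finally show ?thesis by simp
  qed simp
  have fin: "finite (vertices_of G Y1)" "finite (vertices_of G Y2)"
    using sub by (auto intro!: finite_vertices_of[OF assms(1)] simp: Y1_def Y2_def)
  have "card (insert u (vertices_of G Y1)) + card (insert v (vertices_of G Y2))
      = card (insert u (vertices_of G Y1) \<union> insert v (vertices_of G Y2))"
    using V1 V2 fin by (intro card_Un_disjoint[symmetric]) auto
  also have "Y = insert f (Y1 \<union> Y2)" using f by (auto simp: Y1_def Y2_def)
  then have "insert u (vertices_of G Y1) \<union> insert v (vertices_of G Y2) = vertices_of G Y"
    using uv by auto
  finally have "Suc (card Y1) + Suc (card Y2) \<le> card (vertices_of G Y)"
    using IH[OF sub1, of u] IH[OF sub2, of v] by simp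
  moreover have "card Y1 + card Y2 = card ?Y"
    using card_Diff_subset[OF _ sub1] card_mono[OF _ sub1] finite_subset[OF sub1] finY
    unfolding Y2_def by simp
  moreover have "Suc (card ?Y) = card Y" using card_Suc_Diff1[OF finY f] .
  ultimately show ?case by simp
qed

lemma exists_cycle:
  assumes "finite_multigraph G" "Y \<subseteq> edges G" "Y \<noteq> {}" "card (vertices_of G Y) \<le> card Y"
  obtains C where "is_cycle G C" "C \<subseteq> Y"
  using acyclic_card[OF assms(1-3)] assms(4) by force

text \<open>At an inner vertex of the path \<open>D\<close> can only use edges of the path, and a
  cycle never has just one edge at a vertex. So consecutive edges of the path lie both in
  \<open>D\<close> or both outside, and this propagates along the path.\<close>

lemma is_cycle_contains_path:
  assumes "is_cycle G D" "finite_multigraph G" "is_path G u vs es v"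
    "\<And>g. g \<in> D - set es \<Longrightarrow> ends G g \<inter> set vs \<subseteq> {u, v}" "D \<inter> set es \<noteq> {}"
  shows "set es \<subseteq> D"
proof -
  have p: "length vs = Suc (length es)" "distinct vs" "set es \<subseteq> edges G"
    "\<And>i. i < length es \<Longrightarrow> ends G (es ! i) = {vs ! i, vs ! Suc i}"
    using assms(3) by (auto simp: is_path_def)
  note uv = is_path_nth_ends[OF assms(3)]
  have step: "es ! i \<in> D \<longleftrightarrow> es ! Suc i \<in> D" if i: "Suc i < length es" for i
  proof -
    have other: "\<exists>j<length es. es ! j \<in> D \<and> j \<noteq> k \<and> (j = i \<or> j = Suc i)"
      if k: "es ! k \<in> D" "k = i \<or> k = Suc i" for k
    proof -
      have kl: "k < length es" using k i by auto
      have "card (ends G (es ! k)) = 2" using p kl by (simp add: nth_eq_iff_index_eq)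
      moreover have "vs ! Suc i \<in> ends G (es ! k)" using p(4)[OF kl] k by auto
      ultimately obtain g where g: "g \<in> D" "g \<noteq> es ! k" "vs ! Suc i \<in> ends G g"
        using is_cycle_degree_two[OF assms(1,2) k(1)] by blast
      have "vs ! Suc i \<notin> {u, v}" using uv i p(1,2) by (auto simp: nth_eq_iff_index_eq simp flip: uv)
      moreover have "vs ! Suc i \<in> set vs" using p(1) i by simp
      ultimately have "g \<in> set es" using g assms(4)[of g] by blast
      then obtain j where j: "j < length es" "g = es ! j" by (auto simp: in_set_conv_nth)
      have "vs ! Suc i = vs ! j \<or> vs ! Suc i = vs ! Suc j" using g(3) p(4)[OF j(1)] j(2) by auto
      then have "j = i \<or> j = Suc i" using p(1,2) i j(1) by (auto simp: nth_eq_iff_index_eq)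
      then show ?thesis using g j by auto
    qed
    show ?thesis using other[of i] other[of "Suc i"] by auto
  qed
  have all: "es ! i \<in> D \<longleftrightarrow> es ! 0 \<in> D" if "i < length es" for i
    using that
  proof (induction i)
    case (Suc i) then show ?case using step[of i] by simp
  qed simp
  obtain i where "i < length es" "es ! i \<in> D" using assms(5) by (auto simp: in_set_conv_nth)
  then show ?thesis using all by (auto simp: in_set_conv_nth)
qed

section \<open>The three cycles of a theta\<close>

text \<open>A cycle inside the theta contains or misses each of the three paths as a whole. It
  cannot be a single path, which is acyclic, nor the whole theta, which has one edge more than
  vertices; unions of two paths remain. That these are cycles needs no concatenation of sequences:
  it follows from a count.\<close>

lemma theta_cycles:
  assumes "is_theta G T" "finite_multigraph G"
  obtains P Q R where "P \<noteq> {}" "Q \<noteq> {}" "R \<noteq> {}" "P \<inter> Q = {}" "P \<inter> R = {}" "Q \<inter> R = {}"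
    "T = P \<union> Q \<union> R" "T \<subseteq> edges G" "card T = Suc (card (vertices_of G T))"
    "\<And>D. is_cycle G D \<and> D \<subseteq> T \<longleftrightarrow> D = P \<union> Q \<or> D = P \<union> R \<or> D = Q \<union> R"
proof -
  obtain u v vs1 vs2 vs3 es1 es2 es3 where uv: "u \<noteq> v"
    and p: "is_path G u vs1 es1 v" "is_path G u vs2 es2 v" "is_path G u vs3 es3 v"
    and i: "set vs1 \<inter> set vs2 = {u, v}" "set vs1 \<inter> set vs3 = {u, v}" "set vs2 \<inter> set vs3 = {u, v}"
    and d: "set es1 \<inter> set es2 = {}" "set es1 \<inter> set es3 = {}" "set es2 \<inter> set es3 = {}"
    and T: "T = set es1 \<union> set es2 \<union> set es3"
    using assms(1) unfolding is_theta_def by blast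
  have ne: "es \<noteq> []" if "is_path G u vs es v" for vs es
    using is_path_nth_ends[OF that] uv by auto
  note n = ne[OF p(1)] ne[OF p(2)] ne[OF p(3)]
  note V = is_path_vertices(2)[OF p(1) n(1)] is_path_vertices(2)[OF p(2) n(2)]
    is_path_vertices(2)[OF p(3) n(3)]
  note c = is_path_card[OF p(1)] is_path_card[OF p(2)] is_path_card[OF p(3)]
  have E: "T \<subseteq> edges G" using p T by (auto simp: is_path_def)
  have two: "card (set a \<union> set b) = card A + card B"
    if "set a \<inter> set b = {u, v}" "card (set a) = Suc (card A)" "card (set b) = Suc (card B)"
    for a b :: "'a list" and A B :: "'b set"
    using card_Un_Int[of "set a" "set b"] that uv by simp
  have "(set vs1 \<union> set vs2) \<inter> set vs3 = {u, v}" using i by blast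
  then have cV: "Suc (card (vertices_of G T)) = card (set es1) + card (set es2) + card (set es3)"
    using card_Un_Int[of "set vs1 \<union> set vs2" "set vs3"] two[OF i(1) c(1,2)] c(3) uv
    by (simp add: V T)
  have cT: "card T = card (set es1) + card (set es2) + card (set es3)"
    unfolding T using d by (subst card_Un_disjoint) (auto simp: card_Un_disjoint)
  have endsV: "ends G g \<subseteq> set vs" if "is_path G u vs es v" "g \<in> set es" for vs es g
    using is_path_vertices(1)[OF that(1)] that(2) by (auto simp: vertices_of_def)
  note e1 = endsV[OF p(1)] and e2 = endsV[OF p(2)] and e3 = endsV[OF p(3)]
  have aon1: "set es1 \<subseteq> D \<or> D \<inter> set es1 = {}" if D: "is_cycle G D" "D \<subseteq> T" for D
    using is_cycle_contains_path[OF D(1) assms(2) p(1)] D(2) e2 e3 i unfolding T by blast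
  have aon2: "set es2 \<subseteq> D \<or> D \<inter> set es2 = {}" if D: "is_cycle G D" "D \<subseteq> T" for D
    using is_cycle_contains_path[OF D(1) assms(2) p(2)] D(2) e1 e3 i unfolding T by blast
  have aon3: "set es3 \<subseteq> D \<or> D \<inter> set es3 = {}" if D: "is_cycle G D" "D \<subseteq> T" for D
    using is_cycle_contains_path[OF D(1) assms(2) p(3)] D(2) e1 e2 i unfolding T by blast
  let ?P = "set es1" and ?Q = "set es2" and ?R = "set es3"
  have np: "\<not> is_cycle G (set es)" if "is_path G u vs es v" for vs es
    using is_path_acyclic[OF that, of "set es"] is_cycle_card[of G "set es"] by force
  have dir: "D = ?P \<union> ?Q \<or> D = ?P \<union> ?R \<or> D = ?Q \<union> ?R" if D: "is_cycle G D" "D \<subseteq> T" for D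
  proof -
    have "D \<noteq> ?P" "D \<noteq> ?Q" "D \<noteq> ?R" using np p D(1) by blast+
    moreover have "D \<noteq> T" using is_cycle_card(1)[OF D(1)] cV cT by auto
    moreover have "D \<noteq> {}" using is_cycle_card(2)[OF D(1)] .
    moreover have "D = (D \<inter> ?P) \<union> (D \<inter> ?Q) \<union> (D \<inter> ?R)" using D(2) T by blast
    moreover have "D \<inter> ?P = {} \<or> D \<inter> ?P = ?P" "D \<inter> ?Q = {} \<or> D \<inter> ?Q = ?Q" "D \<inter> ?R = {} \<or> D \<inter> ?R = ?R"
      using aon1[OF D] aon2[OF D] aon3[OF D] by blast+
    ultimately show ?thesis unfolding T by (metis Un_empty_left Un_empty_right)
  qed
  \<comment> \<open>A union of two paths has as many vertices as edges and so contains a cycle,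
    which by \<open>dir\<close> can only be that union itself.\<close>
  have ex: "\<exists>D. is_cycle G D \<and> D \<subseteq> A \<union> B"
    if "A \<union> B \<subseteq> T" "A \<noteq> {}" "card (vertices_of G (A \<union> B)) = card (A \<union> B)" for A B
    using exists_cycle[OF assms(2), of "A \<union> B"] that E by (metis Un_empty order_trans order_refl)
  have cc: "card (vertices_of G (?P \<union> ?Q)) = card (?P \<union> ?Q)"
    "card (vertices_of G (?P \<union> ?R)) = card (?P \<union> ?R)"
    "card (vertices_of G (?Q \<union> ?R)) = card (?Q \<union> ?R)"
    using two[OF i(1) c(1,2)] two[OF i(2) c(1,3)] two[OF i(3) c(2,3)] d
    by (simp_all add: V card_Un_disjoint)
  have neq: "?P \<noteq> {}" "?Q \<noteq> {}" "?R \<noteq> {}" using n by auto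
  obtain D1 where D1: "is_cycle G D1" "D1 \<subseteq> ?P \<union> ?Q" using ex[of ?P ?Q] cc neq T by auto
  obtain D2 where D2: "is_cycle G D2" "D2 \<subseteq> ?P \<union> ?R" using ex[of ?P ?R] cc neq T by auto
  obtain D3 where D3: "is_cycle G D3" "D3 \<subseteq> ?Q \<union> ?R" using ex[of ?Q ?R] cc neq T by auto
  have "D1 \<subseteq> T" "D2 \<subseteq> T" "D3 \<subseteq> T" using D1 D2 D3 T by blast+
  note D = dir[OF D1(1) this(1)] dir[OF D2(1) this(2)] dir[OF D3(1) this(3)]
  have "\<not> ?P \<subseteq> ?Q \<union> ?R" "\<not> ?Q \<subseteq> ?P \<union> ?R" "\<not> ?R \<subseteq> ?P \<union> ?Q" 
    using d neq by (metis Int_Un_distrib Un_empty inf.absorb_iff1 inf_commute)+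
  then have "D1 = ?P \<union> ?Q" "D2 = ?P \<union> ?R" "D3 = ?Q \<union> ?R"
    using D D1(2) D2(2) D3(2) by (metis Un_upper1 Un_upper2 order_trans)+
  then have cyc: "is_cycle G (?P \<union> ?Q)" "is_cycle G (?P \<union> ?R)" "is_cycle G (?Q \<union> ?R)"
    using D1 D2 D3 by auto
  show thesis
  proof (rule that[of ?P ?Q ?R])
    show "card T = Suc (card (vertices_of G T))" using cV cT by simp
    show "is_cycle G D \<and> D \<subseteq> T \<longleftrightarrow> D = ?P \<union> ?Q \<or> D = ?P \<union> ?R \<or> D = ?Q \<union> ?R" for D
      using dir[of D] cyc T by blast
  qed (use neq d T E in auto)
qed

section \<open>Two cycles with a common vertex\<close>

lemma is_cycle_rotate_to:
  assumes "cycle_lists G vs es" "k < length es"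
  obtains vs' es' where "cycle_lists G vs' es'" "set es' = set es" "vs' ! 0 = vs ! k" "es' ! 0 = es ! k"
proof (rule that[of "rotate k vs" "rotate k es"])
  show "cycle_lists G (rotate k vs) (rotate k es)" by (rule cycle_lists_rotate[OF assms(1)])
  have "length vs = length es" "0 < length es" using assms by (auto simp: cycle_lists_def)
  then show "rotate k vs ! 0 = vs ! k" "rotate k es ! 0 = es ! k"
    using assms(2) by (simp_all add: nth_rotate)
qed simp

lemma cycle_lists_initial_path:
  assumes "cycle_lists G vs es" "finite_multigraph G" "j < length es"
  shows "is_path G (vs ! 0) (take (Suc j) vs) (take j es) (vs ! j)"
proof -
  have l: "es \<noteq> []" "length vs = length es" "distinct vs" "distinct es" "set es \<subseteq> edges G"
    "\<And>i. i < length es \<Longrightarrow> ends G (es ! i) = {vs ! i, vs ! (Suc i mod length es)}"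
    using assms(1) by (auto simp: cycle_lists_def)
  have "set vs \<subseteq> verts G"
    using cycle_lists_vertices[OF assms(1)] vertices_of_subset_verts[OF assms(2) l(5)] by simp
  moreover have "hd (take (Suc j) vs) = vs ! 0" "last (take (Suc j) vs) = vs ! j"
  proof -
    have "vs \<noteq> []" "j < length vs" using l(1,2) assms(3) by auto
    then show "hd (take (Suc j) vs) = vs ! 0" "last (take (Suc j) vs) = vs ! j"
      by (simp add: hd_conv_nth) (simp add: take_Suc_conv_app_nth \<open>j < length vs\<close>)
  qed
  moreover have "set (take (Suc j) vs) \<subseteq> set vs" "set (take j es) \<subseteq> set es"
    using set_take_subset by fast+
  ultimately show ?thesis using l assms(3) by (auto simp: is_path_def)
qed

text \<open>The second arc runs from position \<open>j\<close> around to position 0. The condition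
  \<open>0 < j\<close> keeps the appended \<open>vs ! 0\<close> from repeating a vertex of
  \<open>drop j vs\<close>.\<close>

lemma cycle_lists_final_path:
  assumes "cycle_lists G vs es" "finite_multigraph G" "0 < j" "j < length es"
  shows "is_path G (vs ! j) (drop j vs @ [vs ! 0]) (drop j es) (vs ! 0)"
proof -
  have l: "es \<noteq> []" "length vs = length es" "distinct vs" "distinct es" "set es \<subseteq> edges G"
    and e: "\<And>i. i < length es \<Longrightarrow> ends G (es ! i) = {vs ! i, vs ! (Suc i mod length es)}"
    using assms(1) by (auto simp: cycle_lists_def)
  have sv: "set vs \<subseteq> verts G"
    using cycle_lists_vertices[OF assms(1)] vertices_of_subset_verts[OF assms(2) l(5)] by simp
  have v0: "vs ! 0 \<in> set vs" using l by simp
  have n0: "vs ! 0 \<notin> set (drop j vs)"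
    using l assms(3,4) by (auto simp: in_set_conv_nth nth_eq_iff_index_eq)
  have "ends G (drop j es ! i) = {(drop j vs @ [vs ! 0]) ! i, (drop j vs @ [vs ! 0]) ! Suc i}"
    if "i < length (drop j es)" for i
  proof (cases "Suc (j + i) < length es")
    case True
    then have "i < length (drop j vs)" "Suc i < length (drop j vs)" "Suc (j + i) mod length es = Suc (j + i)"
      using l(2) by auto
    then show ?thesis using e[of "j + i"] True assms(4) by (simp add: nth_append)
  next
    case False
    then have "Suc (j + i) = length es" using that by simp
    then have "i < length (drop j vs)" "Suc i = length (drop j vs)" "Suc (j + i) mod length es = 0"
      using l(2) by auto
    then show ?thesis using e[of "j + i"] \<open>Suc (j + i) = length es\<close> assms(4)
      by (simp only: nth_append nth_drop) simp
  qed
  then show ?thesis using l sv v0 n0 assms(3,4)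
    by (auto simp: is_path_def hd_append hd_drop_conv_nth dest!: in_set_dropD)
qed

text \<open>Once the cycle is rotated to start at \<open>u\<close>, the position of \<open>v\<close>
  cuts it into an initial path and a final path, and the latter is reversed.\<close>

lemma is_cycle_split:
  assumes "is_cycle G C" "finite_multigraph G" "u \<in> vertices_of G C" "v \<in> vertices_of G C" "u \<noteq> v"
  obtains vs1 es1 vs2 es2 where "is_path G u vs1 es1 v" "is_path G u vs2 es2 v"
    "set vs1 \<inter> set vs2 = {u, v}" "set es1 \<inter> set es2 = {}" "C = set es1 \<union> set es2"
    "set vs1 \<union> set vs2 = vertices_of G C"
proof -
  obtain vs0 es0 where l0: "cycle_lists G vs0 es0" "C = set es0"
    using assms by (auto simp: is_cycle_iff_lists)
  have "length vs0 = length es0" using l0 by (simp add: cycle_lists_def)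
  moreover have "u \<in> set vs0" using assms(3) cycle_lists_vertices[OF l0(1)] l0(2) by simp
  ultimately obtain k where k: "k < length es0" "u = vs0 ! k"
    by (auto simp: in_set_conv_nth)
  obtain vs es where l: "cycle_lists G vs es" "C = set es" "vs ! 0 = u"
    using is_cycle_rotate_to[OF l0(1) k(1)] l0(2) k(2) by metis
  have n: "length vs = length es" "distinct vs" "distinct es" using l by (auto simp: cycle_lists_def)
  have V: "vertices_of G C = set vs" using cycle_lists_vertices[OF l(1)] l(2) by simp
  obtain j where j: "j < length es" "v = vs ! j"
    using assms(4) V n by (auto simp: in_set_conv_nth)
  have j0: "0 < j" using assms(5) j l(3) by (cases j) auto
  let ?vs1 = "take (Suc j) vs" and ?vs2 = "rev (drop j vs @ [u])"
  show thesis
  proof (rule that[of ?vs1 "take j es" ?vs2 "rev (drop j es)"])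
    show "is_path G u ?vs1 (take j es) v"
      using cycle_lists_initial_path[OF l(1) assms(2) j(1)] l(3) j(2) by simp
    show "is_path G u ?vs2 (rev (drop j es)) v"
      using is_path_rev[OF cycle_lists_final_path[OF l(1) assms(2) j0 j(1)]] l(3) j(2) by simp
    have "set (take j vs) \<inter> set (drop j vs) = {}"
      using n(2) by (simp add: set_take_disj_set_drop_if_distinct)
    moreover have "set ?vs1 = insert v (set (take j vs))"
      using j n by (simp add: take_Suc_conv_app_nth)
    moreover have "v \<in> set (drop j vs)" using j n by (simp add: Cons_nth_drop_Suc[symmetric])
    moreover have "u \<in> set (take j vs)" using j0 j(1) n l(3) by (auto simp: in_set_conv_nth intro!: exI[of _ 0])
    ultimately show "set ?vs1 \<inter> set ?vs2 = {u, v}" by auto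
    show "set (take j es) \<inter> set (rev (drop j es)) = {}"
      using n(3) by (simp add: set_take_disj_set_drop_if_distinct)
    show "C = set (take j es) \<union> set (rev (drop j es))"
      using l(2) by (metis set_rev append_take_drop_id set_append)
    have "set vs = set (take j vs) \<union> set (drop j vs)" by (metis append_take_drop_id set_append)
    then show "set ?vs1 \<union> set ?vs2 = vertices_of G C"
      using V \<open>set ?vs1 = insert v (set (take j vs))\<close> \<open>v \<in> set (drop j vs)\<close> \<open>u \<in> set (take j vs)\<close>
      by auto
  qed
qed

text \<open>Leave \<open>C\<close> along an edge of \<open>C'\<close> and follow \<open>C'\<close>
  until it meets \<open>C\<close> again. Meeting \<open>C\<close> at another vertex yields an ear of
  \<open>C\<close>, hence a theta; coming back only at the starting vertex means that the cycles
  touch in that one vertex.\<close>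

lemma cycle_ear:
  assumes "is_cycle G C" "is_cycle G C'" "finite_multigraph G" "C \<noteq> C'"
    "vertices_of G C \<inter> vertices_of G C' \<noteq> {}"
  shows "(\<exists>T. is_theta G T \<and> C \<subseteq> T \<and> T \<subseteq> C \<union> C') \<or>
    (C \<inter> C' = {} \<and> card (vertices_of G C \<inter> vertices_of G C') = 1)"
proof -
  let ?W = "vertices_of G C"
  obtain vs0 es0 where l0: "cycle_lists G vs0 es0" "C' = set es0"
    using assms(2) by (auto simp: is_cycle_iff_lists)
  let ?n = "length es0"
  have n0: "length vs0 = ?n" using l0 by (simp add: cycle_lists_def)
  \<comment> \<open>If \<open>C'\<close> never left \<open>C\<close>, induction around
    \<open>C'\<close> would put all of it into \<open>C\<close>, and a cycle contains no other
    cycle.\<close>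
  have "\<exists>k<?n. vs0 ! k \<in> ?W \<and> es0 ! k \<notin> C"
  proof (rule ccontr)
    assume h: "\<not> ?thesis"
    obtain i0 where i0: "i0 < ?n" "vs0 ! i0 \<in> ?W"
      using assms(5) cycle_lists_vertices[OF l0(1)] l0(2) n0 by (auto simp: in_set_conv_nth)
    have all: "vs0 ! j \<in> ?W" if "j < ?n" for j
    proof (rule mod_closed_imp_all[OF i0(1), of "\<lambda>i. vs0 ! i \<in> ?W", OF i0(2) _ that])
      fix i assume i: "i < ?n" "vs0 ! i \<in> ?W"
      then have "es0 ! i \<in> C" using h by blast
      moreover have "vs0 ! (Suc i mod ?n) \<in> ends G (es0 ! i)"
        using l0(1) i(1) by (auto simp: cycle_lists_def)
      ultimately show "vs0 ! (Suc i mod ?n) \<in> ?W" by (auto simp: vertices_of_def)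
    qed
    then have "C' \<subseteq> C" using h l0(2) by (auto simp: in_set_conv_nth)
    then show False using is_cycle_subset_eq[OF assms(1,2)] assms(4) by blast
  qed
  then obtain k where k: "k < ?n" "vs0 ! k \<in> ?W" "es0 ! k \<notin> C" by blast
  obtain vs es where l: "cycle_lists G vs es" "set es = C'" "vs ! 0 \<in> ?W" "es ! 0 \<notin> C"
    using is_cycle_rotate_to[OF l0(1) k(1)] l0(2) k(2,3) by metis
  let ?m = "length es"
  have m: "?m > 0" "length vs = ?m" "distinct vs"
    and e: "\<And>i. i < ?m \<Longrightarrow> ends G (es ! i) = {vs ! i, vs ! (Suc i mod ?m)}"
    using l(1) by (auto simp: cycle_lists_def)
  have V': "vertices_of G C' = set vs" using cycle_lists_vertices[OF l(1)] l(2) by simp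
  \<comment> \<open>The first return to \<open>C\<close>; the value \<open>?m\<close>, the length of
    \<open>C'\<close>, stands for closing up with no return before the starting vertex.\<close>
  define i where "i = (LEAST i. i \<ge> 1 \<and> (i = ?m \<or> vs ! i \<in> ?W))"
  have i: "i \<ge> 1" "i = ?m \<or> vs ! i \<in> ?W" "i \<le> ?m"
    using LeastI[of "\<lambda>i. i \<ge> 1 \<and> (i = ?m \<or> vs ! i \<in> ?W)" ?m]
      Least_le[of "\<lambda>i. i \<ge> 1 \<and> (i = ?m \<or> vs ! i \<in> ?W)" ?m] m(1) unfolding i_def by auto
  have notW: "vs ! j \<notin> ?W" if "1 \<le> j" "j < i" for j
    using not_less_Least[of j "\<lambda>i. i \<ge> 1 \<and> (i = ?m \<or> vs ! i \<in> ?W)"] that unfolding i_def by blast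
  have notC: "es ! j \<notin> C" if "j < i" for j
  proof (cases "j = 0")
    case False
    then have "vs ! j \<notin> ?W" using notW that by simp
    moreover have "vs ! j \<in> ends G (es ! j)" using e[of j] that i(3) by simp
    ultimately show ?thesis by (auto simp: vertices_of_def)
  qed (use l in simp)
  show ?thesis
  proof (cases "i = ?m")
    case True
    have "C \<inter> C' = {}" using notC True l(2) by (auto simp: in_set_conv_nth)
    moreover have "w = vs ! 0" if w: "w \<in> ?W" "w \<in> set vs" for w
    proof -
      obtain j where "j < ?m" "w = vs ! j" using w(2) m(2) by (auto simp: in_set_conv_nth)
      then show ?thesis using notW[of j] True w(1) by (cases j) auto
    qed
    then have "?W \<inter> vertices_of G C' \<subseteq> {vs ! 0}" using V' by blast
    moreover have "vs ! 0 \<in> vertices_of G C'" using V' m(1,2) by simp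
    ultimately have "?W \<inter> vertices_of G C' = {vs ! 0}" using l(3) by blast
    moreover note \<open>C \<inter> C' = {}\<close>
    ultimately show ?thesis by simp
  next
    case False
    then have im: "i < ?m" "vs ! i \<in> ?W" using i by auto
    let ?u = "vs ! 0" and ?v = "vs ! i"
    have uv: "?u \<noteq> ?v" using m im i(1) by (simp add: nth_eq_iff_index_eq)
    obtain vs1 es1 vs2 es2 where p: "is_path G ?u vs1 es1 ?v" "is_path G ?u vs2 es2 ?v"
      "set vs1 \<inter> set vs2 = {?u, ?v}" "set es1 \<inter> set es2 = {}" "C = set es1 \<union> set es2"
      "set vs1 \<union> set vs2 = ?W"
      using is_cycle_split[OF assms(1,3) l(3) im(2) uv] by blast
    let ?vs3 = "take (Suc i) vs" and ?es3 = "take i es"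
    have p3: "is_path G ?u ?vs3 ?es3 ?v"
      by (rule cycle_lists_initial_path[OF l(1) assms(3) im(1)])
    have "w = ?u \<or> w = ?v" if w: "w \<in> set ?vs3" "w \<in> ?W" for w
    proof -
      obtain j where "j \<le> i" "w = vs ! j" using w(1) m(2) im(1)
        by (auto simp: in_set_conv_nth less_Suc_eq_le)
      then show ?thesis using notW[of j] w(2) by (cases "j = 0"; cases "j = i") auto
    qed
    then have v3: "set vs1 \<inter> set ?vs3 = {?u, ?v}" "set vs2 \<inter> set ?vs3 = {?u, ?v}"
      using p(6) is_path_ends_in[OF p(1)] is_path_ends_in[OF p(2)] is_path_ends_in[OF p3] by auto
    have e3: "set ?es3 \<inter> C = {}" using notC im(1) by (auto simp: in_set_conv_nth)
    have "is_theta G (C \<union> set ?es3)"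
      unfolding is_theta_def
      by (rule exI[of _ ?u], rule exI[of _ ?v], rule exI[of _ vs1], rule exI[of _ vs2], rule exI[of _ ?vs3],
          rule exI[of _ es1], rule exI[of _ es2], rule exI[of _ ?es3])
        (use uv p p3 v3 e3 in auto)
    moreover have "set ?es3 \<subseteq> C'" using set_take_subset[of i es] l(2) by simp
    ultimately show ?thesis by blast
  qed
qed

lemma theta_card:
  assumes "is_theta G T" "finite_multigraph G"
  shows "card T = Suc (card (vertices_of G T))" "T \<subseteq> edges G"
  by (rule theta_cycles[OF assms], assumption)+

lemma theta_two_cycles:
  assumes "is_theta G T" "finite_multigraph G"
  obtains C C' where "is_cycle G C" "is_cycle G C'" "C \<noteq> C'" "C \<subseteq> T" "C' \<subseteq> T"
proof (rule theta_cycles[OF assms])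
  fix P Q R
  assume h: "Q \<noteq> {}" "P \<inter> Q = {}" "Q \<inter> R = {}"
    and D: "\<And>D. is_cycle G D \<and> D \<subseteq> T \<longleftrightarrow> D = P \<union> Q \<or> D = P \<union> R \<or> D = Q \<union> R"
  have ne: "P \<union> Q \<noteq> P \<union> R" using h by blast
  have "is_cycle G (P \<union> Q) \<and> P \<union> Q \<subseteq> T" unfolding D by simp
  moreover have "is_cycle G (P \<union> R) \<and> P \<union> R \<subseteq> T" unfolding D by simp
  ultimately show thesis using that[OF _ _ ne] by simp
qed

text \<open>Any two of the three cycles have one of the three paths in common, and the other two
  paths form the third cycle.\<close>

lemma theta_cycle_pair:
  assumes "is_theta G T" "finite_multigraph G" "is_cycle G C" "C \<subseteq> T" "is_cycle G C'" "C' \<subseteq> T" "C \<noteq> C'"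
  shows "C \<union> C' = T" "C \<inter> C' \<noteq> {}" "is_cycle G ((C - C') \<union> (C' - C))"
    "(C - C') \<union> (C' - C) \<noteq> C" "(C - C') \<union> (C' - C) \<noteq> C'"
    "\<And>D. is_cycle G D \<Longrightarrow> D \<subseteq> T \<Longrightarrow> D = C \<or> D = C' \<or> D = (C - C') \<union> (C' - C)"
proof -
  obtain P Q R where *: "P \<noteq> {}" "Q \<noteq> {}" "R \<noteq> {}" "P \<inter> Q = {}" "P \<inter> R = {}" "Q \<inter> R = {}"
    "T = P \<union> Q \<union> R" "T \<subseteq> edges G" "card T = Suc (card (vertices_of G T))"
    and cyc: "\<And>D. is_cycle G D \<and> D \<subseteq> T \<longleftrightarrow> D = P \<union> Q \<or> D = P \<union> R \<or> D = Q \<union> R"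
    by (rule theta_cycles[OF assms(1,2)]) (rule that; assumption)
  have c: "C = P \<union> Q \<or> C = P \<union> R \<or> C = Q \<union> R" "C' = P \<union> Q \<or> C' = P \<union> R \<or> C' = Q \<union> R"
    using cyc assms(3-6) by blast+
  have sub: "\<not> P \<subseteq> Q \<union> R" "\<not> Q \<subseteq> P \<union> R" "\<not> R \<subseteq> P \<union> Q"
    using *(1-6) by (metis Int_Un_distrib Un_empty inf.absorb_iff1 inf_commute)+
  have n: "P \<union> Q \<noteq> P \<union> R" "P \<union> Q \<noteq> Q \<union> R" "P \<union> R \<noteq> Q \<union> R" using sub by blast+
  have s: "(P \<union> Q - (P \<union> R)) \<union> (P \<union> R - (P \<union> Q)) = Q \<union> R"
    "(P \<union> Q - (Q \<union> R)) \<union> (Q \<union> R - (P \<union> Q)) = P \<union> R"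
    "(P \<union> R - (Q \<union> R)) \<union> (Q \<union> R - (P \<union> R)) = P \<union> Q"
    using *(4-6) by blast+
  have s': "(P \<union> R - (P \<union> Q)) \<union> (P \<union> Q - (P \<union> R)) = Q \<union> R"
    "(Q \<union> R - (P \<union> Q)) \<union> (P \<union> Q - (Q \<union> R)) = P \<union> R"
    "(Q \<union> R - (P \<union> R)) \<union> (P \<union> R - (Q \<union> R)) = P \<union> Q"
    using *(4-6) by blast+
  let ?S = "(C - C') \<union> (C' - C)"
  have S: "(?S = P \<union> Q \<and> (C = P \<union> R \<and> C' = Q \<union> R \<or> C' = P \<union> R \<and> C = Q \<union> R)) \<or>
    (?S = P \<union> R \<and> (C = P \<union> Q \<and> C' = Q \<union> R \<or> C' = P \<union> Q \<and> C = Q \<union> R)) \<or>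
    (?S = Q \<union> R \<and> (C = P \<union> Q \<and> C' = P \<union> R \<or> C' = P \<union> Q \<and> C = P \<union> R))"
    using c assms(7) s s' by metis
  show "?S \<noteq> C" "?S \<noteq> C'" using S n by metis+
  show "C \<union> C' = T" using c assms(7) *(7) by blast
  have "(P \<union> Q) \<inter> (P \<union> R) \<noteq> {}" "(P \<union> Q) \<inter> (Q \<union> R) \<noteq> {}" "(P \<union> R) \<inter> (Q \<union> R) \<noteq> {}"
    using *(1-3) by blast+
  then show "C \<inter> C' \<noteq> {}" using S by (metis Int_commute)
  show "is_cycle G ?S" using cyc S by metis
  show "D = C \<or> D = C' \<or> D = ?S" if "is_cycle G D" "D \<subseteq> T" for D
  proof -
    have "D = P \<union> Q \<or> D = P \<union> R \<or> D = Q \<union> R" using cyc that by blast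
    then show ?thesis using S by metis
  qed
qed

text \<open>A common edge rules out that the cycles merely touch, so an ear of \<open>C\<close>
  gives a theta \<open>T\<close> inside the union. If \<open>T\<close> were smaller than the union,
  then \<open>C' \<inter> T\<close> would be a nonempty proper part of \<open>C'\<close>, with more
  vertices than edges. Inclusion-exclusion would then give the union at least two more edges than
  vertices.\<close>

lemma cycle_union_theta:
  assumes "is_cycle G C" "is_cycle G C'" "finite_multigraph G" "C \<noteq> C'" "C \<inter> C' \<noteq> {}"
    "card (C \<union> C') \<le> Suc (card (vertices_of G (C \<union> C')))"
  shows "is_theta G (C \<union> C')"
proof -
  note c = is_cycle_card[OF assms(1)] and c' = is_cycle_card[OF assms(2)]
  obtain g where g: "g \<in> C" "g \<in> C'" using assms(5) by auto
  have "ends G g \<noteq> {}" "ends G g \<subseteq> vertices_of G C" "ends G g \<subseteq> vertices_of G C'"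
    using card_ends(2)[OF assms(3)] g c(3) by (auto simp: vertices_of_def)
  then have "vertices_of G C \<inter> vertices_of G C' \<noteq> {}" by blast
  then obtain T where T: "is_theta G T" "C \<subseteq> T" "T \<subseteq> C \<union> C'"
    using cycle_ear[OF assms(1-4)] assms(5) by blast
  have "T = C \<union> C'"
  proof (rule ccontr)
    assume "T \<noteq> C \<union> C'"
    then have ps: "C' \<inter> T \<subset> C'" "C' \<inter> T \<noteq> {}" using T g by blast+
    have fT: "finite T" "finite C'" using T(3) c(4) c'(4) finite_subset by blast+
    have TE: "T \<subseteq> edges G" using T(3) c(3) c'(3) by blast
    note cT = theta_card(1)[OF T(1) assms(3)]
    have fV: "finite (vertices_of G T)" "finite (vertices_of G C')"
      using finite_vertices_of[OF assms(3)] TE c'(3) by auto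
    have "vertices_of G (C' \<inter> T) \<subseteq> vertices_of G C' \<inter> vertices_of G T"
      by (simp add: vertices_of_mono)
    then have "Suc (card (C' \<inter> T)) \<le> card (vertices_of G C' \<inter> vertices_of G T)"
      using is_cycle_proper_subset[OF assms(2) ps] fV
      by (meson Suc_leI card_mono finite_Int le_trans order.strict_trans2)
    moreover have "card (vertices_of G (C \<union> C')) + card (vertices_of G C' \<inter> vertices_of G T) = card C' + card (vertices_of G T)"
    proof -
      have "vertices_of G C \<subseteq> vertices_of G T" "vertices_of G T \<subseteq> vertices_of G (C \<union> C')"
        using T by (simp_all only: vertices_of_mono)
      then have "vertices_of G (C \<union> C') = vertices_of G C' \<union> vertices_of G T" by auto
      then show ?thesis using card_Un_Int[OF fV(2,1)] c'(1) by simp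
    qed
    moreover have "card (C \<union> C') + card (C' \<inter> T) = card C' + card T"
    proof -
      have "C \<union> C' = C' \<union> T" using T by blast
      then show ?thesis using card_Un_Int[OF fT(2,1)] by simp
    qed
    ultimately show False using cT assms(6) by linarith
  qed
  then show ?thesis using T by simp
qed

section \<open>The theta property as a count\<close>

text \<open>The theta property without thetas: a common edge and the bound on the number of edges
  are what makes the union of two cycles a theta, and the symmetric difference is then its third
  cycle.\<close>

definition theta_closed :: "('v, 'e) multigraph \<Rightarrow> 'e set set \<Rightarrow> bool" where
  "theta_closed G B \<longleftrightarrow> (\<forall>C\<in>B. \<forall>C'\<in>B. C \<noteq> C' \<and> C \<inter> C' \<noteq> {} \<and>
     card (C \<union> C') \<le> Suc (card (vertices_of G (C \<union> C'))) \<longrightarrow> (C - C') \<union> (C' - C) \<in> B)"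

text \<open>A theta has three cycles, so exactly two of them are balanced just when the symmetric
  difference of two balanced ones is unbalanced.\<close>

lemma biased_graph_iff:
  "biased_graph G B \<longleftrightarrow> finite_multigraph G \<and> (\<forall>C\<in>B. is_cycle G C) \<and> theta_closed G B"
proof (cases "finite_multigraph G \<and> (\<forall>C\<in>B. is_cycle G C)")
  case True
  then have fin: "finite_multigraph G" and B: "\<And>C. C \<in> B \<Longrightarrow> is_cycle G C" by auto
  have "(\<forall>T. is_theta G T \<longrightarrow> card {C \<in> B. C \<subseteq> T} \<noteq> 2) \<longleftrightarrow> theta_closed G B" (is "?l \<longleftrightarrow> _")
  proof
    assume ?l
    show "theta_closed G B"
      unfolding theta_closed_def
    proof (intro ballI impI)
      fix C C' assume h: "C \<in> B" "C' \<in> B" "C \<noteq> C' \<and> C \<inter> C' \<noteq> {} \<and>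
        card (C \<union> C') \<le> Suc (card (vertices_of G (C \<union> C')))"
      have th: "is_theta G (C \<union> C')" using cycle_union_theta[OF B B fin] h by blast
      note p = theta_cycle_pair[OF th fin B[OF h(1)] _ B[OF h(2)]]
      show "(C - C') \<union> (C' - C) \<in> B"
      proof (rule ccontr)
        assume n: "\<not> ?thesis"
        have "{D \<in> B. D \<subseteq> C \<union> C'} = {C, C'}" using p(6) B h n by blast
        then have "card {D \<in> B. D \<subseteq> C \<union> C'} = 2" using h(3) by simp
        then show False using \<open>?l\<close> th by blast
      qed
    qed
  next
    assume tc: "theta_closed G B"
    show ?l
    proof (intro allI impI notI)
      fix T assume T: "is_theta G T" and "card {C \<in> B. C \<subseteq> T} = 2"
      then obtain C C' where cc: "{C \<in> B. C \<subseteq> T} = {C, C'}" "C \<noteq> C'" by (auto simp: card_2_iff)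
      then have h: "C \<in> B" "C' \<in> B" "C \<subseteq> T" "C' \<subseteq> T" by blast+
      note p = theta_cycle_pair[OF T fin B[OF h(1)] h(3) B[OF h(2)] h(4) cc(2)]
      have "card T = Suc (card (vertices_of G T))" by (rule theta_card[OF T fin])
      then have "(C - C') \<union> (C' - C) \<in> B" 
        using tc[unfolded theta_closed_def, rule_format, OF h(1,2)] cc(2) p(1,2)
        by (simp del: vertices_of_Un)
      then have "(C - C') \<union> (C' - C) \<in> {C \<in> B. C \<subseteq> T}" using h by blast
      then show False unfolding cc(1) using p(4,5) by simp
    qed
  qed
  then show ?thesis using True by (simp add: biased_graph_def)
qed (auto simp: biased_graph_def)

section \<open>Circuits of the frame matroid\<close>

text \<open>The shape of a tight or loose handcuff with its two cycles exposed and without the bias,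
  so that its existence is a matter of the graph alone and the bias is consulted afterwards.\<close>

definition handcuff_of :: "('v, 'e) multigraph \<Rightarrow> 'e set \<Rightarrow> 'e set \<Rightarrow> 'e set \<Rightarrow> bool" where
  "handcuff_of G C C' X \<longleftrightarrow> is_cycle G C \<and> is_cycle G C' \<and>
     ((C \<inter> C' = {} \<and> card (vertices_of G C \<inter> vertices_of G C') = 1 \<and> X = C \<union> C') \<or>
      (\<exists>u vs es v. vertices_of G C \<inter> vertices_of G C' = {} \<and> is_path G u vs es v \<and>
         vertices_of G C \<inter> set vs = {u} \<and> vertices_of G C' \<inter> set vs = {v} \<and>
         X = C \<union> C' \<union> set es))"

lemma handcuff_iff:
  "tight_handcuff G B X \<or> loose_handcuff G B X \<longleftrightarrow>
     (\<exists>C C'. C \<notin> B \<and> C' \<notin> B \<and> handcuff_of G C C' X)"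
  (is "?t \<or> ?l \<longleftrightarrow> ?r")
proof
  assume "?t \<or> ?l"
  then show ?r
  proof
    assume ?t
    then obtain C C' where "unbalanced_cycle G B C" "unbalanced_cycle G B C'" "C \<inter> C' = {}"
      "card (vertices_of G C \<inter> vertices_of G C') = 1" "X = C \<union> C'"
      unfolding tight_handcuff_def by blast
    then show ?r by (intro exI[of _ C] exI[of _ C']) (auto simp: handcuff_of_def unbalanced_cycle_def)
  next
    assume ?l
    then obtain C C' u vs es v where "unbalanced_cycle G B C" "unbalanced_cycle G B C'"
      and h: "vertices_of G C \<inter> vertices_of G C' = {} \<and> is_path G u vs es v \<and>
        vertices_of G C \<inter> set vs = {u} \<and> vertices_of G C' \<inter> set vs = {v} \<and> X = C \<union> C' \<union> set es"
      unfolding loose_handcuff_def by blast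
    then have "C \<notin> B \<and> C' \<notin> B \<and> is_cycle G C \<and> is_cycle G C'" by (simp add: unbalanced_cycle_def)
    then show ?r unfolding handcuff_of_def using h
      by (intro exI[of _ C] exI[of _ C'] conjI disjI2 exI[of _ u] exI[of _ vs] exI[of _ es] exI[of _ v]) simp_all
  qed
next
  assume ?r
  then obtain C C' where "C \<notin> B \<and> C' \<notin> B" and h: "handcuff_of G C C' X" by blast
  then have u: "unbalanced_cycle G B C" "unbalanced_cycle G B C'"
    by (simp_all add: handcuff_of_def unbalanced_cycle_def)
  from h consider "C \<inter> C' = {} \<and> card (vertices_of G C \<inter> vertices_of G C') = 1 \<and> X = C \<union> C'"
    | u vs es v where "vertices_of G C \<inter> vertices_of G C' = {} \<and> is_path G u vs es v \<and>
         vertices_of G C \<inter> set vs = {u} \<and> vertices_of G C' \<inter> set vs = {v} \<and> X = C \<union> C' \<union> set es"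
    unfolding handcuff_of_def by blast
  then show "?t \<or> ?l"
  proof cases
    case 1
    then have ?t unfolding tight_handcuff_def using u by (intro exI[of _ C] exI[of _ C']) simp
    then show ?thesis ..
  next
    case (2 x vs es y)
    then have ?l unfolding loose_handcuff_def using u
      by (intro exI[of _ C] exI[of _ C'] exI[of _ x] exI[of _ vs] exI[of _ es] exI[of _ y]) simp
    then show ?thesis ..
  qed
qed

lemma card_Un3_disjoint:
  assumes "finite A" "finite B" "finite C" "A \<inter> B = {}" "A \<inter> C = {}" "B \<inter> C = {}"
  shows "card (A \<union> B \<union> C) = card A + card B + card C"
proof -
  have "(A \<union> B) \<inter> C = {}" using assms(5,6) by blast
  then have 1: "card (A \<union> B \<union> C) = card (A \<union> B) + card C"
    using assms(1-3) by (intro card_Un_disjoint finite_UnI)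
  have "card (A \<union> B) = card A + card B" using assms(1,2,4) by (rule card_Un_disjoint)
  with 1 show ?thesis by (simp only:)
qed

text \<open>The one shared vertex makes the edges outnumber the vertices by one. A third cycle would
  meet both \<open>C\<close> and \<open>C'\<close> in nonempty proper parts; each part has a vertex
  to spare and the parts share at most one vertex, so the third cycle would have more vertices than
  edges.\<close>

lemma tight_handcuff_props:
  assumes "is_cycle G C" "is_cycle G C'" "finite_multigraph G" "C \<inter> C' = {}"
    "card (vertices_of G C \<inter> vertices_of G C') = 1"
  shows "card (C \<union> C') = Suc (card (vertices_of G (C \<union> C')))"
    "\<And>D. is_cycle G D \<Longrightarrow> D \<subseteq> C \<union> C' \<Longrightarrow> D = C \<or> D = C'"
proof -
  note c = is_cycle_card[OF assms(1)] and c' = is_cycle_card[OF assms(2)]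
  have fV: "finite (vertices_of G C)" "finite (vertices_of G C')"
    using finite_vertices_of[OF assms(3)] c(3) c'(3) by auto
  show "card (C \<union> C') = Suc (card (vertices_of G (C \<union> C')))"
    using card_Un_Int[OF fV] card_Un_disjoint[OF c(4) c'(4) assms(4)] c(1) c'(1) assms(5) by simp
  fix D assume D: "is_cycle G D" "D \<subseteq> C \<union> C'"
  show "D = C \<or> D = C'"
  proof (rule ccontr)
    assume n: "\<not> ?thesis"
    have n1: "\<not> C \<subseteq> D" "\<not> C' \<subseteq> D" "\<not> D \<subseteq> C" "\<not> D \<subseteq> C'"
      using is_cycle_subset_eq[OF D(1)] is_cycle_subset_eq[OF _ D(1)] assms(1,2) n by blast+
    have ps: "D \<inter> C \<subset> C" "D \<inter> C \<noteq> {}" "D \<inter> C' \<subset> C'" "D \<inter> C' \<noteq> {}" using n1 D(2) by blast+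
    note l = is_cycle_proper_subset[OF assms(1) ps(1,2)] is_cycle_proper_subset[OF assms(2) ps(3,4)]
    have sub: "vertices_of G (D \<inter> C) \<subseteq> vertices_of G C" "vertices_of G (D \<inter> C') \<subseteq> vertices_of G C'"
      by (simp_all add: vertices_of_mono)
    have f: "finite (vertices_of G (D \<inter> C))" "finite (vertices_of G (D \<inter> C'))"
      using finite_subset[OF sub(1) fV(1)] finite_subset[OF sub(2) fV(2)] .
    have "card (vertices_of G (D \<inter> C) \<inter> vertices_of G (D \<inter> C')) \<le> 1"
      using card_mono[of "vertices_of G C \<inter> vertices_of G C'"] sub fV assms(5)
      by (metis Int_mono finite_Int)
    moreover have De: "D = (D \<inter> C) \<union> (D \<inter> C')" using D(2) by blast
    then have "vertices_of G D = vertices_of G (D \<inter> C) \<union> vertices_of G (D \<inter> C')"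
      by (metis vertices_of_Un)
    moreover have "card D = card (D \<inter> C) + card (D \<inter> C')"
      using De card_Un_disjoint[of "D \<inter> C" "D \<inter> C'"] c(4) c'(4) assms(4) by auto
    ultimately show False using card_Un_Int[OF f] l is_cycle_card(1)[OF D(1)] by simp
  qed
qed

text \<open>The counts rest on one observation: the complete path brings one inner vertex fewer than
  it has edges, while any incomplete set of its edges touches at least as many inner vertices as it
  has edges.\<close>

lemma loose_handcuff_props:
  assumes "is_cycle G C" "is_cycle G C'" "finite_multigraph G"
    "vertices_of G C \<inter> vertices_of G C' = {}" "is_path G u vs es v"
    "vertices_of G C \<inter> set vs = {u}" "vertices_of G C' \<inter> set vs = {v}"
  shows "C \<inter> C' = {}" "card (C \<union> C' \<union> set es) = Suc (card (vertices_of G (C \<union> C' \<union> set es)))"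
    "\<And>D. is_cycle G D \<Longrightarrow> D \<subseteq> C \<union> C' \<union> set es \<Longrightarrow> D = C \<or> D = C'"
    "\<And>Z. C \<union> C' \<subseteq> Z \<Longrightarrow> Z \<subset> C \<union> C' \<union> set es \<Longrightarrow> card Z \<le> card (vertices_of G Z)"
proof -
  note c = is_cycle_card[OF assms(1)] and c' = is_cycle_card[OF assms(2)]
  let ?V = "vertices_of G"
  have fV: "finite (?V C)" "finite (?V C')"
    using finite_vertices_of[OF assms(3)] c(3) c'(3) by auto
  have p: "length vs = Suc (length es)" "distinct vs" "set es \<subseteq> edges G"
    "\<And>i. i < length es \<Longrightarrow> ends G (es ! i) = {vs ! i, vs ! Suc i}"
    using assms(5) by (auto simp: is_path_def)
  have e2: "card (ends G g) = 2 \<and> ends G g \<subseteq> set vs" if g: "g \<in> set es" for g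
  proof -
    obtain i where "i < length es" "g = es ! i" using g by (auto simp: in_set_conv_nth)
    then show ?thesis using p by (simp add: nth_eq_iff_index_eq)
  qed
  have one: "\<not> ends G g \<subseteq> {w}" if g: "g \<in> set es" for g w
    using e2[OF g] card_mono[of "{w}" "ends G g"] by auto
  have endsC: "ends G g \<subseteq> ?V X" if "g \<in> X" for g X using that by (auto simp: vertices_of_def)
  show CC: "C \<inter> C' = {}"
  proof (rule ccontr)
    assume "C \<inter> C' \<noteq> {}"
    then obtain g where g: "g \<in> C" "g \<in> C'" by blast
    then show False using endsC[OF g(1)] endsC[OF g(2)] assms(4) card_ends(2)[OF assms(3), of g] c(3) by blast
  qed
  have CP: "C \<inter> set es = {}" "C' \<inter> set es = {}"
    using endsC e2 one assms(6,7) by (metis Int_greatest disjoint_iff)+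
  have uv: "u \<noteq> v" using assms(4,6,7) by blast
  have ne: "es \<noteq> []" using is_path_nth_ends[OF assms(5)] uv by auto
  have VP: "?V (set es) = set vs" by (rule is_path_vertices(2)[OF assms(5) ne])
  have cvs: "card (set vs) = Suc (card (set es))" by (rule is_path_card[OF assms(5)])
  have cE: "card (C \<union> C' \<union> set es) = card C + card C' + card (set es)"
    using card_Un3_disjoint[OF c(4) c'(4) _ CC CP] by simp
  have "?V (C \<union> C' \<union> set es) = ?V C \<union> ?V C' \<union> (set vs - {u, v})"
    using VP assms(6,7) by auto
  moreover have "card (?V C \<union> ?V C' \<union> (set vs - {u, v})) = card (?V C) + card (?V C') + card (set vs - {u, v})"
    using assms(4,6,7) fV by (intro card_Un3_disjoint) auto
  moreover have "card (set vs - {u, v}) = card (set vs) - 2"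
    using card_Diff_subset[of "{u, v}" "set vs"] is_path_ends_in[OF assms(5)] uv by simp
  moreover have "card (set es) \<ge> 1" using ne by (simp add: Suc_leI card_gt_0_iff)
  ultimately show "card (C \<union> C' \<union> set es) = Suc (card (?V (C \<union> C' \<union> set es)))"
    using cE cvs c(1) c'(1) by simp
  \<comment> \<open>With the path incomplete, its edges are paid for by inner vertices, which lie on
    neither cycle.\<close>
  have part: "card (?V X) + card (?V X') + card P \<le> card (?V (X \<union> X' \<union> P))"
    if "X \<subseteq> C" "X' \<subseteq> C'" "P \<subset> set es" for X X' P
  proof -
    have sub: "?V X \<subseteq> ?V C" "?V X' \<subseteq> ?V C'" "?V P \<subseteq> set vs"
      using vertices_of_mono[OF that(1), of G] vertices_of_mono[OF that(2), of G]
        vertices_of_mono[of P "set es" G] that(3) VP by blast+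
    then have f: "finite (?V X)" "finite (?V X')" "finite (?V P)"
      using finite_subset[OF sub(1) fV(1)] finite_subset[OF sub(2) fV(2)] finite_subset[OF sub(3)] by simp_all
    have "card (?V X) + card (?V X') + card P \<le> card (?V X) + card (?V X') + card (?V P - {u, v})"
      using is_path_proper_subset[OF assms(5) that(3)] by simp
    also have "\<dots> = card (?V X \<union> ?V X' \<union> (?V P - {u, v}))"
      using sub f assms(4,6,7) by (intro card_Un3_disjoint[symmetric]) auto
    also have "\<dots> \<le> card (?V (X \<union> X' \<union> P))" using f by (intro card_mono) auto
    finally show ?thesis .
  qed
  show "card Z \<le> card (?V Z)" if Z: "C \<union> C' \<subseteq> Z" "Z \<subset> C \<union> C' \<union> set es" for Z
  proof -
    have Ze: "Z = C \<union> C' \<union> (Z \<inter> set es)" and ps: "Z \<inter> set es \<subset> set es" using Z by blast+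
    have "card (C \<union> C' \<union> (Z \<inter> set es)) = card C + card C' + card (Z \<inter> set es)"
      using CC CP by (intro card_Un3_disjoint c(4) c'(4)) auto
    then show ?thesis using part[OF subset_refl subset_refl ps] Ze c(1) c'(1) by simp
  qed
  fix D assume D: "is_cycle G D" "D \<subseteq> C \<union> C' \<union> set es"
  show "D = C \<or> D = C'"
  proof (rule ccontr)
    assume n: "\<not> ?thesis"
    have n1: "\<not> C \<subseteq> D" "\<not> C' \<subseteq> D"
      using is_cycle_subset_eq[OF D(1)] assms(1,2) n by blast+
    then have ps: "D \<inter> C \<subset> C" "D \<inter> C' \<subset> C'" by blast+
    have De: "D = (D \<inter> C) \<union> (D \<inter> C') \<union> (D \<inter> set es)" using D(2) by blast
    have cD: "card D = card (D \<inter> C) + card (D \<inter> C') + card (D \<inter> set es)"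
      using CC CP c(4) c'(4) by (subst De, intro card_Un3_disjoint) auto
    have VD: "?V D = ?V (D \<inter> C) \<union> ?V (D \<inter> C') \<union> ?V (D \<inter> set es)"
      by (subst De) simp
    have l: "D \<inter> C = {} \<or> card (D \<inter> C) < card (?V (D \<inter> C))"
      "D \<inter> C' = {} \<or> card (D \<inter> C') < card (?V (D \<inter> C'))"
      using is_cycle_proper_subset[OF assms(1) ps(1)] is_cycle_proper_subset[OF assms(2) ps(2)] by blast+
    show False
    proof (cases "D \<inter> set es = set es")
      case False
      then have "card (?V (D \<inter> C)) + card (?V (D \<inter> C')) + card (D \<inter> set es) \<le> card (?V D)"
        using part[of "D \<inter> C" "D \<inter> C'" "D \<inter> set es"] De by auto
      then have "D \<inter> C = {}" "D \<inter> C' = {}"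
        using l cD is_cycle_card(1)[OF D(1)] by (fastforce)+
      then have "D \<subseteq> set es" using De by blast
      then show False using is_path_acyclic[OF assms(5), of D] is_cycle_card[OF D(1)] by simp
    next
      case True
      have sub: "?V (D \<inter> C) \<subseteq> ?V C" "?V (D \<inter> C') \<subseteq> ?V C'"
        by (simp_all add: vertices_of_mono)
      have f: "finite (?V (D \<inter> C))" "finite (?V (D \<inter> C'))"
        using finite_subset[OF sub(1) fV(1)] finite_subset[OF sub(2) fV(2)] .
      \<comment> \<open>The whole path lies in \<open>D\<close> and pays for itself with one vertex
        to spare, if \<open>u\<close> and \<open>v\<close> are counted with it. The parts of
        \<open>D\<close> on the two cycles can give up these vertices, because each part is empty or
        has more vertices than edges.\<close>
      have "card (D \<inter> C) \<le> card (?V (D \<inter> C) - {u})" "card (D \<inter> C') \<le> card (?V (D \<inter> C') - {v})"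
        using l by (auto simp: card_Diff_singleton_if)
      moreover have "card ((?V (D \<inter> C) - {u}) \<union> (?V (D \<inter> C') - {v}) \<union> set vs)
          = card (?V (D \<inter> C) - {u}) + card (?V (D \<inter> C') - {v}) + card (set vs)"
        using sub f assms(4,6,7) by (intro card_Un3_disjoint) auto
      moreover have "?V D = (?V (D \<inter> C) - {u}) \<union> (?V (D \<inter> C') - {v}) \<union> set vs"
        using VD True VP is_path_ends_in[OF assms(5)] by auto
      ultimately show False using cD True cvs is_cycle_card(1)[OF D(1)] by simp
    qed
  qed
qed

text \<open>Both shapes at once. The last claim has content for loose handcuffs: no proper subset of
  a tight one contains both of its cycles.\<close>

lemma handcuff_of_props:
  assumes "handcuff_of G C C' X" "finite_multigraph G"
  shows "is_cycle G C" "is_cycle G C'" "C \<noteq> C'" "C \<union> C' \<subseteq> X" "X \<subseteq> edges G"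
    "card X = Suc (card (vertices_of G X))"
    "\<And>D. is_cycle G D \<Longrightarrow> D \<subseteq> X \<Longrightarrow> D = C \<or> D = C'"
    "\<And>Z. C \<union> C' \<subseteq> Z \<Longrightarrow> Z \<subset> X \<Longrightarrow> card Z \<le> card (vertices_of G Z)"
proof -
  show cyc: "is_cycle G C" "is_cycle G C'" using assms(1) by (auto simp: handcuff_of_def)
  note c = is_cycle_card[OF cyc(1)] and c' = is_cycle_card[OF cyc(2)]
  have "C \<noteq> C' \<and> C \<union> C' \<subseteq> X \<and> X \<subseteq> edges G \<and> card X = Suc (card (vertices_of G X)) \<and>
    (\<forall>D. is_cycle G D \<longrightarrow> D \<subseteq> X \<longrightarrow> D = C \<or> D = C') \<and>
    (\<forall>Z. C \<union> C' \<subseteq> Z \<longrightarrow> Z \<subset> X \<longrightarrow> card Z \<le> card (vertices_of G Z))"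
  proof (cases "C \<inter> C' = {} \<and> card (vertices_of G C \<inter> vertices_of G C') = 1 \<and> X = C \<union> C'")
    case True
    then have h: "C \<inter> C' = {}" "card (vertices_of G C \<inter> vertices_of G C') = 1" "X = C \<union> C'" by auto
    show ?thesis unfolding h(3)
      using tight_handcuff_props[OF cyc assms(2) h(1,2)] h(1) c(2,3) c'(3) by blast
  next
    case False
    then obtain u vs es v where h: "vertices_of G C \<inter> vertices_of G C' = {}" "is_path G u vs es v"
      "vertices_of G C \<inter> set vs = {u}" "vertices_of G C' \<inter> set vs = {v}" "X = C \<union> C' \<union> set es"
      using assms(1) unfolding handcuff_of_def by blast
    have "set es \<subseteq> edges G" using h(2) by (simp add: is_path_def)
    then have "X \<subseteq> edges G" using h(5) c(3) c'(3) by simp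
    moreover note lp = loose_handcuff_props[OF cyc assms(2) h(1-4), folded h(5)]
    moreover have "C \<noteq> C'" using lp(1) c(2) by auto
    moreover have "C \<union> C' \<subseteq> X" using h(5) by simp
    ultimately show ?thesis by (intro conjI allI impI)
  qed
  then show "C \<noteq> C'" "C \<union> C' \<subseteq> X" "X \<subseteq> edges G" "card X = Suc (card (vertices_of G X))"
    "\<And>D. is_cycle G D \<Longrightarrow> D \<subseteq> X \<Longrightarrow> D = C \<or> D = C'"
    "\<And>Z. C \<union> C' \<subseteq> Z \<Longrightarrow> Z \<subset> X \<Longrightarrow> card Z \<le> card (vertices_of G Z)" by blast+
qed

section \<open>Edge sets that outnumber their vertices\<close>

text \<open>A shortest path in \<open>Y\<close> from one cycle to the other meets each of them only
  in its end, since otherwise a piece of it would be shorter.\<close>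

lemma disjoint_cycles_joined:
  assumes "finite_multigraph G" "Y \<subseteq> edges G" "is_cycle G C" "is_cycle G C'" "C \<subseteq> Y" "C' \<subseteq> Y"
    "vertices_of G C \<inter> vertices_of G C' = {}"
    "u \<in> vertices_of G C" "v \<in> vertices_of G C'" "(u, v) \<in> reach G Y"
  shows "\<exists>X\<subseteq>Y. handcuff_of G C C' X"
proof -
  \<comment> \<open>Both end vertices are bound anew inside \<open>Q\<close>, so the minimum ranges
    over all pairs of vertices of the two cycles.\<close>
  define Q where "Q n \<longleftrightarrow> (\<exists>u vs es v. is_path G u vs es v \<and> set es \<subseteq> Y \<and> u \<in> vertices_of G C \<and>
    v \<in> vertices_of G C' \<and> length es = n)" for n
  have "u \<in> verts G"
    using assms(8) vertices_of_subset_verts[OF assms(1) is_cycle_card(3)[OF assms(3)]] by blast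
  from reach_path[OF assms(10,2) this assms(1)] have "\<exists>n. Q n"
    using assms(8,9) unfolding Q_def by blast
  then have Q: "Q (LEAST n. Q n)" by (rule LeastI_ex)
  then obtain u vs es v where p: "is_path G u vs es v" "set es \<subseteq> Y" "u \<in> vertices_of G C"
    "v \<in> vertices_of G C'" "length es = (LEAST n. Q n)" unfolding Q_def by blast
  have min: "length es \<le> n" if "Q n" for n using Least_le[of Q, OF that] p(5) by simp
  note uv = is_path_nth_ends[OF p(1)]
  have lv: "length vs = Suc (length es)" using p(1) by (simp add: is_path_def)
  have "w = u" if w: "w \<in> vertices_of G C" "w \<in> set vs" for w
  proof -
    obtain i where i: "i < length vs" "w = vs ! i" using w(2) by (auto simp: in_set_conv_nth)
    have "set (drop i es) \<subseteq> Y" using p(2) set_drop_subset by fast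
    then have "Q (length es - i)" unfolding Q_def using is_path_drop[OF p(1) i(1)] p(4) w(1) i(2)
      by (metis length_drop)
    then have "i = 0" using min[of "length es - i"] i(1) lv by linarith
    then show ?thesis using i(2) uv(1) by simp
  qed
  moreover have "w = v" if w: "w \<in> vertices_of G C'" "w \<in> set vs" for w
  proof -
    obtain i where i: "i < length vs" "w = vs ! i" using w(2) by (auto simp: in_set_conv_nth)
    have "set (take i es) \<subseteq> Y" using p(2) set_take_subset by fast
    moreover have "length (take i es) = i" using i(1) lv by simp
    ultimately have "Q i" unfolding Q_def using is_path_take[OF p(1) i(1)] p(3) w(1) i(2) by metis
    then have "i = length es" using min[of i] i(1) lv by simp
    then show ?thesis using i(2) uv(2) by simp
  qed
  ultimately have "vertices_of G C \<inter> set vs = {u}" "vertices_of G C' \<inter> set vs = {v}"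
    using is_path_ends_in[OF p(1)] p(3,4) by blast+
  then have "handcuff_of G C C' (C \<union> C' \<union> set es)"
    using assms(3,4,7) p(1) unfolding handcuff_of_def by blast
  moreover have "C \<union> C' \<union> set es \<subseteq> Y" using p(2) assms(5,6) by simp
  ultimately show ?thesis by blast
qed

text \<open>By induction no proper subset of \<open>Y\<close> outnumbers its vertices. An edge of a
  first cycle can be deleted and a second cycle still remains. Cycles that meet give a theta or a
  tight handcuff through an ear; disjoint ones are joined by a path, as \<open>Y\<close> cannot fall
  apart.\<close>

lemma overfull_contains:
  assumes "finite_multigraph G" "Y \<subseteq> edges G" "card (vertices_of G Y) < card Y"
  shows "\<exists>X\<subseteq>Y. is_theta G X \<or> (\<exists>C C'. handcuff_of G C C' X)"
  using assms(2,3)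
proof (induction "card Y" arbitrary: Y rule: less_induct)
  case less
  note finY = finite_edges_subset[OF assms(1) less.prems(1)]
  show ?case
  proof (cases "\<exists>Y'\<subset>Y. card (vertices_of G Y') < card Y'")
    case True
    then obtain Y' where Y': "Y' \<subset> Y" "card (vertices_of G Y') < card Y'" by blast
    then show ?thesis using less.hyps[OF psubset_card_mono[OF finY Y'(1)]] less.prems(1) by (meson order_trans psubset_imp_subset)
  next
    case False
    have ne: "Y \<noteq> {}" using less.prems(2) by auto
    obtain C where C: "is_cycle G C" "C \<subseteq> Y"
      using exists_cycle[OF assms(1) less.prems(1) ne] less.prems(2) by auto
    obtain f where f: "f \<in> C" using is_cycle_card(2)[OF C(1)] by auto
    let ?Y = "Y - {f}"
    have sub: "?Y \<subseteq> edges G" using less.prems by auto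
    have cY: "Suc (card ?Y) = card Y" using f C(2) finY by (intro card_Suc_Diff1) auto
    have le: "card (vertices_of G ?Y) \<le> card ?Y"
      using card_vertices_of_mono[OF assms(1) less.prems(1), of ?Y] less.prems(2) cY by auto
    \<comment> \<open>A vertex exists, so \<open>Y\<close> has at least two edges and the rest
      \<open>?Y\<close> is not empty.\<close>
    have "vertices_of G Y \<noteq> {}" using vertices_of_eq_empty_iff[OF assms(1) less.prems(1)] ne by simp
    then have "card (vertices_of G Y) \<noteq> 0" using finite_vertices_of[OF assms(1) less.prems(1)] by simp
    then have "card ?Y \<noteq> 0" using less.prems(2) cY by linarith
    then have "?Y \<noteq> {}" by (metis card.empty)
    then obtain C' where C': "is_cycle G C'" "C' \<subseteq> ?Y"
      using exists_cycle[OF assms(1) sub _ le] by auto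
    have CC: "C \<noteq> C'" and C'Y: "C' \<subseteq> Y" using f C' by auto
    show ?thesis
    proof (cases "vertices_of G C \<inter> vertices_of G C' = {}")
      case V: False
      from cycle_ear[OF C(1) C'(1) assms(1) CC V] show ?thesis
      proof
        assume "\<exists>T. is_theta G T \<and> C \<subseteq> T \<and> T \<subseteq> C \<union> C'"
        then obtain T where "is_theta G T" "T \<subseteq> C \<union> C'" by blast
        then show ?thesis using C(2) C'Y by (intro exI[of _ T]) auto
      next
        assume "C \<inter> C' = {} \<and> card (vertices_of G C \<inter> vertices_of G C') = 1"
        then have "handcuff_of G C C' (C \<union> C')" using C(1) C'(1) by (auto simp: handcuff_of_def)
        then show ?thesis using C(2) C'Y by blast
      qed
    next
      case V: True
      have vne: "vertices_of G C \<noteq> {}" "vertices_of G C' \<noteq> {}"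
        using vertices_of_eq_empty_iff[OF assms(1)] is_cycle_card(2,3)[OF C(1)] is_cycle_card(2,3)[OF C'(1)]
        by blast+
      then obtain u where u: "u \<in> vertices_of G C" by blast
      define R where "R = {w. (u, w) \<in> reach G Y}"
      \<comment> \<open>If \<open>C'\<close> were not reached from \<open>C\<close>, then
        \<open>Y\<close> would split into two proper parts with disjoint vertex sets. Neither part
        outnumbers its vertices, so neither would \<open>Y\<close>.\<close>
      have "vertices_of G C' \<inter> R \<noteq> {}"
      proof
        assume dis: "vertices_of G C' \<inter> R = {}"
        define Y1 where "Y1 = {g \<in> Y. ends G g \<inter> R \<noteq> {}}"
        define Y2 where "Y2 = Y - Y1"
        have uR: "u \<in> R" using reach_refl by (simp add: R_def)
        have V1: "vertices_of G Y1 \<subseteq> R"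
          using reach_step[OF _ _ _ _ assms(1) less.prems(1)]
          by (fastforce simp: R_def Y1_def vertices_of_def)
        have V2: "vertices_of G Y2 \<inter> R = {}" by (auto simp: Y2_def Y1_def vertices_of_def)
        obtain g where g: "g \<in> C" "u \<in> ends G g" using u by (auto simp: vertices_of_def)
        then have "g \<in> Y1" using uR C(2) by (auto simp: Y1_def)
        then have "Y2 \<subset> Y" by (auto simp: Y2_def Y1_def)
        moreover have "C' \<subseteq> Y2" using dis C'Y by (auto simp: Y2_def Y1_def vertices_of_def)
        then have "Y1 \<subset> Y" using is_cycle_card(2)[OF C'(1)] by (auto simp: Y2_def Y1_def)
        ultimately have le: "card Y1 \<le> card (vertices_of G Y1)" "card Y2 \<le> card (vertices_of G Y2)"
          using False by (meson not_le)+
        have sub: "Y1 \<subseteq> Y" "Y2 \<subseteq> Y" by (auto simp: Y1_def Y2_def)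
        then have "finite (vertices_of G Y1)" "finite (vertices_of G Y2)"
          using finite_vertices_of[OF assms(1)] less.prems(1) by (meson order_trans)+
        then have "card (vertices_of G Y1) + card (vertices_of G Y2) = card (vertices_of G (Y1 \<union> Y2))"
          unfolding vertices_of_Un using V1 V2 by (intro card_Un_disjoint[symmetric]) auto
        moreover have "Y1 \<union> Y2 = Y" by (auto simp: Y1_def Y2_def)
        moreover have "card Y = card Y1 + card Y2"
          using card_Diff_subset[OF _ sub(1)] card_mono[OF finY sub(1)] finite_subset[OF sub(1) finY]
          unfolding Y2_def by simp
        ultimately show False using le less.prems(2) by simp
      qed
      then obtain v where "v \<in> vertices_of G C'" "(u, v) \<in> reach G Y" by (auto simp: R_def)
      from disjoint_cycles_joined[OF assms(1) less.prems(1) C(1) C'(1) C(2) C'Y V u this]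
      show ?thesis by blast
    qed
  qed
qed

text \<open>Serves the minimality of circuits: in a theta two different cycles cover everything, and
  a handcuff has only two cycles, so a subset that outnumbers its vertices is forced to be
  large.\<close>

lemma overfull_two_cycles:
  assumes "finite_multigraph G" "Y \<subseteq> edges G" "card (vertices_of G Y) < card Y"
  obtains C C' where "is_cycle G C" "is_cycle G C'" "C \<noteq> C'" "C \<subseteq> Y" "C' \<subseteq> Y"
proof -
  obtain X where X: "X \<subseteq> Y" "is_theta G X \<or> (\<exists>C C'. handcuff_of G C C' X)"
    using overfull_contains[OF assms] by blast
  from X(2) show thesis
  proof
    assume "is_theta G X"
    from theta_two_cycles[OF this assms(1)] obtain C C' where
      "is_cycle G C" "is_cycle G C'" "C \<noteq> C'" "C \<subseteq> X" "C' \<subseteq> X" .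
    then show thesis using that[of C C'] X(1) by auto
  next
    assume "\<exists>C C'. handcuff_of G C C' X"
    then obtain C C' where "handcuff_of G C C' X" by blast
    from handcuff_of_props(1-4)[OF this assms(1)] show thesis using that[of C C'] X(1) by auto
  qed
qed

section \<open>Dependent sets and circuits\<close>

text \<open>The negation is the familiar description of independence: no balanced cycle, and at most
  one cycle in every component.\<close>

definition dependent :: "('v, 'e) multigraph \<Rightarrow> 'e set set \<Rightarrow> 'e set \<Rightarrow> bool" where
  "dependent G B X \<longleftrightarrow> (\<exists>C\<in>B. C \<subseteq> X) \<or> (\<exists>Z\<subseteq>X. card (vertices_of G Z) < card Z)"

lemma dependent_mono: 
  assumes "dependent G B X" "X \<subseteq> Y"
  shows "dependent G B Y"
  using assms(1) unfolding dependent_def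
proof (elim disjE bexE exE conjE)
  fix C assume "C \<in> B" "C \<subseteq> X"
  then show "(\<exists>C\<in>B. C \<subseteq> Y) \<or> (\<exists>Z\<subseteq>Y. card (vertices_of G Z) < card Z)" using assms(2) by blast
next
  fix Z assume "Z \<subseteq> X" "card (vertices_of G Z) < card Z"
  moreover from this have "Z \<subseteq> Y" using assms(2) by simp
  ultimately show "(\<exists>C\<in>B. C \<subseteq> Y) \<or> (\<exists>Z\<subseteq>Y. card (vertices_of G Z) < card Z)" by iprover
qed

lemma frame_circuit_iff:
  "X \<in> circuits (frame_matroid G B) \<longleftrightarrow>
     X \<in> B \<or> (\<exists>C C'. C \<notin> B \<and> C' \<notin> B \<and> handcuff_of G C C' X) \<or> unbalanced_theta G B X"
proof -
  have "X \<in> circuits (frame_matroid G B) \<longleftrightarrow>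
     X \<in> B \<or> (tight_handcuff G B X \<or> loose_handcuff G B X) \<or> unbalanced_theta G B X"
    by (simp add: frame_matroid_def)
  then show ?thesis by (simp only: handcuff_iff)
qed

lemma frame_circuit_dependent:
  assumes "biased_graph G B" "X \<in> circuits (frame_matroid G B)"
  shows "X \<subseteq> edges G" "dependent G B X"
proof -
  have fin: "finite_multigraph G" and B: "\<And>C. C \<in> B \<Longrightarrow> is_cycle G C"
    using assms(1) by (auto simp: biased_graph_def)
  have "X \<subseteq> edges G \<and> dependent G B X"
    using assms(2) unfolding frame_circuit_iff
  proof (elim disjE exE conjE)
    assume "X \<in> B" then show ?thesis using is_cycle_card(3)[OF B] by (auto simp: dependent_def)
  next
    fix C C' assume "handcuff_of G C C' X"
    from handcuff_of_props(5,6)[OF this fin] show ?thesis by (auto simp: dependent_def)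
  next
    assume "unbalanced_theta G B X"
    then have "is_theta G X" by (simp add: unbalanced_theta_def)
    from theta_card[OF this fin] show ?thesis
      unfolding dependent_def by (intro conjI disjI2 exI[of _ X]) simp_all
  qed
  then show "X \<subseteq> edges G" "dependent G B X" by auto
qed

text \<open>If no balanced cycle lies in \<open>X\<close>, every cycle in \<open>X\<close> is
  unbalanced, and the theta or handcuff inside an overfull subset is a circuit whatever its cycles
  are.\<close>

lemma dependent_contains_circuit:
  assumes "biased_graph G B" "X \<subseteq> edges G" "dependent G B X"
  shows "\<exists>C\<in>circuits (frame_matroid G B). C \<subseteq> X"
proof (cases "\<exists>C\<in>B. C \<subseteq> X")
  case True then show ?thesis unfolding Bex_def frame_circuit_iff by blast
next
  case False
  have fin: "finite_multigraph G" using assms(1) by (auto simp: biased_graph_def)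
  obtain Z where Z: "Z \<subseteq> X" "card (vertices_of G Z) < card Z"
    using assms(3) False by (auto simp: dependent_def)
  obtain Y where Y: "Y \<subseteq> Z" "is_theta G Y \<or> (\<exists>C C'. handcuff_of G C C' Y)"
    using overfull_contains[OF fin _ Z(2)] Z(1) assms(2) by blast
  have nB: "C \<notin> B" if "C \<subseteq> Y" for C using False that Y(1) Z(1) by blast
  have "unbalanced_theta G B Y \<or> (\<exists>C C'. C \<notin> B \<and> C' \<notin> B \<and> handcuff_of G C C' Y)"
    using Y(2) nB handcuff_of_props(4)[OF _ fin]
    unfolding unbalanced_theta_def unbalanced_cycle_def by (meson Un_subset_iff)
  then show ?thesis using Y(1) Z(1) unfolding Bex_def frame_circuit_iff by blast
qed

text \<open>A dependent proper part contains a balanced cycle or an overfull \<open>Z\<close> with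
  two different cycles. The first is impossible because the cycles inside a circuit are unbalanced,
  or the circuit is itself a cycle. For the second, a cycle has no overfull part, two cycles exhaust
  a theta, and a proper part of a handcuff that contains both of its cycles is not overfull.\<close>

lemma frame_circuit_minimal:
  assumes "biased_graph G B" "X \<in> circuits (frame_matroid G B)" "Y \<subset> X"
  shows "\<not> dependent G B Y"
proof
  assume dep: "dependent G B Y"
  have fin: "finite_multigraph G" and B: "\<And>C. C \<in> B \<Longrightarrow> is_cycle G C"
    using assms(1) by (auto simp: biased_graph_def)
  note XE = frame_circuit_dependent(1)[OF assms(1,2)]
  have two: "(\<exists>C\<in>B. C \<subseteq> Y) \<or> (\<exists>Z D D'. Z \<subseteq> Y \<and> card (vertices_of G Z) < card Z \<and>
      is_cycle G D \<and> is_cycle G D' \<and> D \<noteq> D' \<and> D \<subseteq> Z \<and> D' \<subseteq> Z)"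
  proof (cases "\<exists>C\<in>B. C \<subseteq> Y")
    case False
    then obtain Z where Z: "Z \<subseteq> Y" "card (vertices_of G Z) < card Z" using dep by (auto simp: dependent_def)
    have "Z \<subseteq> edges G" using Z(1) assms(3) XE by blast
    from overfull_two_cycles[OF fin this Z(2)] show ?thesis using Z by metis
  qed simp
  show False using assms(2) unfolding frame_circuit_iff
  proof (elim disjE exE conjE)
    assume X: "X \<in> B"
    show False using two
    proof (elim disjE exE conjE bexE)
      fix C assume "C \<in> B" "C \<subseteq> Y"
      then show False using is_cycle_subset_eq[OF B[OF X] B] assms(3) by blast
    next
      fix Z assume "Z \<subseteq> Y" "card (vertices_of G Z) < card Z"
      then show False using is_cycle_subset_card_le[OF B[OF X], of Z] assms(3) by auto
    qed
  next
    fix C C' assume C: "C \<notin> B" "C' \<notin> B" and h: "handcuff_of G C C' X"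
    note p = handcuff_of_props[OF h fin]
    show False using two
    proof (elim disjE exE conjE bexE)
      fix D assume "D \<in> B" "D \<subseteq> Y"
      then show False using p(7)[OF B] C assms(3) by blast
    next
      fix Z D D' assume Z: "Z \<subseteq> Y" "card (vertices_of G Z) < card Z" "is_cycle G D" "is_cycle G D'"
        "D \<noteq> D'" "D \<subseteq> Z" "D' \<subseteq> Z"
      have "D \<subseteq> X" "D' \<subseteq> X" using Z assms(3) by blast+
      then have "{D, D'} = {C, C'}" using p(7) Z(3-5) by blast
      then have "C \<union> C' \<subseteq> Z" using Z(6,7) by blast
      then show False using p(8)[of Z] Z(1,2) assms(3) by auto
    qed
  next
    assume "unbalanced_theta G B X"
    then have th: "is_theta G X" and nB: "\<And>C. is_cycle G C \<Longrightarrow> C \<subseteq> X \<Longrightarrow> C \<notin> B"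
      by (auto simp: unbalanced_theta_def unbalanced_cycle_def)
    show False using two
    proof (elim disjE exE conjE bexE)
      fix D assume "D \<in> B" "D \<subseteq> Y"
      then show False using nB B assms(3) by blast
    next
      fix Z D D' assume Z: "Z \<subseteq> Y" "is_cycle G D" "is_cycle G D'" "D \<noteq> D'" "D \<subseteq> Z" "D' \<subseteq> Z"
      have "D \<subseteq> X" "D' \<subseteq> X" using Z assms(3) by blast+
      then have "D \<union> D' = X" using theta_cycle_pair(1)[OF th fin Z(2) _ Z(3) _ Z(4)] by simp
      then show False using Z assms(3) by blast
    qed
  qed
qed

text \<open>Circuits are the minimal dependent sets, and the members of an antichain
  \<open>K\<close> are the minimal sets that contain a member of \<open>K\<close>. This is how a
  graph is shown to represent a given matroid: only its dependent sets are compared.\<close>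

lemma frame_circuits_eq:
  assumes "biased_graph G B" "\<And>C C'. C \<in> K \<Longrightarrow> C' \<in> K \<Longrightarrow> C \<subseteq> C' \<Longrightarrow> C = C'"
    "\<And>C. C \<in> K \<Longrightarrow> C \<subseteq> edges G"
    "\<And>X. X \<subseteq> edges G \<Longrightarrow> dependent G B X \<longleftrightarrow> (\<exists>C\<in>K. C \<subseteq> X)"
  shows "circuits (frame_matroid G B) = K"
proof (intro set_eqI iffI)
  fix X assume X: "X \<in> circuits (frame_matroid G B)"
  note d = frame_circuit_dependent[OF assms(1) X]
  obtain C where C: "C \<in> K" "C \<subseteq> X" using assms(4)[OF d(1)] d(2) by blast
  then have "dependent G B C" using assms(3,4) by blast
  then have "C = X" using frame_circuit_minimal[OF assms(1) X] C(2) by blast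
  then show "X \<in> K" using C by simp
next
  fix X assume X: "X \<in> K"
  then have "dependent G B X" using assms(3,4) by blast
  then obtain C where C: "C \<in> circuits (frame_matroid G B)" "C \<subseteq> X"
    using dependent_contains_circuit[OF assms(1) assms(3)[OF X]] by blast
  obtain C' where "C' \<in> K" "C' \<subseteq> C"
    using assms(4) frame_circuit_dependent[OF assms(1) C(1)] by blast
  then have "C = X" using assms(2)[OF _ X, of C'] C(2) by blast
  then show "X \<in> circuits (frame_matroid G B)" using C by simp
qed

lemma frame_matroid_antichain:
  assumes "biased_graph G B" "C \<in> circuits (frame_matroid G B)" "C' \<in> circuits (frame_matroid G B)"
    "C \<subseteq> C'"
  shows "C = C'"
proof (rule ccontr)
  assume "C \<noteq> C'"
  then have "C \<subset> C'" using assms(4) by simp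
  then show False
    using frame_circuit_minimal[OF assms(1,3)] frame_circuit_dependent(2)[OF assms(1,2)] by simp
qed

lemma dependent_iff_contains_circuit:
  assumes "biased_graph G B" "X \<subseteq> edges G"
  shows "dependent G B X \<longleftrightarrow> (\<exists>C\<in>circuits (frame_matroid G B). C \<subseteq> X)"
proof
  assume "\<exists>C\<in>circuits (frame_matroid G B). C \<subseteq> X"
  then obtain C where "C \<in> circuits (frame_matroid G B)" "C \<subseteq> X" by blast
  then show "dependent G B X" using dependent_mono[OF frame_circuit_dependent(2)[OF assms(1)]] by blast
qed (rule dependent_contains_circuit[OF assms])

section \<open>Replacing a loop by three parallel edges\<close>

lemma vertices_of_cong: "(\<And>f. f \<in> X \<Longrightarrow> ends G f = ends G' f) \<Longrightarrow> vertices_of G X = vertices_of G' X"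
  by (simp add: vertices_of_def)

lemma not_dependent_card_le:
  "\<not> dependent G B Y \<Longrightarrow> Z \<subseteq> Y \<Longrightarrow> card Z \<le> card (vertices_of G Z)"
  unfolding dependent_def by (meson not_le)

lemma dependent_overfull:
  "Z \<subseteq> Y \<Longrightarrow> card (vertices_of G Z) < card Z \<Longrightarrow> dependent G B Y"
  unfolding dependent_def by blast

lemma dependent_balanced: "C \<in> B \<Longrightarrow> C \<subseteq> Y \<Longrightarrow> dependent G B Y"
  unfolding dependent_def by blast

lemma dependentE:
  assumes "dependent G B Y"
  obtains (balanced) C where "C \<in> B" "C \<subseteq> Y"
  | (overfull) Z where "Z \<subseteq> Y" "card (vertices_of G Z) < card Z"
  using assms unfolding dependent_def by blast

lemma not_dependent_empty:
  assumes "biased_graph G B"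
  shows "\<not> dependent G B {}"
proof
  assume "dependent G B {}"
  then show False
  proof (cases rule: dependentE)
    case (balanced C)
    then show False using assms is_cycle_card(2)[of G C] by (auto simp: biased_graph_def)
  qed simp
qed

text \<open>In a longer cycle the edge set \<open>{e}\<close> would be a proper part and would need
  two vertices.\<close>

lemma loop_notin_balanced:
  assumes "biased_graph G B" "unbalanced_loop G B e" "C \<in> B"
  shows "e \<notin> C"
proof
  assume e: "e \<in> C"
  have C: "is_cycle G C" using assms by (simp add: biased_graph_def)
  have "C \<noteq> {e}" using assms by (auto simp: unbalanced_loop_def)
  then have "{e} \<subset> C" using e by blast
  from is_cycle_proper_subset[OF C this] show False
    using assms(2) by (simp add: unbalanced_loop_def)
qed

text \<open>Two edges of \<open>P\<close> bring one new vertex \<open>w\<close> and hence a surplus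
  of one edge at \<open>v\<close>, which is exactly what the loop \<open>e\<close> brings. A single
  edge of \<open>P\<close> is pendant, and all three outnumber \<open>{v, w}\<close> by themselves.
  The balanced cycles stay the same: none of them uses \<open>e\<close>, and every cycle through
  \<open>P\<close> is unbalanced.\<close>

lemma replace_loop_by_triple:
  fixes G :: "(nat, 'e) multigraph"
  assumes "biased_graph G B" "unbalanced_loop G B e" "card P = 3" "P \<inter> edges G = {}"
  obtains G' :: "(nat, 'e) multigraph" and B' where
    "biased_graph G' B'" "edges G' = edges G - {e} \<union> P"
    "\<And>Y S. Y \<subseteq> edges G - {e} \<Longrightarrow> S \<subseteq> P \<Longrightarrow> dependent G' B' (Y \<union> S) \<longleftrightarrow>
        S = P \<or> dependent G B Y \<or> 2 \<le> card S \<and> dependent G B (insert e Y)"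
    "\<And>f. unbalanced_loop G B f \<Longrightarrow> f \<noteq> e \<Longrightarrow> unbalanced_loop G' B' f"
proof -
  have fin: "finite_multigraph G" and Bc: "\<And>C. C \<in> B \<Longrightarrow> is_cycle G C" and tc: "theta_closed G B"
    using assms(1) by (auto simp: biased_graph_iff)
  have finP: "finite P" using assms(3) card.infinite by fastforce
  obtain v where v: "ends G e = {v}" using assms(2) by (auto simp: unbalanced_loop_def card_1_singleton_iff)
  have eE: "e \<in> edges G" using assms(2) by (simp add: unbalanced_loop_def)
  have vV: "v \<in> verts G" using card_ends(3)[OF fin eE] v by simp
  have "finite (verts G)" using fin by (simp add: finite_multigraph_def)
  then obtain w where w: "w \<notin> verts G" using ex_new_if_finite infinite_UNIV_nat by metis
  let ?E = "edges G - {e}"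
  define G' :: "(nat, 'e) multigraph" where "G' = \<lparr>verts = insert w (verts G), edges = ?E \<union> P,
    ends = (\<lambda>f. if f \<in> P then {v, w} else ends G f)\<rparr>"
  have vw: "v \<noteq> w" using vV w by auto
  have ends': "ends G' f = ends G f" if "f \<in> edges G" for f using that assms(4) by (auto simp: G'_def)
  have endsP: "ends G' f = {v, w}" if "f \<in> P" for f using that by (simp add: G'_def)
  have V': "vertices_of G' Z = vertices_of G Z" if "Z \<subseteq> ?E" for Z
    using that ends' by (intro vertices_of_cong) auto
  have VP: "vertices_of G' S = {v, w}" if "S \<subseteq> P" "S \<noteq> {}" for S
    using that endsP by (auto simp: vertices_of_def)
  have BE: "C \<subseteq> ?E" if "C \<in> B" for C
    using is_cycle_card(3)[OF Bc[OF that]] loop_notin_balanced[OF assms(1,2) that] by blast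
  have fin': "finite_multigraph G'"
    unfolding finite_multigraph_def
  proof (intro conjI ballI)
    show "finite (verts G')" "finite (edges G')"
      using fin finP by (simp_all add: G'_def finite_multigraph_def)
    fix f assume "f \<in> edges G'"
    then have f: "f \<in> P \<or> f \<in> edges G" by (auto simp: G'_def)
    then show "card (ends G' f) \<in> {1, 2}"
      using endsP ends' card_ends(4)[OF fin, of f] vw by auto
    show "ends G' f \<subseteq> verts G'"
      using f endsP ends' card_ends(3)[OF fin, of f] vV by (auto simp: G'_def)
  qed
  have cyc: "is_cycle G' C" if "C \<in> B" for C
  proof -
    have "f \<in> edges G' \<and> ends G' f = id ` ends G f" if "f \<in> C" for f
    proof -
      have "f \<in> edges G - {e}" using that BE[OF \<open>C \<in> B\<close>] by blast
      then show ?thesis using ends'[of f] by (simp add: G'_def)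
    qed
    then show ?thesis using is_cycle_transport[OF Bc[OF that], of id G' id] by simp
  qed
  have "theta_closed G' B"
    unfolding theta_closed_def
  proof (intro ballI impI)
    fix C C' assume h: "C \<in> B" "C' \<in> B" "C \<noteq> C' \<and> C \<inter> C' \<noteq> {} \<and>
      card (C \<union> C') \<le> Suc (card (vertices_of G' (C \<union> C')))"
    moreover have "vertices_of G' (C \<union> C') = vertices_of G (C \<union> C')"
      using BE[OF h(1)] BE[OF h(2)] by (intro V') simp
    ultimately show "(C - C') \<union> (C' - C) \<in> B"
      using tc[unfolded theta_closed_def, rule_format, OF h(1,2)] by simp
  qed
  then have bg': "biased_graph G' B" using fin' cyc by (simp add: biased_graph_iff)
  have E': "edges G' = ?E \<union> P" by (simp add: G'_def)
  have dep': "dependent G' B (Y \<union> S) \<longleftrightarrow>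
      S = P \<or> dependent G B Y \<or> 2 \<le> card S \<and> dependent G B (insert e Y)" (is "?l \<longleftrightarrow> ?r")
    if Y: "Y \<subseteq> ?E" and S: "S \<subseteq> P" for Y S
  proof
    have finY: "finite Z" "finite (vertices_of G Z)" if "Z \<subseteq> Y" for Z
      using finite_edges_subset[OF fin, of Z] finite_vertices_of[OF fin, of Z] that Y by blast+
    have cI: "card (insert v (insert w (vertices_of G Z))) = Suc (card (insert v (vertices_of G Z)))" if "Z \<subseteq> Y" for Z
    proof -
      have "w \<notin> vertices_of G Z" using vertices_of_subset_verts[OF fin, of Z] that Y w by blast
      then have "w \<notin> insert v (vertices_of G Z)" using vw by simp
      then show ?thesis unfolding insert_commute[of v w] using finY[OF that] by simp
    qed
    show ?l if ?r
      using that
    proof (elim disjE conjE)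
      assume "S = P"
      moreover have "P \<noteq> {}" using assms(3) by auto
      ultimately have "dependent G' B S" using VP[of P] assms(3) vw by (intro dependent_overfull[of P]) auto
      then show ?l by (rule dependent_mono) simp
    next
      assume "dependent G B Y"
      then have "dependent G' B Y"
      proof (cases rule: dependentE)
        case (balanced C) then show ?thesis by (rule dependent_balanced)
      next
        case (overfull Z)
        then show ?thesis using V'[of Z] Y by (intro dependent_overfull[of Z]) auto
      qed
      then show ?l by (rule dependent_mono) simp
    next
      assume c: "2 \<le> card S" and "dependent G B (insert e Y)"
      from this(2) show ?l
      proof (cases rule: dependentE)
        case (balanced C) then show ?thesis using BE[of C] by (intro dependent_balanced[of C]) auto
      next
        case (overfull Z)
        show ?thesis
        proof (cases "e \<in> Z")
          case False
          then have "Z \<subseteq> Y" using overfull by blast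
          then show ?thesis using V'[of Z] Y overfull by (intro dependent_overfull[of Z]) auto
        next
          case True
          define Z0 where "Z0 = Z - {e}"
          have Z0: "Z0 \<subseteq> Y" "Z = insert e Z0" "e \<notin> Z0" using True overfull(1) by (auto simp: Z0_def)
          obtain S' where S': "S' \<subseteq> S" "card S' = 2" using obtain_subset_with_card_n[OF c] by metis
          then have S'P: "S' \<subseteq> P" "S' \<noteq> {}" "finite S'"
            using S finite_subset[OF order_trans[OF S'(1) S] finP] by auto
          have "card (insert v (vertices_of G Z0)) \<le> card Z0"
            using overfull(2) Z0 finY[OF Z0(1)] v by simp
          moreover have "vertices_of G' (Z0 \<union> S') = insert v (insert w (vertices_of G Z0))"
            using V'[of Z0] VP[OF S'P(1,2)] Z0(1) Y by auto
          moreover have "Z0 \<inter> S' = {}" using Z0(1) Y S'P(1) assms(4) by blast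
          then have "card (Z0 \<union> S') = card Z0 + 2"
            using finY[OF Z0(1)] S'P(3) S'(2) by (simp add: card_Un_disjoint)
          ultimately have "card (vertices_of G' (Z0 \<union> S')) < card (Z0 \<union> S')"
            using cI[OF Z0(1)] by simp
          then show ?thesis using Z0(1) S'(1) by (intro dependent_overfull[of "Z0 \<union> S'"]) auto
        qed
      qed
    qed
    show ?r if ?l
    proof (rule ccontr)
      assume "\<not> ?r"
      then have n: "S \<noteq> P" "\<not> dependent G B Y" "2 \<le> card S \<Longrightarrow> \<not> dependent G B (insert e Y)" by auto
      from \<open>?l\<close> show False
      proof (cases rule: dependentE)
        case (balanced C)
        then have "C \<subseteq> Y" using BE[of C] S assms(4) by blast
        then show False using n(2) balanced(1) dependent_balanced by blast
      next
        case (overfull Z)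
        define Z0 where "Z0 = Z \<inter> Y"
        define S' where "S' = Z \<inter> S"
        have Z: "Z = Z0 \<union> S'" "Z0 \<subseteq> Y" "S' \<subseteq> S"
          using overfull(1) unfolding Z0_def S'_def by blast+
        then have Z': "S' \<subset> P" using n(1) S by blast
        have Z'': "Z0 \<inter> S' = {}" using Z(2,3) Y S assms(4) by blast
        note Z = Z Z' Z''
        have finS: "finite S'" "finite S"
          using finite_subset[OF S finP] finite_subset[OF Z(3)] by simp_all
        have "card S' < 3" using psubset_card_mono[OF finP Z(4)] assms(3) by simp
        have cZ: "card Z = card Z0 + card S'" using Z finY[OF Z(2)] finS by (simp add: card_Un_disjoint)
        have VZ: "vertices_of G' Z = vertices_of G Z0 \<union> vertices_of G' S'"
          using Z(1) V'[of Z0] Z(2) Y by simp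
        note le = not_dependent_card_le[OF n(2) Z(2)]
        show False
        proof (cases "S' = {}")
          case True
          then show False using overfull(2) cZ VZ le by simp
        next
          case False
          then have "vertices_of G' Z = insert v (insert w (vertices_of G Z0))"
            using VZ VP[of S'] Z(4) by auto
          then have lt: "Suc (card (insert v (vertices_of G Z0))) < card Z0 + card S'"
            using overfull(2) cZ cI[OF Z(2)] by simp
          have "card (vertices_of G Z0) \<le> card (insert v (vertices_of G Z0))"
            using finY[OF Z(2)] by (intro card_mono) auto
          \<comment> \<open>\<open>lt\<close> and \<open>le\<close> leave no room for a single edge
            of \<open>P\<close>, and fewer than three are present; the two edges are then traded for
            the loop \<open>e\<close>.\<close>
          then have c2: "card S' = 2" using lt le \<open>card S' < 3\<close> by linarith
          then have "2 \<le> card S" using card_mono[OF finS(2) Z(3)] by simp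
          moreover have "e \<notin> Z0" using Z(2) Y by blast
          then have "card (vertices_of G (insert e Z0)) < card (insert e Z0)"
            using lt c2 v finY[OF Z(2)] by simp
          then have "dependent G B (insert e Y)" using Z(2) by (intro dependent_overfull[of "insert e Z0"]) auto
          ultimately show False using n(3) by simp
        qed
      qed
    qed
  qed
  have "unbalanced_loop G' B f" if "unbalanced_loop G B f" "f \<noteq> e" for f
    using that ends'[of f] by (auto simp: unbalanced_loop_def G'_def)
  from that[OF bg' E' dep' this] show thesis by simp
qed

section \<open>Replacing three edges by a loop\<close>

text \<open>Independent with equality in the count: every component of \<open>Y\<close> has exactly
  one cycle, and that cycle is unbalanced. Any further edge inside the vertex set of
  \<open>Y\<close> makes it dependent. The empty set qualifies.\<close>

definition tight_in :: "('v, 'e) multigraph \<Rightarrow> 'e set set \<Rightarrow> 'e set \<Rightarrow> 'e set \<Rightarrow> bool" where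
  "tight_in G B E Y \<longleftrightarrow> Y \<subseteq> E \<and> \<not> dependent G B Y \<and> card (vertices_of G Y) = card Y"

text \<open>The vertices of the components of \<open>E\<close> that contain an unbalanced cycle.\<close>

definition spanned :: "('v, 'e) multigraph \<Rightarrow> 'e set set \<Rightarrow> 'e set \<Rightarrow> 'v set" where
  "spanned G B E = (\<Union>Y\<in>{Y. tight_in G B E Y}. vertices_of G Y)"

text \<open>The edge \<open>f\<close> is pendant at the new vertex \<open>t\<close>. No balanced
  cycle can pass through it, and it adds one edge and one vertex.\<close>

lemma tight_in_insert:
  assumes "biased_graph G B" "E \<subseteq> edges G" "tight_in G B E Y" "f \<in> E"
    "s \<in> ends G f" "s \<in> vertices_of G Y" "t \<in> ends G f" "t \<notin> vertices_of G Y"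
  shows "tight_in G B E (insert f Y)" "f \<notin> Y"
proof -
  have fin: "finite_multigraph G" and Bc: "\<And>C. C \<in> B \<Longrightarrow> is_cycle G C"
    using assms(1) by (auto simp: biased_graph_def)
  have Y: "Y \<subseteq> E" "\<not> dependent G B Y" "card (vertices_of G Y) = card Y"
    using assms(3) by (auto simp: tight_in_def)
  have fE: "f \<in> edges G" using assms by blast
  have "s \<noteq> t" using assms by auto
  then have c2: "card (ends G f) = 2" "finite (ends G f)"
    using card_ends(1,4)[OF fin fE] assms(5,7) by (auto simp: card_1_singleton_iff)
  then have st: "ends G f = {s, t}"
    using card_seteq[OF c2(2), of "{s, t}"] assms(5,7) \<open>s \<noteq> t\<close> by simp
  show fY: "f \<notin> Y" using assms(7,8) by (auto simp: vertices_of_def)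
  have finY: "finite Y" "finite (vertices_of G Y)"
    using finite_edges_subset[OF fin] finite_vertices_of[OF fin] Y(1) assms(2) by blast+
  have "\<not> dependent G B (insert f Y)"
  proof
    assume "dependent G B (insert f Y)"
    then show False
    proof (cases rule: dependentE)
      case (balanced C)
      then have "f \<in> C" using Y(2) dependent_balanced by blast
      from is_cycle_degree_two[OF Bc[OF balanced(1)] fin this assms(7) c2(1)] balanced(2)
      have "t \<in> vertices_of G Y" by (auto simp: vertices_of_def)
      then show False using assms(8) by simp
    next
      case (overfull Z)
      define Z0 where "Z0 = Z - {f}"
      have Z0: "Z0 \<subseteq> Y" using overfull by (auto simp: Z0_def)
      have "f \<in> Z"
      proof (rule ccontr)
        assume "f \<notin> Z"
        then have "Z \<subseteq> Y" using overfull by blast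
        from not_dependent_card_le[OF Y(2) this] overfull(2) show False by simp
      qed
      then have Ze: "Z = insert f Z0" "f \<notin> Z0" by (auto simp: Z0_def)
      have t: "t \<notin> vertices_of G Z0" using vertices_of_mono[OF Z0, of G] assms(8) by blast
      have f0: "finite Z0" "finite (vertices_of G Z0)"
        using finite_subset[OF Z0 finY(1)] finite_subset[OF vertices_of_mono[OF Z0] finY(2)] .
      have "Suc (card (vertices_of G Z0)) = card (insert t (vertices_of G Z0))" using t f0 by simp
      also have "\<dots> \<le> card (vertices_of G Z)" using Ze st f0 by (intro card_mono) auto
      finally show False using overfull(2) Ze f0 not_dependent_card_le[OF Y(2) Z0] by simp
    qed
  qed
  moreover have "vertices_of G (insert f Y) = insert t (vertices_of G Y)" using st assms(6) by auto
  then have "card (vertices_of G (insert f Y)) = card (insert f Y)" using assms(8) fY finY Y(3) by simp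
  ultimately show "tight_in G B E (insert f Y)" using Y(1) assms(4) by (simp add: tight_in_def)
qed

text \<open>All counts add up over the two vertex-disjoint parts. A balanced cycle meeting both
  parts would have a nonempty proper portion in one of them, with a vertex to spare, and so more
  vertices than edges altogether.\<close>

lemma tight_in_Un:
  assumes "biased_graph G B" "E \<subseteq> edges G" "tight_in G B E Y" "tight_in G B E Y'"
    "vertices_of G Y \<inter> vertices_of G Y' = {}"
  shows "tight_in G B E (Y \<union> Y')"
proof -
  have fin: "finite_multigraph G" and Bc: "\<And>C. C \<in> B \<Longrightarrow> is_cycle G C"
    using assms(1) by (auto simp: biased_graph_def)
  have Y: "Y \<subseteq> E" "\<not> dependent G B Y" "card (vertices_of G Y) = card Y"
    and Y': "Y' \<subseteq> E" "\<not> dependent G B Y'" "card (vertices_of G Y') = card Y'"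
    using assms(3,4) by (auto simp: tight_in_def)
  have finE: "finite Z" "finite (vertices_of G Z)" if "Z \<subseteq> E" for Z
    using finite_edges_subset[OF fin] finite_vertices_of[OF fin] that assms(2) by blast+
  have YE: "Y \<subseteq> edges G" "Y' \<subseteq> edges G" using Y(1) Y'(1) assms(2) by auto
  have dis: "Y \<inter> Y' = {}"
  proof (rule ccontr)
    assume "Y \<inter> Y' \<noteq> {}"
    then obtain g where g: "g \<in> Y" "g \<in> Y'" by blast
    then have "ends G g \<subseteq> vertices_of G Y \<inter> vertices_of G Y'" by (auto simp: vertices_of_def)
    then show False using assms(5) card_ends(2)[OF fin, of g] g YE by blast
  qed
  have split: "card (vertices_of G Z) = card (vertices_of G (Z \<inter> Y)) + card (vertices_of G (Z \<inter> Y'))"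
    "card Z = card (Z \<inter> Y) + card (Z \<inter> Y')" if Z: "Z \<subseteq> Y \<union> Y'" for Z
  proof -
    have e: "Z = (Z \<inter> Y) \<union> (Z \<inter> Y')" using Z by blast
    have "Z \<inter> Y \<subseteq> E" "Z \<inter> Y' \<subseteq> E" using Y(1) Y'(1) by auto
    note f = finE[OF this(1)] finE[OF this(2)]
    have "vertices_of G (Z \<inter> Y) \<inter> vertices_of G (Z \<inter> Y') = {}"
      using assms(5) vertices_of_mono[of "Z \<inter> Y" Y G] vertices_of_mono[of "Z \<inter> Y'" Y' G] by blast
    then show "card (vertices_of G Z) = card (vertices_of G (Z \<inter> Y)) + card (vertices_of G (Z \<inter> Y'))"
      using f by (subst e) (simp add: card_Un_disjoint)
    show "card Z = card (Z \<inter> Y) + card (Z \<inter> Y')"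
      using f dis by (subst e, intro card_Un_disjoint) auto
  qed
  have le: "card (Z \<inter> Y) \<le> card (vertices_of G (Z \<inter> Y))" "card (Z \<inter> Y') \<le> card (vertices_of G (Z \<inter> Y'))" for Z
    using not_dependent_card_le[OF Y(2)] not_dependent_card_le[OF Y'(2)] by simp_all
  have "\<not> dependent G B (Y \<union> Y')"
  proof
    assume "dependent G B (Y \<union> Y')"
    then show False
    proof (cases rule: dependentE)
      case (balanced C)
      have "\<not> C \<subseteq> Y" "\<not> C \<subseteq> Y'" using Y(2) Y'(2) dependent_balanced[OF balanced(1)] by blast+
      then have "C \<inter> Y \<subset> C" "C \<inter> Y \<noteq> {}" using balanced(2) by blast+
      from is_cycle_proper_subset[OF Bc[OF balanced(1)] this]
      show False using split[OF balanced(2)] is_cycle_card(1)[OF Bc[OF balanced(1)]] le(2)[of C] by simp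
    next
      case (overfull Z)
      then show False using split[OF overfull(1)] le[of Z] by simp
    qed
  qed
  moreover have "card (vertices_of G (Y \<union> Y')) = card (Y \<union> Y')"
  proof -
    have "(Y \<union> Y') \<inter> Y = Y" "(Y \<union> Y') \<inter> Y' = Y'" by blast+
    then show ?thesis using split[OF subset_refl] Y(3) Y'(3) by presburger
  qed
  ultimately show ?thesis using Y(1) Y'(1) by (simp add: tight_in_def)
qed

text \<open>A tight set \<open>T\<close> with the most edges covers all tight sets. If a tight
  \<open>Y\<close> had a vertex outside \<open>T\<close>, an edge of \<open>Y\<close> leaving the
  vertices of \<open>T\<close> could be added to \<open>T\<close>. Without such an edge, the part of
  \<open>Y\<close> away from \<open>T\<close> is itself tight and can be united with
  \<open>T\<close>.\<close>

lemma spanned_tight: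
  assumes "biased_graph G B" "E \<subseteq> edges G"
  obtains T where "tight_in G B E T" "vertices_of G T = spanned G B E"
proof -
  have fin: "finite_multigraph G" using assms(1) by (auto simp: biased_graph_def)
  have finE: "finite Z" "finite (vertices_of G Z)" if "Z \<subseteq> E" for Z
    using finite_edges_subset[OF fin] finite_vertices_of[OF fin] that assms(2) by blast+
  have tE: "Z \<subseteq> E" if "tight_in G B E Z" for Z using that by (simp add: tight_in_def)
  have "tight_in G B E {}" using not_dependent_empty[OF assms(1)] by (simp add: tight_in_def)
  moreover have "\<forall>Z. tight_in G B E Z \<longrightarrow> card Z < Suc (card E)"
    using tE finE by (simp add: card_mono less_Suc_eq_le)
  ultimately obtain T where T: "tight_in G B E T" "\<And>Z. tight_in G B E Z \<Longrightarrow> card Z \<le> card T"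
    using ex_has_greatest_nat[of "tight_in G B E" "{}" card "Suc (card E)"] by blast
  note TE = tE[OF T(1)] and fT = finE[OF tE[OF T(1)]]
  have "spanned G B E \<subseteq> vertices_of G T"
  proof
    fix w assume "w \<in> spanned G B E"
    then obtain Y where Y: "tight_in G B E Y" "w \<in> vertices_of G Y" by (auto simp: spanned_def)
    note YE = tE[OF Y(1)] and fY = finE[OF tE[OF Y(1)]]
    show "w \<in> vertices_of G T"
    proof (rule ccontr)
      assume w: "w \<notin> vertices_of G T"
      have nocross: "ends G f \<subseteq> vertices_of G T \<or> ends G f \<inter> vertices_of G T = {}" if f: "f \<in> Y" for f
      proof (rule ccontr)
        assume "\<not> ?thesis"
        then obtain s t where "s \<in> ends G f" "s \<in> vertices_of G T" "t \<in> ends G f" "t \<notin> vertices_of G T" by blast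
        from tight_in_insert[OF assms T(1) _ this] f YE
        have "tight_in G B E (insert f T)" "f \<notin> T" by blast+
        then show False using T(2)[of "insert f T"] fT by simp
      qed
      define Ya where "Ya = {f \<in> Y. ends G f \<subseteq> vertices_of G T}"
      define Yb where "Yb = Y - Ya"
      have sub: "Ya \<subseteq> Y" "Yb \<subseteq> Y" "Y = Ya \<union> Yb" by (auto simp: Ya_def Yb_def)
      have fab: "finite Ya" "finite Yb" "finite (vertices_of G Ya)" "finite (vertices_of G Yb)"
        using finE sub YE by (meson order_trans)+
      have Va: "vertices_of G Ya \<subseteq> vertices_of G T" by (auto simp: Ya_def vertices_of_def)
      have Vb: "vertices_of G Yb \<inter> vertices_of G T = {}"
        using nocross by (fastforce simp: Yb_def Ya_def vertices_of_def)
      have nd: "\<not> dependent G B Y" "card (vertices_of G Y) = card Y" using Y(1) by (auto simp: tight_in_def)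
      have "card Y = card Ya + card Yb"
        unfolding sub(3) by (rule card_Un_disjoint[OF fab(1,2)]) (simp add: Yb_def)
      moreover have "card (vertices_of G Y) = card (vertices_of G Ya) + card (vertices_of G Yb)"
        unfolding sub(3) vertices_of_Un by (rule card_Un_disjoint[OF fab(3,4)]) (use Va Vb in blast)
      moreover note not_dependent_card_le[OF nd(1) sub(1)] not_dependent_card_le[OF nd(1) sub(2)]
      \<comment> \<open>Both parts satisfy the inequality and their sums agree, so equality holds in
        each of them.\<close>
      ultimately have "card (vertices_of G Yb) = card Yb" using nd(2) by linarith
      moreover have "\<not> dependent G B Yb" using nd(1) dependent_mono[OF _ sub(2)] by blast
      ultimately have "tight_in G B E Yb" using sub(2) YE by (auto simp: tight_in_def)
      from tight_in_Un[OF assms T(1) this] Vb have "tight_in G B E (T \<union> Yb)" by blast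
      from T(2)[OF this] have "card (T \<union> Yb) \<le> card T" .
      then have "Yb \<subseteq> T" using card_seteq[of "T \<union> Yb" T] fT fab by auto
      then have "vertices_of G Yb = {}" using vertices_of_mono[of Yb T G] Vb by blast
      then have "w \<in> vertices_of G Ya" using Y(2) vertices_of_Un[of G Ya Yb, folded sub(3)] by simp
      then show False using w Va by blast
    qed
  qed
  moreover have "vertices_of G T \<subseteq> spanned G B E" using T(1) by (auto simp: spanned_def)
  ultimately show thesis using that[OF T(1)] by blast
qed

section \<open>Identifying two vertices\<close>

lemma card_image_identify:
  assumes "finite A" "p \<noteq> q"
  shows "card ((\<lambda>v. if v = q then p else v) ` A) = (if p \<in> A \<and> q \<in> A then card A - 1 else card A)"
proof (cases "q \<in> A")
  case True
  have e: "(\<lambda>v. if v = q then p else v) ` A = insert p (A - {q})" using True assms(2) by auto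
  show ?thesis
  proof (cases "p \<in> A")
    case pA: True
    then have "insert p (A - {q}) = A - {q}" using assms(2) by auto
    then show ?thesis using e True pA assms(1) by simp
  next
    case False
    then show ?thesis using e True assms(1) by (simp add: card_insert_if card_Suc_Diff1 del: card_Diff_insert)
  qed
next
  case False
  then have "(\<lambda>v. if v = q then p else v) ` A = A" by (auto simp: image_iff)
  then show ?thesis using False by simp
qed

text \<open>Identifying two vertices does not change the frame matroid unless both of them lie in
  unbalanced components: a cycle through both becomes a tight handcuff of unbalanced cycles.\<close>

lemma identify_vertices:
  fixes G :: "(nat, 'e) multigraph"
  assumes bg: "biased_graph G B" and E: "E \<subseteq> edges G" and eE: "e \<notin> edges G"
    and pq: "p \<in> verts G" "p \<noteq> q" "p \<notin> spanned G B E \<or> q \<notin> spanned G B E"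
    and r: "r \<in> verts G" "r = p \<or> r = q \<or> r \<notin> spanned G B E"
  obtains K :: "(nat, 'e) multigraph" and B' where
    "biased_graph K B'" "edges K = insert e E" "unbalanced_loop K B' e"
    "\<And>Y. Y \<subseteq> E \<Longrightarrow> dependent K B' Y \<longleftrightarrow> dependent G B Y"
    "\<And>Y. Y \<subseteq> E \<Longrightarrow> dependent K B' (insert e Y) \<longleftrightarrow> dependent G B Y \<or>
          (\<exists>Z\<subseteq>Y. card (vertices_of G Z \<union> {p, q, r}) \<le> Suc (card Z))"
    "\<And>f. f \<in> E \<Longrightarrow> unbalanced_loop G B f \<Longrightarrow> unbalanced_loop K B' f"
proof -
  have fin: "finite_multigraph G" and Bc: "\<And>C. C \<in> B \<Longrightarrow> is_cycle G C" and tc: "theta_closed G B"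
    using bg by (auto simp: biased_graph_iff)
  define \<pi> :: "nat \<Rightarrow> nat" where "\<pi> = (\<lambda>v. if v = q then p else v)"
  define K :: "(nat, 'e) multigraph" where "K = \<lparr>verts = verts G, edges = insert e E,
    ends = (\<lambda>f. if f = e then {\<pi> r} else \<pi> ` ends G f)\<rparr>"
  \<comment> \<open>A balanced cycle through both \<open>p\<close> and \<open>q\<close> loses a
    vertex in \<open>K\<close> and is no longer a cycle there, so the condition
    \<open>is_cycle K C\<close> removes it.\<close>
  define B' where "B' = {C \<in> B. C \<subseteq> E \<and> is_cycle K C}"
  have eE': "e \<notin> E" using E eE by blast
  have finE: "finite Z" "finite (vertices_of G Z)" if "Z \<subseteq> E" for Z
    using finite_edges_subset[OF fin order_trans[OF that E]] finite_vertices_of[OF fin order_trans[OF that E]] .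
  have endsK: "ends K f = \<pi> ` ends G f" if "f \<in> E" for f using that eE' by (auto simp: K_def)
  have VK: "vertices_of K Z = \<pi> ` vertices_of G Z" if "Z \<subseteq> E" for Z
  proof -
    have "ends K f = \<pi> ` ends G f" if "f \<in> Z" for f using endsK that \<open>Z \<subseteq> E\<close> by blast
    then show ?thesis by (simp add: vertices_of_def image_UN)
  qed
  have c\<pi>: "card (\<pi> ` A) = (if p \<in> A \<and> q \<in> A then card A - 1 else card A)" if "finite A" for A
    unfolding \<pi>_def by (rule card_image_identify[OF that pq(2)])
  have \<pi>V: "\<pi> ` A \<subseteq> verts G" if "A \<subseteq> verts G" for A using that pq(1) by (auto simp: \<pi>_def)
  have finK: "finite_multigraph K"
    unfolding finite_multigraph_def
  proof (intro conjI ballI)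
    show "finite (verts K)" "finite (edges K)"
      using fin finE(1)[OF subset_refl] by (simp_all add: K_def finite_multigraph_def)
    fix f assume "f \<in> edges K"
    then consider "f = e" | "f \<in> E" by (auto simp: K_def)
    then have "ends K f \<subseteq> verts G \<and> card (ends K f) \<in> {1, 2}"
    proof cases
      case 1
      then show ?thesis using \<pi>V[of "{r}"] r(1) by (simp add: K_def)
    next
      case 2
      then have fG: "f \<in> edges G" using E by blast
      note ce = card_ends[OF fin fG]
      have "card (\<pi> ` ends G f) \<noteq> 0" using ce(1,2) by simp
      moreover have "card (\<pi> ` ends G f) \<le> card (ends G f)" by (rule card_image_le[OF ce(1)])
      ultimately have "card (\<pi> ` ends G f) = 1 \<or> card (\<pi> ` ends G f) = 2" using ce(4) by linarith
      then show ?thesis using endsK[OF 2] \<pi>V[OF ce(3)] by simp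
    qed
    then show "ends K f \<subseteq> verts K" "card (ends K f) \<in> {1, 2}" by (simp_all add: K_def)
  qed
  have tcK: "theta_closed K B'"
    unfolding theta_closed_def
  proof (intro ballI impI)
    fix C C' assume "C \<in> B'" "C' \<in> B'" and h: "C \<noteq> C' \<and> C \<inter> C' \<noteq> {} \<and>
      card (C \<union> C') \<le> Suc (card (vertices_of K (C \<union> C')))"
    then have C: "C \<in> B" "C \<subseteq> E" "is_cycle K C" "C' \<in> B" "C' \<subseteq> E" "is_cycle K C'" by (auto simp: B'_def)
    have U: "C \<union> C' \<subseteq> E" using C by blast
    have "card (vertices_of K (C \<union> C')) \<le> card (vertices_of G (C \<union> C'))"
      unfolding VK[OF U] by (rule card_image_le[OF finE(2)[OF U]])
    then have le: "card (C \<union> C') \<le> Suc (card (vertices_of G (C \<union> C')))" using h by linarith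
    have "(C - C') \<union> (C' - C) \<in> B"
      using tc[unfolded theta_closed_def, rule_format, OF C(1,4)] h le by simp
    \<comment> \<open>The count holds in \<open>K\<close>, so the union is a theta of
      \<open>K\<close> as well and its third cycle survives the identification.\<close>
    moreover have "is_cycle K ((C - C') \<union> (C' - C))"
    proof -
      have "is_theta K (C \<union> C')" using h by (intro cycle_union_theta[OF C(3,6) finK]) simp_all
      then show ?thesis by (rule theta_cycle_pair(3)[OF _ finK C(3) _ C(6)]) (use h in auto)
    qed
    moreover have "(C - C') \<union> (C' - C) \<subseteq> E" using U by blast
    ultimately show "(C - C') \<union> (C' - C) \<in> B'" by (simp add: B'_def)
  qed
  have bgK: "biased_graph K B'" using finK tcK by (simp add: biased_graph_iff B'_def)
  have loop: "unbalanced_loop K B' e"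
    using eE' by (auto simp: unbalanced_loop_def B'_def K_def)
  have dep: "dependent K B' Y \<longleftrightarrow> dependent G B Y" if Y: "Y \<subseteq> E" for Y
  proof
    assume "dependent K B' Y"
    then show "dependent G B Y"
    proof (cases rule: dependentE)
      case (balanced C)
      then show ?thesis by (intro dependent_balanced[of C]) (auto simp: B'_def)
    next
      case (overfull Z)
      have ZE: "Z \<subseteq> E" using overfull Y by blast
      have lt: "card (\<pi> ` vertices_of G Z) < card Z" using overfull VK[OF ZE] by simp
      show ?thesis
      proof (rule ccontr)
        assume n: "\<not> dependent G B Y"
        note le = not_dependent_card_le[OF n overfull(1)]
        \<comment> \<open>Only the loss of a vertex can have made \<open>Z\<close> overfull. So
          \<open>Z\<close> contains both \<open>p\<close> and \<open>q\<close> and is tight in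
          \<open>G\<close>, which puts both vertices into \<open>spanned\<close>.\<close>
        have both: "p \<in> vertices_of G Z" "q \<in> vertices_of G Z" and "card (vertices_of G Z) = card Z"
          using lt le c\<pi>[OF finE(2)[OF ZE]] by (auto split: if_splits)
        moreover have "\<not> dependent G B Z" using n dependent_mono[OF _ overfull(1)] by blast
        ultimately have "tight_in G B E Z" using ZE by (simp add: tight_in_def)
        then have "p \<in> spanned G B E" "q \<in> spanned G B E" using both by (auto simp: spanned_def)
        then show False using pq(3) by blast
      qed
    qed
  next
    assume "dependent G B Y"
    then show "dependent K B' Y"
    proof (cases rule: dependentE)
      case (balanced C)
      have CE: "C \<subseteq> E" using balanced Y by blast
      have cC: "card (vertices_of G C) = card C" "C \<noteq> {}" "finite C"
        using is_cycle_card[OF Bc[OF balanced(1)]] by simp_all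
      show ?thesis
      proof (cases "p \<in> vertices_of G C \<and> q \<in> vertices_of G C")
        case True
        \<comment> \<open>Such a cycle stays dependent without being balanced: it now has one edge
          more than vertices.\<close>
        then have "card (vertices_of K C) = card C - 1" using c\<pi>[OF finE(2)[OF CE]] VK[OF CE] cC(1) by simp
        moreover have "card C > 0" using cC by (simp add: card_gt_0_iff)
        ultimately show ?thesis by (intro dependent_overfull[OF balanced(2)]) simp
      next
        case False
        then have "inj_on \<pi> (vertices_of G C)" by (auto simp: inj_on_def \<pi>_def)
        moreover have "f \<in> edges K \<and> ends K f = \<pi> ` ends G f" if "f \<in> C" for f
        proof -
          have "f \<in> E" using that CE by blast
          then show ?thesis using endsK by (simp add: K_def)
        qed
        ultimately have "is_cycle K C"
          using is_cycle_transport[OF Bc[OF balanced(1)], of id K \<pi>] by simp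
        then show ?thesis using balanced CE by (intro dependent_balanced[of C]) (simp_all add: B'_def)
      qed
    next
      case (overfull Z)
      have ZE: "Z \<subseteq> E" using overfull Y by blast
      have "card (vertices_of K Z) \<le> card (vertices_of G Z)"
        unfolding VK[OF ZE] by (rule card_image_le[OF finE(2)[OF ZE]])
      then show ?thesis using overfull by (intro dependent_overfull[OF overfull(1)]) linarith
    qed
  qed
  have VKe: "vertices_of K (insert e Z) = \<pi> ` insert r (vertices_of G Z)" if "Z \<subseteq> E" for Z
    using VK[OF that] by (simp add: K_def)
  \<comment> \<open>This set always contains \<open>p\<close> and \<open>q\<close>, so the
    identification costs exactly one vertex; this is the origin of the \<open>Suc\<close> in the
    condition for \<open>insert e Y\<close>.\<close>
  have cS: "card (\<pi> ` (vertices_of G Z \<union> {p, q, r})) = card (vertices_of G Z \<union> {p, q, r}) - 1" if "Z \<subseteq> E" for Z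
    using c\<pi>[of "vertices_of G Z \<union> {p, q, r}"] finE(2)[OF that] by simp
  have depe: "dependent K B' (insert e Y) \<longleftrightarrow> dependent G B Y \<or>
          (\<exists>Z\<subseteq>Y. card (vertices_of G Z \<union> {p, q, r}) \<le> Suc (card Z))" if Y: "Y \<subseteq> E" for Y
  proof
    assume "dependent K B' (insert e Y)"
    then show "dependent G B Y \<or> (\<exists>Z\<subseteq>Y. card (vertices_of G Z \<union> {p, q, r}) \<le> Suc (card Z))"
    proof (cases rule: dependentE)
      case (balanced C)
      then have "C \<subseteq> Y" using eE' by (auto simp: B'_def)
      then show ?thesis using dep[OF Y] dependent_balanced[OF balanced(1)] by blast
    next
      case (overfull Z)
      show ?thesis
      proof (cases "e \<in> Z")
        case False
        then have "Z \<subseteq> Y" using overfull by blast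
        then show ?thesis using dep[OF Y] dependent_overfull[OF _ overfull(2)] by blast
      next
        case True
        define Z0 where "Z0 = Z - {e}"
        have Z0: "Z0 \<subseteq> Y" "Z = insert e Z0" "e \<notin> Z0" using True overfull(1) by (auto simp: Z0_def)
        have ZE: "Z0 \<subseteq> E" using Z0(1) Y by blast
        have le: "card (\<pi> ` insert r (vertices_of G Z0)) \<le> card Z0"
          using overfull(2) Z0 VKe[OF ZE] finE(1)[OF ZE] by simp
        show ?thesis
        proof (cases "{p, q} \<inter> insert r (vertices_of G Z0) = {}")
          case False
          \<comment> \<open>The identified vertex is already present, so adding \<open>p\<close> and
            \<open>q\<close> does not enlarge the image.\<close>
          then have "\<pi> ` (vertices_of G Z0 \<union> {p, q, r}) = \<pi> ` insert r (vertices_of G Z0)"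
            by (auto simp: \<pi>_def image_iff)
          then show ?thesis using le cS[OF ZE] Z0(1) by (intro disjI2 exI[of _ Z0]) simp
        next
          case none: True
          have cr: "card (insert r (vertices_of G Z0)) \<le> card Z0"
            using le c\<pi>[of "insert r (vertices_of G Z0)"] finE(2)[OF ZE] none by simp
          \<comment> \<open>The loop sits at a third vertex \<open>r\<close>, and neither
            \<open>p\<close> nor \<open>q\<close> occurs. If \<open>Y\<close> were independent,
            \<open>Z0\<close> would be a tight set through \<open>r\<close>, against the choice of
            \<open>r\<close>.\<close>
          show ?thesis
          proof (rule disjI1, rule ccontr)
            assume n: "\<not> dependent G B Y"
            note le' = not_dependent_card_le[OF n Z0(1)]
            have rV: "r \<in> vertices_of G Z0"
            proof (rule ccontr)
              assume "r \<notin> vertices_of G Z0"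
              then show False using cr le' finE(2)[OF ZE] by simp
            qed
            then have "card (vertices_of G Z0) = card Z0" using cr le' by (simp add: insert_absorb)
            moreover have "\<not> dependent G B Z0" using n dependent_mono[OF _ Z0(1)] by blast
            ultimately have "tight_in G B E Z0" using ZE by (simp add: tight_in_def)
            then have "r \<in> spanned G B E" using rV by (auto simp: spanned_def)
            then show False using r(2) none by blast
          qed
        qed
      qed
    qed
  next
    assume "dependent G B Y \<or> (\<exists>Z\<subseteq>Y. card (vertices_of G Z \<union> {p, q, r}) \<le> Suc (card Z))"
    then show "dependent K B' (insert e Y)"
    proof (elim disjE exE conjE)
      assume "dependent G B Y"
      then have "dependent K B' Y" using dep[OF Y] by simp
      then show ?thesis by (rule dependent_mono) blast
    next
      fix Z assume Z: "Z \<subseteq> Y" "card (vertices_of G Z \<union> {p, q, r}) \<le> Suc (card Z)"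
      have ZE: "Z \<subseteq> E" using Z(1) Y by blast
      have "card (\<pi> ` insert r (vertices_of G Z)) \<le> card (\<pi> ` (vertices_of G Z \<union> {p, q, r}))"
        using finE(2)[OF ZE] by (intro card_mono) auto
      also have "\<dots> \<le> card Z" using cS[OF ZE] Z(2) by simp
      finally have "card (vertices_of K (insert e Z)) \<le> card Z" unfolding VKe[OF ZE] .
      moreover have "e \<notin> Z" using ZE eE' by blast
      ultimately have "card (vertices_of K (insert e Z)) < card (insert e Z)"
        using finE(1)[OF ZE] by simp
      then show ?thesis using Z(1) by (intro dependent_overfull[of "insert e Z"]) auto
    qed
  qed
  have loops: "unbalanced_loop K B' f" if "f \<in> E" "unbalanced_loop G B f" for f
  proof -
    have "card (ends G f) = 1" using that(2) by (simp add: unbalanced_loop_def)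
    then obtain x where "ends G f = {x}" by (auto simp: card_1_singleton_iff)
    then have "card (ends K f) = 1" using endsK[OF that(1)] by simp
    then show ?thesis using that by (simp add: unbalanced_loop_def B'_def K_def)
  qed
  have "edges K = insert e E" by (simp add: K_def)
  from that[OF bgK this loop dep depe loops] show thesis by simp
qed

section \<open>The vertices of the three edges to be replaced\<close>

text \<open>\<open>D\<close> is the dependence pattern of a 2-sum with
  \<open>U\<^sub>2\<^sub>,\<^sub>4\<close>, where \<open>Q Y\<close> stands for a circuit inside
  \<open>Y\<close> together with the basepoint. The vertices \<open>p\<close>, \<open>q\<close>,
  \<open>r\<close> are as the identification requires. The edges \<open>s\<close> and
  \<open>t\<close> already cover all vertices of \<open>P\<close>, and the last clause makes
  balanced cycles through them irrelevant, so \<open>Y \<union> {s, t}\<close> can be judged by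
  counting.\<close>

lemma triple_vertices:
  assumes bg: "biased_graph G B" and P: "P \<subseteq> edges G" "card P = 3"
    and D: "\<And>Y S. Y \<subseteq> edges G - P \<Longrightarrow> S \<subseteq> P \<Longrightarrow> dependent G B (Y \<union> S) \<longleftrightarrow>
      S = P \<or> dependent G B Y \<or> 2 \<le> card S \<and> Q Y"
    and Q: "\<not> Q {}"
  obtains p q r s t where "p \<noteq> q" "p \<notin> spanned G B (edges G - P) \<or> q \<notin> spanned G B (edges G - P)"
    "r = p \<or> r = q \<or> r \<notin> spanned G B (edges G - P)" "{p, q, r} = vertices_of G P"
    "s \<in> P" "t \<in> P" "s \<noteq> t" "ends G s \<union> ends G t = vertices_of G P"
    "\<forall>C\<in>B. C \<subseteq> edges G - P \<union> {s, t} \<longrightarrow> dependent G B (C - {s, t})"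
proof -
  let ?E = "edges G - P" and ?U = "spanned G B (edges G - P)"
  have fin: "finite_multigraph G" and Bc: "\<And>C. C \<in> B \<Longrightarrow> is_cycle G C" and tc: "theta_closed G B"
    using bg by (auto simp: biased_graph_iff)
  have finP: "finite P" using P(2) card.infinite by fastforce
  have fV: "finite (vertices_of G S)" if "S \<subseteq> P" for S
    by (rule finite_vertices_of[OF fin order_trans[OF that P(1)]])
  note ne = not_dependent_empty[OF bg]
  have indep: "\<not> dependent G B S" if "S \<subset> P" for S
    using D[of "{}" S] that ne Q by auto
  have depP: "dependent G B P" using D[of "{}" P] by simp
  obtain T where T: "tight_in G B ?E T" "vertices_of G T = ?U"
    using spanned_tight[OF bg, of ?E] by blast
  have T': "T \<subseteq> ?E" "\<not> dependent G B T" "card (vertices_of G T) = card T"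
    using T(1) by (auto simp: tight_in_def)
  have single: "dependent G B Y" if "Y \<subseteq> ?E" "s \<in> P" "dependent G B (insert s Y)" for s Y
  proof -
    have "{s} \<noteq> P" using P(2) by auto
    then show ?thesis using D[of Y "{s}"] that by auto
  qed
  \<comment> \<open>An element of \<open>P\<close> with both ends at the tight set \<open>T\<close>
    would make \<open>T\<close> overfull, but by \<open>single\<close> adding one element of
    \<open>P\<close> to an independent set keeps it independent.\<close>
  have notU: "\<not> ends G s \<subseteq> ?U" if s: "s \<in> P" for s
  proof
    assume sub: "ends G s \<subseteq> ?U"
    have "vertices_of G (insert s T) = vertices_of G T" using sub T(2) by auto
    moreover have "s \<notin> T" "finite T" using T'(1) s finite_edges_subset[OF fin, of T] by blast+
    ultimately have "card (vertices_of G (insert s T)) < card (insert s T)" using T'(3) by simp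
    then have "dependent G B (insert s T)" by (intro dependent_overfull[of "insert s T"]) simp_all
    then show False using single[OF T'(1) s] T'(2) by blast
  qed
  have third: "\<exists>c. P = {s, t, c} \<and> c \<noteq> s \<and> c \<noteq> t" if "s \<in> P" "t \<in> P" "s \<noteq> t" for s t
  proof -
    have "card (P - {s, t}) = 1" using that P(2) finP by (simp add: card_Diff_subset)
    then obtain c where "P - {s, t} = {c}" by (auto simp: card_1_singleton_iff)
    then show ?thesis using that by blast
  qed
  show thesis
  proof (cases "P \<in> B")
    case False
    have "\<not> C \<subseteq> P" if "C \<in> B" for C
    proof
      assume "C \<subseteq> P"
      then have "C \<subset> P" using False that by blast
      then show False using indep[of C] dependent_balanced[OF that subset_refl] by blast
    qed
    then obtain Z where Z: "Z \<subseteq> P" "card (vertices_of G Z) < card Z" using depP by (auto elim: dependentE)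
    have "Z = P"
    proof (rule ccontr)
      assume "Z \<noteq> P"
      then have "Z \<subset> P" using Z(1) by blast
      then show False using indep dependent_overfull[OF subset_refl Z(2)] by blast
    qed
    then have lt3: "card (vertices_of G P) < 3" using Z(2) P(2) by simp
    have two: "2 \<le> card (vertices_of G {s, t})" if "s \<in> P" "t \<in> P" "s \<noteq> t" for s t
    proof -
      have "{s, t} \<subset> P" using third[OF that] by blast
      then have "card {s, t} \<le> card (vertices_of G {s, t})"
        using not_dependent_card_le[OF indep subset_refl] by blast
      then show ?thesis using that(3) by simp
    qed
    obtain s0 t0 where st0: "s0 \<in> P" "t0 \<in> P" "s0 \<noteq> t0"
      using P(2) by (auto simp: card_3_iff)
    have "card (vertices_of G {s0, t0}) \<le> card (vertices_of G P)"
      using st0 by (intro card_mono fV vertices_of_mono) auto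
    then have "card (vertices_of G P) = 2" using two[OF st0] lt3 by linarith
    then obtain x y where xy: "vertices_of G P = {x, y}" "x \<noteq> y" by (auto simp: card_2_iff)
    have sub: "ends G s \<subseteq> {x, y}" if "s \<in> P" for s using xy(1) that by (auto simp: vertices_of_def)
    have "\<exists>s t. s \<in> P \<and> t \<in> P \<and> s \<noteq> t \<and> ends G s \<union> ends G t = {x, y}"
    proof -
      obtain s where s: "s \<in> P" "x \<in> ends G s" using xy(1) by (auto simp: vertices_of_def)
      show ?thesis
      proof (cases "y \<in> ends G s")
        case True
        obtain t where "t \<in> P" "t \<noteq> s" using st0 by blast
        moreover from this have "ends G s \<union> ends G t = {x, y}" using s True sub[of s] sub[of t] by blast
        ultimately show ?thesis using s(1) by blast
      next
        case False
        obtain t where t: "t \<in> P" "y \<in> ends G t" using xy(1) by (auto simp: vertices_of_def)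
        have "ends G s \<union> ends G t = {x, y}" using s t sub[of s] sub[of t] by blast
        then show ?thesis using s(1) t False by blast
      qed
    qed
    then obtain s t where st: "s \<in> P" "t \<in> P" "s \<noteq> t" "ends G s \<union> ends G t = {x, y}" by blast
    have "\<forall>C\<in>B. C \<subseteq> ?E \<union> {s, t} \<longrightarrow> dependent G B (C - {s, t})"
    proof (intro ballI impI)
      fix C assume C: "C \<in> B" "C \<subseteq> ?E \<union> {s, t}"
      \<comment> \<open>Two edges on the two vertices \<open>x\<close> and \<open>y\<close> are as
        many as their vertices, so they are not a proper part of a cycle; and they are independent,
        so they are not a balanced cycle themselves.\<close>
      have "\<not> {s, t} \<subseteq> C"
      proof
        assume sub: "{s, t} \<subseteq> C"
        have "{s, t} \<subset> P" using third[OF st(1-3)] by blast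
        then have "C \<noteq> {s, t}" using indep dependent_balanced[OF C(1) subset_refl] by blast
        then have "{s, t} \<subset> C" using sub by blast
        from is_cycle_proper_subset[OF Bc[OF C(1)] this] show False
          using st(3,4) xy(2) by simp
      qed
      then obtain u where u: "u \<in> {s, t}" "C \<subseteq> insert u (C - {s, t})" by blast
      have "dependent G B (insert u (C - {s, t}))" by (rule dependent_balanced[OF C(1) u(2)])
      then show "dependent G B (C - {s, t})" using single[of "C - {s, t}" u] u(1) st C(2) by blast
    qed
    moreover have "x \<notin> ?U \<or> y \<notin> ?U"
      using notU[OF st(1)] sub[OF st(1)] by blast
    moreover have "{x, y, x} = vertices_of G P" "ends G s \<union> ends G t = vertices_of G P"
      using xy(1) st(4) by auto
    ultimately show thesis using that[of x y x s t] xy(2) st(1-3) by simp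
  next
    case True
    have V3: "card (vertices_of G P) = 3" using is_cycle_card(1)[OF Bc[OF True]] P(2) by simp
    have small: "card S < card (vertices_of G S)" if "S \<subset> P" "S \<noteq> {}" for S
      by (rule is_cycle_proper_subset[OF Bc[OF True] that])
    have pair: "vertices_of G {s, t} = vertices_of G P" if "s \<in> P" "t \<in> P" "s \<noteq> t" for s t
    proof -
      have "{s, t} \<subset> P" using third[OF that] by blast
      then have "3 \<le> card (vertices_of G {s, t})" using small[of "{s, t}"] that(3) by simp
      moreover have "vertices_of G {s, t} \<subseteq> vertices_of G P" using that by (intro vertices_of_mono) auto
      ultimately show ?thesis using card_seteq[OF fV[OF subset_refl]] V3 by simp
    qed
    have two: "card (ends G s) = 2" if "s \<in> P" for s
    proof -
      have "{s} \<subset> P" using that P(2) by force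
      then have "1 < card (ends G s)" using small[of "{s}"] by simp
      then show ?thesis using card_ends(4)[OF fin, of s] that P(1) by auto
    qed
    have atmost: "x \<notin> ?U \<or> y \<notin> ?U" if xy: "x \<in> vertices_of G P" "y \<in> vertices_of G P" "x \<noteq> y" for x y
    proof (rule ccontr)
      assume n: "\<not> ?thesis"
      have "card (vertices_of G P - {x, y}) = 1"
        using V3 xy fV[OF subset_refl] by (simp add: card_Diff_subset)
      then obtain z where z: "vertices_of G P - {x, y} = {z}" by (auto simp: card_1_singleton_iff)
      \<comment> \<open>Each edge must leave \<open>{x, y}\<close>, which leaves two possible pairs
        of ends for three edges. Two edges would be parallel, although any two edges of a triangle
        cover its three vertices.\<close>
      have "ends G s = {x, z} \<or> ends G s = {y, z}" if s: "s \<in> P" for s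
      proof -
        have "ends G s \<subseteq> vertices_of G P" using s by (auto simp: vertices_of_def)
        then have sub: "ends G s \<subseteq> {x, y, z}" using z by blast
        have nn: "\<not> ends G s \<subseteq> {x, y}" using notU[OF s] n by blast
        then have zin: "z \<in> ends G s" using sub by blast
        obtain a b where ab: "ends G s = {a, b}" "a \<noteq> b" using two[OF s] by (auto simp: card_2_iff)
        then show ?thesis using zin sub by (auto simp: doubleton_eq_iff)
      qed
      then have "ends G ` P \<subseteq> {{x, z}, {y, z}}" by blast
      then have "card (ends G ` P) \<le> card {{x, z}, {y, z}}" by (intro card_mono) simp_all
      also have "\<dots> \<le> 2" by (simp add: card_insert_if)
      finally have "card (ends G ` P) < card P" using P(2) by simp
      then have "\<not> inj_on (ends G) P" using card_image by force
      then obtain s t where st: "s \<in> P" "t \<in> P" "s \<noteq> t" "ends G s = ends G t" by (auto simp: inj_on_def)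
      then have "vertices_of G P = ends G s" using pair[OF st(1-3)] by simp
      then show False using two[OF st(1)] V3 by simp
    qed
    obtain x y z where xyz: "vertices_of G P = {x, y, z}" "x \<noteq> y" "y \<noteq> z" "x \<noteq> z"
      using V3 by (auto simp: card_3_iff)
    \<comment> \<open>At most one vertex of the triangle lies in \<open>spanned\<close>;
      \<open>r\<close> is chosen among the others, and \<open>atmost\<close> takes care of
      \<open>p\<close> and \<open>q\<close>.\<close>
    have "\<exists>p q r. {p, q, r} = vertices_of G P \<and> p \<noteq> q \<and> r \<notin> ?U"
    proof (cases "x \<in> ?U")
      case True
      then have "y \<notin> ?U" using atmost[of x y] xyz by simp
      then show ?thesis unfolding xyz(1) using xyz(4) by (intro exI[of _ x] exI[of _ z] exI[of _ y]) auto
    next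
      case False
      then show ?thesis unfolding xyz(1) using xyz(3) by (intro exI[of _ y] exI[of _ z] exI[of _ x]) auto
    qed
    then obtain p q r where pqr: "{p, q, r} = vertices_of G P" "p \<noteq> q" "r \<notin> ?U" by blast
    have pq: "p \<notin> ?U \<or> q \<notin> ?U" using atmost[of p q] pqr(2) unfolding pqr(1)[symmetric] by simp
    obtain s t where st: "s \<in> P" "t \<in> P" "s \<noteq> t" using P(2) by (auto simp: card_3_iff)
    obtain c where c: "P = {s, t, c}" "c \<noteq> s" "c \<noteq> t" using third[OF st] by blast
    have e: "ends G s \<union> ends G t = vertices_of G P" using pair[OF st] by simp
    have "\<forall>C\<in>B. C \<subseteq> ?E \<union> {s, t} \<longrightarrow> dependent G B (C - {s, t})"
    proof (intro ballI impI)
      fix C assume C: "C \<in> B" "C \<subseteq> ?E \<union> {s, t}"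
      have CE: "C - {s, t} \<subseteq> ?E" using C(2) by blast
      have cC: "c \<notin> C" using C(2) c by auto
      show "dependent G B (C - {s, t})"
      proof (cases "{s, t} \<subseteq> C")
        case False
        then obtain u where u: "u \<in> {s, t}" "C \<subseteq> insert u (C - {s, t})" by blast
        have "dependent G B (insert u (C - {s, t}))" by (rule dependent_balanced[OF C(1) u(2)])
        then show ?thesis using single[OF CE] u(1) st by blast
      next
        \<comment> \<open>The triangle \<open>P\<close> adds to \<open>C\<close> the edge
          \<open>c\<close> and no vertex, so the theta property trades \<open>s\<close> and
          \<open>t\<close> for \<open>c\<close>. A single element of \<open>P\<close> can then be
          dropped by \<open>single\<close>.\<close>
        case st': True
        have "vertices_of G {s, t} \<subseteq> vertices_of G C" by (rule vertices_of_mono[OF st'])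
        then have "vertices_of G (C \<union> P) = vertices_of G C" using pair[OF st] by auto
        moreover have "C \<union> P = insert c C" using c st' by blast
        then have "card (C \<union> P) = Suc (card C)" using cC is_cycle_card(4)[OF Bc[OF C(1)]] by simp
        ultimately have "card (C \<union> P) \<le> Suc (card (vertices_of G (C \<union> P)))"
          using is_cycle_card(1)[OF Bc[OF C(1)]] by simp
        moreover have "C \<noteq> P" "C \<inter> P \<noteq> {}" using cC c st' by blast+
        ultimately have "(C - P) \<union> (P - C) \<in> B"
          using tc[unfolded theta_closed_def, rule_format, OF C(1) True] by blast
        moreover have "(C - P) \<union> (P - C) \<subseteq> insert c (C - {s, t})" using c st' by blast
        ultimately have "dependent G B (insert c (C - {s, t}))" by (rule dependent_balanced)
        then show ?thesis using single[OF CE] c by blast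
      qed
    qed
    then show thesis using that[of p q r s t] pqr pq st e by simp
  qed
qed

text \<open>Two edges \<open>s\<close> and \<open>t\<close> in \<open>G\<close> and the loop
  \<open>e\<close> in \<open>K\<close> lead to the same count. \<open>Z \<union> {s, t}\<close> has
  \<open>card Z + 2\<close> edges on the vertices of \<open>Z\<close> and \<open>{p, q, r}\<close>;
  in \<open>K\<close> one edge is gone, and so is one vertex through the identification.\<close>

lemma replace_triple_by_loop:
  fixes G :: "(nat, 'e) multigraph"
  assumes bg: "biased_graph G B" and P: "P \<subseteq> edges G" "card P = 3" and e: "e \<notin> edges G"
    and D: "\<And>Y S. Y \<subseteq> edges G - P \<Longrightarrow> S \<subseteq> P \<Longrightarrow> dependent G B (Y \<union> S) \<longleftrightarrow>
      S = P \<or> dependent G B Y \<or> 2 \<le> card S \<and> Q Y"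
    and Q: "\<not> Q {}"
  obtains K :: "(nat, 'e) multigraph" and B' where
    "biased_graph K B'" "edges K = insert e (edges G - P)" "unbalanced_loop K B' e"
    "\<And>Y. Y \<subseteq> edges G - P \<Longrightarrow> dependent K B' Y \<longleftrightarrow> dependent G B Y"
    "\<And>Y. Y \<subseteq> edges G - P \<Longrightarrow> dependent K B' (insert e Y) \<longleftrightarrow> dependent G B Y \<or> Q Y"
    "\<And>f. f \<in> edges G - P \<Longrightarrow> unbalanced_loop G B f \<Longrightarrow> unbalanced_loop K B' f"
proof -
  let ?E = "edges G - P"
  have fin: "finite_multigraph G" using bg by (simp add: biased_graph_def)
  have finP: "finite P" using P(2) card.infinite by fastforce
  obtain p q r s t where
    pq: "p \<noteq> q" "p \<notin> spanned G B ?E \<or> q \<notin> spanned G B ?E" "r = p \<or> r = q \<or> r \<notin> spanned G B ?E"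
    and V: "{p, q, r} = vertices_of G P" and st: "s \<in> P" "t \<in> P" "s \<noteq> t" "ends G s \<union> ends G t = vertices_of G P"
    and bal: "\<forall>C\<in>B. C \<subseteq> ?E \<union> {s, t} \<longrightarrow> dependent G B (C - {s, t})"
    by (rule triple_vertices[OF bg P D Q])
  have pr: "p \<in> verts G" "r \<in> verts G"
    using vertices_of_subset_verts[OF fin P(1)] V by blast+
  obtain K :: "(nat, 'e) multigraph" and B' where K:
    "biased_graph K B'" "edges K = insert e ?E" "unbalanced_loop K B' e"
    "\<And>Y. Y \<subseteq> ?E \<Longrightarrow> dependent K B' Y \<longleftrightarrow> dependent G B Y"
    "\<And>Y. Y \<subseteq> ?E \<Longrightarrow> dependent K B' (insert e Y) \<longleftrightarrow> dependent G B Y \<or>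
          (\<exists>Z\<subseteq>Y. card (vertices_of G Z \<union> {p, q, r}) \<le> Suc (card Z))"
    "\<And>f. f \<in> ?E \<Longrightarrow> unbalanced_loop G B f \<Longrightarrow> unbalanced_loop K B' f"
    by (rule identify_vertices[OF bg Diff_subset e pr(1) pq(1,2) pr(2) pq(3)]) (rule that; assumption)
  have c2: "card {s, t} = 2" using st(3) by simp
  have QY: "dependent G B Y \<or> Q Y \<longleftrightarrow> dependent G B Y \<or>
      (\<exists>Z\<subseteq>Y. card (vertices_of G Z \<union> {p, q, r}) \<le> Suc (card Z))" if Y: "Y \<subseteq> ?E" for Y
  proof -
    have "{s, t} \<noteq> P" using c2 P(2) by auto
    then have 1: "dependent G B (Y \<union> {s, t}) \<longleftrightarrow> dependent G B Y \<or> Q Y"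
      using D[OF Y, of "{s, t}"] st c2 by simp
    have disj: "s \<notin> Z" "t \<notin> Z" "finite Z" if "Z \<subseteq> Y" for Z
      using that Y st(1,2) finite_edges_subset[OF fin, of Z] by blast+
    have V2: "vertices_of G (Z \<union> {s, t}) = vertices_of G Z \<union> {p, q, r}" for Z
      using st(4) V by auto
    have cZ: "card (Z \<union> {s, t}) = card Z + 2" if "Z \<subseteq> Y" for Z
      using disj[OF that] st(3) by simp
    have "dependent G B (Y \<union> {s, t}) \<longleftrightarrow> dependent G B Y \<or>
      (\<exists>Z\<subseteq>Y. card (vertices_of G Z \<union> {p, q, r}) \<le> Suc (card Z))" (is "?l \<longleftrightarrow> _ \<or> ?r")
    proof
      assume ?l
      then show "dependent G B Y \<or> ?r"
      proof (cases rule: dependentE)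
        case (balanced C)
        then have "dependent G B (C - {s, t})" using bal Y by blast
        then have "dependent G B Y" by (rule dependent_mono) (use balanced in blast)
        then show ?thesis ..
      next
        case (overfull Z)
        show ?thesis
        proof (cases "{s, t} \<subseteq> Z")
          case True
          define Z0 where "Z0 = Z - {s, t}"
          have Z0: "Z0 \<subseteq> Y" "Z = Z0 \<union> {s, t}" using True overfull(1) by (auto simp: Z0_def)
          have "card (vertices_of G Z0 \<union> {p, q, r}) \<le> Suc (card Z0)"
            using overfull(2) unfolding Z0(2) V2 cZ[OF Z0(1)] by simp
          then show ?thesis using Z0(1) by blast
        next
          case False
          then obtain u where u: "u \<in> {s, t}" "Z \<subseteq> Y \<union> {u}" using overfull(1) by blast
          \<comment> \<open>With one of \<open>s\<close> and \<open>t\<close> missing from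
            \<open>Z\<close>, the pattern \<open>D\<close> for a single element leaves
            \<open>Y\<close> itself dependent.\<close>
          have "dependent G B (Y \<union> {u})" by (rule dependent_overfull[OF u(2) overfull(2)])
          moreover have "{u} \<noteq> P" "{u} \<subseteq> P" using u(1) st P(2) by auto
          ultimately have "dependent G B Y" using D[OF Y, of "{u}"] by simp
          then show ?thesis ..
        qed
      qed
    next
      assume "dependent G B Y \<or> ?r"
      then show ?l
      proof (elim disjE exE conjE)
        assume "dependent G B Y" then show ?l by (rule dependent_mono) blast
      next
        fix Z assume Z: "Z \<subseteq> Y" "card (vertices_of G Z \<union> {p, q, r}) \<le> Suc (card Z)"
        then have "card (vertices_of G (Z \<union> {s, t})) < card (Z \<union> {s, t})"
          unfolding V2 cZ[OF Z(1)] by simp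
        moreover have "Z \<union> {s, t} \<subseteq> Y \<union> {s, t}" using Z(1) by blast
        ultimately show ?l by (intro dependent_overfull[of "Z \<union> {s, t}"])
      qed
    qed
    then show ?thesis using 1 by blast
  qed
  have "dependent K B' (insert e Y) \<longleftrightarrow> dependent G B Y \<or> Q Y" if "Y \<subseteq> ?E" for Y
    using K(5)[OF that] QY[OF that] by simp
  from that[OF K(1-4) this K(6)] show thesis by simp
qed

section \<open>Two-sums\<close>

lemma frame_matroid_eqI:
  "edges G = ground M \<Longrightarrow> circuits (frame_matroid G B) = circuits M \<Longrightarrow> frame_matroid G B = M"
  by (cases M) (simp add: frame_matroid_def)

section \<open>Renaming the elements\<close>

text \<open>Mediates between \<open>N\<close> and its copy tagged by \<open>Inl\<close>. The
  vertices stay the same, so vertex sets and cardinalities carry over and with them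
  dependence.\<close>

lemma frame_matroid_map:
  fixes G :: "('v, 'e) multigraph" and h :: "'e \<Rightarrow> 'f"
  assumes bg: "biased_graph G B" and inj: "inj_on h (edges G)"
  obtains G' :: "('v, 'f) multigraph" and B' where "biased_graph G' B'"
    "frame_matroid G' B' = map_matroid h (frame_matroid G B)"
    "\<And>f. unbalanced_loop G B f \<Longrightarrow> unbalanced_loop G' B' (h f)"
proof -
  have fin: "finite_multigraph G" and Bc: "\<And>C. C \<in> B \<Longrightarrow> is_cycle G C" and tc: "theta_closed G B"
    using bg by (auto simp: biased_graph_iff)
  define G' :: "('v, 'f) multigraph" where "G' = \<lparr>verts = verts G, edges = h ` edges G,
    ends = (\<lambda>x. ends G (inv_into (edges G) h x))\<rparr>"
  define B' where "B' = (`) h ` B"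
  have e: "ends G' (h f) = ends G f" if "f \<in> edges G" for f
    using inv_into_f_f[OF inj that] by (simp add: G'_def)
  have V: "vertices_of G' (h ` X) = vertices_of G X" if "X \<subseteq> edges G" for X
  proof -
    have "ends G' (h f) = ends G f" if "f \<in> X" for f using e that \<open>X \<subseteq> edges G\<close> by blast
    then show ?thesis by (simp add: vertices_of_def)
  qed
  have c: "card (h ` X) = card X" if "X \<subseteq> edges G" for X
    by (rule card_image[OF inj_on_subset[OF inj that]])
  have BE: "C \<subseteq> edges G" if "C \<in> B" for C by (rule is_cycle_card(3)[OF Bc[OF that]])
  have sub: "h ` X \<subseteq> h ` Y \<longleftrightarrow> X \<subseteq> Y" if "X \<subseteq> edges G" "Y \<subseteq> edges G" for X Y
    using inj_on_image_mem_iff[OF inj _ that(2)] that(1) by blast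
  have "finite_multigraph G'"
    using fin e by (auto simp: finite_multigraph_def) (auto simp: G'_def)
  moreover have "is_cycle G' C" if C: "C \<in> B'" for C
  proof -
    obtain D where D: "D \<in> B" "C = h ` D" using C by (auto simp: B'_def)
    have "h f \<in> edges G' \<and> ends G' (h f) = id ` ends G f" if "f \<in> D" for f
    proof -
      have "f \<in> edges G" using that BE[OF D(1)] by blast
      then show ?thesis using e by (simp add: G'_def)
    qed
    from is_cycle_transport[OF Bc[OF D(1)] this inj_on_id inj_on_subset[OF inj BE[OF D(1)]]]
    show ?thesis using D(2) by simp
  qed
  moreover have "theta_closed G' B'"
    unfolding theta_closed_def
  proof (intro ballI impI)
    fix C C' assume "C \<in> B'" "C' \<in> B'" and hyp: "C \<noteq> C' \<and> C \<inter> C' \<noteq> {} \<and>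
      card (C \<union> C') \<le> Suc (card (vertices_of G' (C \<union> C')))"
    then obtain D D' where D: "D \<in> B" "C = h ` D" "D' \<in> B" "C' = h ` D'" by (auto simp: B'_def)
    note DE = BE[OF D(1)] BE[OF D(3)]
    have U: "D \<union> D' \<subseteq> edges G" "C \<union> C' = h ` (D \<union> D')" using DE D by auto
    have "C \<inter> C' = h ` (D \<inter> D')" using inj_on_image_Int[OF inj DE] D by simp
    then have "D \<noteq> D'" "D \<inter> D' \<noteq> {}" using hyp D by auto
    moreover have "card (D \<union> D') \<le> Suc (card (vertices_of G (D \<union> D')))"
      using hyp unfolding U(2) c[OF U(1)] V[OF U(1)] by simp
    ultimately have sd: "(D - D') \<union> (D' - D) \<in> B"
      using tc[unfolded theta_closed_def, rule_format, OF D(1,3)] by simp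
    have "D - D' \<subseteq> edges G" "D' - D \<subseteq> edges G" using DE by blast+
    from inj_on_image_set_diff[OF inj this(1) DE(2)] inj_on_image_set_diff[OF inj this(2) DE(1)]
    have "(C - C') \<union> (C' - C) = h ` ((D - D') \<union> (D' - D))" unfolding D(2,4) image_Un by (simp only:)
    then show "(C - C') \<union> (C' - C) \<in> B'" unfolding B'_def using sd by (rule image_eqI)
  qed
  ultimately have bg': "biased_graph G' B'" by (simp add: biased_graph_iff)
  have dep: "dependent G' B' (h ` X) \<longleftrightarrow> dependent G B X" if X: "X \<subseteq> edges G" for X
  proof
    assume "dependent G' B' (h ` X)"
    then show "dependent G B X"
    proof (cases rule: dependentE)
      case (balanced C)
      then obtain D where D: "D \<in> B" "C = h ` D" by (auto simp: B'_def)
      then have "D \<subseteq> X" using balanced(2) sub[OF BE[OF D(1)] X] by simp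
      then show ?thesis by (rule dependent_balanced[OF D(1)])
    next
      case (overfull Z)
      from overfull(1) obtain W where W: "W \<subseteq> X" "Z = h ` W" by (rule subset_imageE)
      have WE: "W \<subseteq> edges G" using W(1) X by blast
      show ?thesis
        by (rule dependent_overfull[OF W(1)]) (use overfull(2) W(2) V[OF WE] c[OF WE] in simp)
    qed
  next
    assume "dependent G B X"
    then show "dependent G' B' (h ` X)"
    proof (cases rule: dependentE)
      case (balanced C)
      then show ?thesis by (intro dependent_balanced[of "h ` C"]) (auto simp: B'_def)
    next
      case (overfull Z)
      have ZE: "Z \<subseteq> edges G" using overfull(1) X by blast
      show ?thesis
        by (rule dependent_overfull[OF image_mono[OF overfull(1)]])
          (use overfull(2) V[OF ZE] c[OF ZE] in simp)
    qed
  qed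
  let ?M = "frame_matroid G B"
  have ME: "C \<subseteq> edges G" if "C \<in> circuits ?M" for C by (rule frame_circuit_dependent(1)[OF bg that])
  have "circuits (frame_matroid G' B') = (`) h ` circuits ?M"
  proof (rule frame_circuits_eq[OF bg'])
    fix C C' assume "C \<in> (`) h ` circuits ?M" "C' \<in> (`) h ` circuits ?M" "C \<subseteq> C'"
    then obtain D D' where D: "D \<in> circuits ?M" "C = h ` D" "D' \<in> circuits ?M" "C' = h ` D'" by blast
    then have "D \<subseteq> D'" using \<open>C \<subseteq> C'\<close> sub[OF ME ME] by simp
    then show "C = C'" using frame_matroid_antichain[OF bg D(1,3)] D by simp
  next
    fix C assume "C \<in> (`) h ` circuits ?M"
    then show "C \<subseteq> edges G'" using ME by (auto simp: G'_def)
  next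
    fix X assume "X \<subseteq> edges G'"
    then obtain Y where Y: "Y \<subseteq> edges G" "X = h ` Y" by (auto simp: G'_def elim: subset_imageE)
    have "dependent G' B' X \<longleftrightarrow> (\<exists>C\<in>circuits ?M. C \<subseteq> Y)"
      using dep[OF Y(1)] dependent_iff_contains_circuit[OF bg Y(1)] Y(2) by simp
    also have "\<dots> \<longleftrightarrow> (\<exists>C\<in>circuits ?M. h ` C \<subseteq> X)"
      using sub[OF ME Y(1)] Y(2) by simp
    finally show "dependent G' B' X \<longleftrightarrow> (\<exists>C\<in>(`) h ` circuits ?M. C \<subseteq> X)" by simp
  qed
  then have "frame_matroid G' B' = map_matroid h ?M"
    by (intro frame_matroid_eqI) (simp_all add: map_matroid_def G'_def frame_matroid_def)
  moreover have "unbalanced_loop G' B' (h f)" if f: "unbalanced_loop G B f" for f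
  proof -
    have fE: "f \<in> edges G" using f by (simp add: unbalanced_loop_def)
    have "{h f} \<notin> B'"
    proof
      assume "{h f} \<in> B'"
      then obtain D where D: "D \<in> B" "h ` D = h ` {f}" by (auto simp: B'_def)
      then have "D = {f}" using inj_on_image_eq_iff[OF inj BE[OF D(1)], of "{f}"] fE by simp
      then show False using D(1) f by (simp add: unbalanced_loop_def)
    qed
    then show ?thesis using f e[OF fE] by (simp add: unbalanced_loop_def G'_def)
  qed
  ultimately show thesis using that[OF bg'] by blast
qed

lemma matroidal_is_frame_map:
  assumes "matroidal_is_frame N L" "inj_on h (ground N)"
  shows "matroidal_is_frame (map_matroid h N) (h ` L)"
proof -
  obtain G :: "(nat, 'a) multigraph" and B where G: "biased_graph G B" "frame_matroid G B = N"
    "\<forall>e\<in>L. unbalanced_loop G B e"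
    using assms(1) unfolding matroidal_is_frame_def by blast
  have "inj_on h (edges G)" using assms(2) G(2) by (auto simp: frame_matroid_def)
  from frame_matroid_map[OF G(1) this] obtain G' :: "(nat, 'b) multigraph" and B' where
    "biased_graph G' B'" "frame_matroid G' B' = map_matroid h (frame_matroid G B)"
    "\<And>f. unbalanced_loop G B f \<Longrightarrow> unbalanced_loop G' B' (h f)" by blast
  then show ?thesis using G(2,3) unfolding matroidal_is_frame_def
    by (intro exI[of _ G'] exI[of _ B']) simp
qed

text \<open>The converse renames back by \<open>projl\<close>, which is injective on a ground set
  that consists of \<open>Inl\<close> elements.\<close>

lemma matroidal_is_frame_Inl:
  "matroidal_is_frame (map_matroid (Inl :: 'a \<Rightarrow> 'a + 'b) N) (Inl ` L) \<longleftrightarrow> matroidal_is_frame N L"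
proof
  let ?I = "Inl :: 'a \<Rightarrow> 'a + 'b"
  assume "matroidal_is_frame (map_matroid ?I N) (?I ` L)"
  moreover have "inj_on projl (ground (map_matroid ?I N))" by (auto simp: map_matroid_def inj_on_def)
  ultimately have "matroidal_is_frame (map_matroid projl (map_matroid ?I N)) (projl ` ?I ` L)"
    by (rule matroidal_is_frame_map)
  moreover have "map_matroid projl (map_matroid ?I N) = N"
    by (cases N) (simp add: map_matroid_def image_image)
  moreover have "projl ` ?I ` L = L" by (simp add: image_image)
  ultimately show "matroidal_is_frame N L" by simp
qed (rule matroidal_is_frame_map, simp_all)

section \<open>Circuits of a 2-sum with U_{2,4}\<close>

text \<open>The part of the copy of U_{2,4} at \<open>e\<close> that survives the 2-sum: its
  elements other than the basepoint.\<close>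

definition triple :: "'a \<Rightarrow> ('a + 'a \<times> nat) set" where
  "triple e = {Inr (e, 1), Inr (e, 2), Inr (e, 3)}"

lemma card_triple [simp]: "card (triple e) = 3" "finite (triple e)"
  by (simp_all add: triple_def)

lemma U24_copy_ground: "(\<lambda>i. Inr (e, i)) ` {..<4} = insert (Inr (e, 0)) (triple e)"
proof -
  have "{..<4::nat} = {0, 1, 2, 3}" by auto
  then show ?thesis by (simp add: triple_def)
qed

lemma U24_copy_circuits:
  "D \<in> circuits (U24_copy e) \<longleftrightarrow> D \<subseteq> insert (Inr (e, 0)) (triple e) \<and> card D = 3"
  by (simp add: U24_copy_def uniform_matroid_def U24_copy_ground)

lemma basepoint_notin_triple [simp]: "Inr (e, 0) \<notin> triple e"
  by (simp add: triple_def)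

lemma ground_two_sum_U24_at:
  assumes "Inr (e, 0) \<notin> ground M"
  shows "ground (two_sum_U24_at e M) = ground M - {Inl e} \<union> triple e"
proof -
  have "Inl e \<notin> triple e" by (simp add: triple_def)
  then show ?thesis using assms
    by (auto simp: two_sum_U24_at_def two_sum_def U24_copy_def uniform_matroid_def U24_copy_ground)
qed

text \<open>The circuits of U_{2,4} are its three-element subsets: the one without the basepoint is
  \<open>triple e\<close>, and the others are the basepoint with two elements of
  \<open>triple e\<close>.\<close>

lemma circuits_two_sum_U24_at:
  assumes "\<And>C. C \<in> circuits M \<Longrightarrow> Inr (e, 0) \<notin> C"
  shows "X \<in> circuits (two_sum_U24_at e M) \<longleftrightarrow> (X \<in> circuits M \<and> Inl e \<notin> X) \<or> X = triple e \<or>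
    (\<exists>C S. X = (C - {Inl e}) \<union> S \<and> C \<in> circuits M \<and> Inl e \<in> C \<and> S \<subseteq> triple e \<and> card S = 2)"
    (is "?l \<longleftrightarrow> ?r")
proof
  assume ?l
  then show ?r
  proof (cases rule: two_sum_U24_at_cases)
    case copy
    then have "X \<subseteq> triple e" "card X = 3" by (auto simp: U24_copy_circuits)
    then have "X = triple e" by (intro card_seteq) simp_all
    then show ?thesis by blast
  next
    case (glue C D)
    have D: "D \<subseteq> insert (Inr (e, 0)) (triple e)" "card D = 3" using glue(4) by (auto simp: U24_copy_circuits)
    have "finite D" using D(2) card.infinite by fastforce
    then have "card (D - {Inr (e, 0)}) = 2" using D(2) glue(5) by simp
    moreover have "D - {Inr (e, 0)} \<subseteq> triple e" using D(1) by blast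
    moreover have "X = (C - {Inl e}) \<union> (D - {Inr (e, 0)})"
      using glue(1) assms[OF glue(2)] U24_copy_circuit_notin(1)[OF glue(4)] by auto
    ultimately show ?thesis using glue(2,3) by blast
  qed simp
next
  assume ?r
  then show ?l
  proof (elim disjE exE conjE)
    assume "X = triple e"
    then show ?l by (intro two_sum_U24_at_copy) (auto simp: U24_copy_circuits)
  next
    fix C S assume h: "X = (C - {Inl e}) \<union> S" "C \<in> circuits M" "Inl e \<in> C" "S \<subseteq> triple e" "card S = 2"
    have fS: "finite S" by (rule finite_subset[OF h(4)]) simp
    have n: "Inr (e, 0) \<notin> S" "Inl e \<notin> S" using h(4) by (auto simp: triple_def)
    have D: "insert (Inr (e, 0)) S \<in> circuits (U24_copy e)"
      using h(4,5) fS n by (auto simp: U24_copy_circuits)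
    have "X = (C \<union> insert (Inr (e, 0)) S) - {Inl e, Inr (e, 0)}"
      using h(1) n assms[OF h(2)] by auto
    then show ?l by (rule two_sum_U24_at_glue[OF _ h(2,3) D]) simp
  qed (rule two_sum_U24_at_old)
qed

context
  fixes M :: "('a + 'a \<times> nat) matroid" and e :: 'a
  assumes circ: "\<And>C. C \<in> circuits M \<Longrightarrow> C \<subseteq> ground M"
    and fresh: "\<And>i. Inr (e, i) \<notin> ground M"
begin

lemma triple_disjoint: "triple e \<inter> ground M = {}"
  using fresh by (auto simp: triple_def)

lemma circuits_at:
  "X \<in> circuits (two_sum_U24_at e M) \<longleftrightarrow> (X \<in> circuits M \<and> Inl e \<notin> X) \<or> X = triple e \<or>
    (\<exists>C S. X = (C - {Inl e}) \<union> S \<and> C \<in> circuits M \<and> Inl e \<in> C \<and> S \<subseteq> triple e \<and> card S = 2)"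
  by (rule circuits_two_sum_U24_at) (use circ fresh in blast)

text \<open>Any two elements of the triple can replace \<open>e\<close> in a circuit of
  \<open>M\<close>, while one element occurs in no circuit without a second. This is the pattern
  that both replacement lemmas for graphs realize.\<close>

lemma two_sum_U24_at_contains_circuit:
  assumes "Y \<subseteq> ground M - {Inl e}" "S \<subseteq> triple e"
  shows "(\<exists>C\<in>circuits (two_sum_U24_at e M). C \<subseteq> Y \<union> S) \<longleftrightarrow>
    S = triple e \<or> (\<exists>C\<in>circuits M. C \<subseteq> Y) \<or> 2 \<le> card S \<and> (\<exists>C\<in>circuits M. C \<subseteq> insert (Inl e) Y)"
    (is "?l \<longleftrightarrow> ?r")
proof
  have fS: "finite S" by (rule finite_subset[OF assms(2)]) simp
  have Yt: "Y \<inter> triple e = {}" using assms(1) triple_disjoint by blast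
  show ?r if ?l
  proof -
    from \<open>?l\<close> obtain X where X: "X \<in> circuits (two_sum_U24_at e M)" "X \<subseteq> Y \<union> S" by blast
    from X(1) show ?r unfolding circuits_at
    proof (elim disjE exE conjE)
      assume h: "X \<in> circuits M"
      then have "X \<inter> triple e = {}" using circ triple_disjoint by blast
      then have "X \<subseteq> Y" using X(2) assms(2) by blast
      then show ?r using h by blast
    next
      assume "X = triple e"
      then have "S = triple e" using X(2) Yt assms(2) by blast
      then show ?r ..
    next
      fix C S' assume h: "X = (C - {Inl e}) \<union> S'" "C \<in> circuits M" "S' \<subseteq> triple e" "card S' = 2"
      have "S' \<subseteq> S" using h(1,3) X(2) Yt by blast
      then have "2 \<le> card S" using card_mono[OF fS] h(4) by metis
      moreover have "C \<inter> triple e = {}" using circ[OF h(2)] triple_disjoint by blast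
      then have "C \<subseteq> insert (Inl e) Y" using h(1) X(2) assms(2) by blast
      ultimately show ?r using h(2) by blast
    qed
  qed
  show ?l if ?r
    using that
  proof (elim disjE conjE bexE)
    assume "S = triple e"
    moreover have "triple e \<in> circuits (two_sum_U24_at e M)" unfolding circuits_at by simp
    ultimately show ?l by blast
  next
    fix C assume h: "C \<in> circuits M" "C \<subseteq> Y"
    moreover have "Inl e \<notin> C" using h(2) assms(1) by blast
    ultimately have "C \<in> circuits (two_sum_U24_at e M)" unfolding circuits_at by simp
    then show ?l using h(2) by blast
  next
    fix C assume c: "2 \<le> card S" and h: "C \<in> circuits M" "C \<subseteq> insert (Inl e) Y"
    show ?l
    proof (cases "Inl e \<in> C")
      case False
      then have "C \<in> circuits (two_sum_U24_at e M)" unfolding circuits_at using h(1) by simp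
      then show ?thesis using h(2) False by blast
    next
      case True
      obtain S' where S': "S' \<subseteq> S" "card S' = 2" by (rule obtain_subset_with_card_n[OF c])
      then have "S' \<subseteq> triple e" using assms(2) by blast
      then have "(C - {Inl e}) \<union> S' \<in> circuits (two_sum_U24_at e M)"
        unfolding circuits_at using h(1) True S'(2) by blast
      moreover have "(C - {Inl e}) \<union> S' \<subseteq> Y \<union> S" using h(2) S'(1) by blast
      ultimately show ?thesis by blast
    qed
  qed
qed

lemma two_sum_U24_at_circuits_subset:
  assumes "C \<in> circuits (two_sum_U24_at e M)"
  shows "C \<subseteq> ground (two_sum_U24_at e M)"
proof -
  have g: "ground (two_sum_U24_at e M) = ground M - {Inl e} \<union> triple e"
    by (rule ground_two_sum_U24_at[OF fresh])
  from assms show ?thesis unfolding circuits_at g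
  proof (elim disjE exE conjE)
    fix D S assume "C = (D - {Inl e}) \<union> S" "D \<in> circuits M" "S \<subseteq> triple e"
    moreover from this have "D \<subseteq> ground M" using circ by blast
    ultimately show "C \<subseteq> ground M - {Inl e} \<union> triple e" by blast
  qed (use circ in blast)+
qed

lemma two_elements_of_triple:
  obtains S where "S \<subseteq> triple e" "card S = 2"
proof -
  have "2 \<le> card (triple e)" by simp
  then show thesis using obtain_subset_with_card_n that by metis
qed

text \<open>Required for comparing circuits through dependent sets. A circuit \<open>{Inl e}\<close>
  has to be excluded: it would turn the pairs inside \<open>triple e\<close> into members next to
  \<open>triple e\<close> itself.\<close>

lemma two_sum_U24_at_antichain:
  assumes anti: "\<And>C C'. C \<in> circuits M \<Longrightarrow> C' \<in> circuits M \<Longrightarrow> C \<subseteq> C' \<Longrightarrow> C = C'"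
    and ne: "{} \<notin> circuits M" and loop: "{Inl e} \<notin> circuits M"
    and X: "X \<in> circuits (two_sum_U24_at e M)" "X' \<in> circuits (two_sum_U24_at e M)" "X \<subseteq> X'"
  shows "X = X'"
proof -
  have dis: "C \<inter> triple e = {}" if "C \<in> circuits M" for C using circ[OF that] triple_disjoint by blast
  have et: "Inl e \<notin> triple e" by (simp add: triple_def)
  have small: "\<not> triple e \<subseteq> S" if "S \<subseteq> triple e" "card S = 2" for S
  proof
    assume "triple e \<subseteq> S"
    then have "S = triple e" using that(1) by blast
    then show False using that(2) by simp
  qed
  have nonempty: "S \<noteq> {}" if "card S = 2" for S :: "('a + 'a \<times> nat) set" using that by auto
  from X(1) show ?thesis unfolding circuits_at
  proof (elim disjE exE conjE)
    assume x: "X \<in> circuits M" "Inl e \<notin> X"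
    from X(2) show ?thesis unfolding circuits_at
    proof (elim disjE exE conjE)
      assume "X' \<in> circuits M" then show ?thesis using anti x(1) X(3) by blast
    next
      assume "X' = triple e"
      then have "X = {}" using X(3) dis[OF x(1)] by blast
      then show ?thesis using ne x(1) by simp
    next
      fix C S assume h: "X' = (C - {Inl e}) \<union> S" "C \<in> circuits M" "Inl e \<in> C" "S \<subseteq> triple e"
      have "X \<subseteq> C" using X(3) h(1,4) dis[OF x(1)] by blast
      then have "X = C" using anti x(1) h(2) by blast
      then show ?thesis using x(2) h(3) by simp
    qed
  next
    assume x: "X = triple e"
    from X(2) show ?thesis unfolding circuits_at
    proof (elim disjE exE conjE)
      assume "X' \<in> circuits M"
      from dis[OF this] have "triple e = {}" using x X(3) by blast
      then show ?thesis by (simp add: triple_def)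
    next
      fix C S assume h: "X' = (C - {Inl e}) \<union> S" "C \<in> circuits M" "S \<subseteq> triple e" "card S = 2"
      have "triple e \<subseteq> S" using x X(3) h(1) dis[OF h(2)] by blast
      then show ?thesis using small[OF h(3,4)] by simp
    qed (use x in simp)
  next
    fix C S assume x: "X = (C - {Inl e}) \<union> S" "C \<in> circuits M" "Inl e \<in> C" "S \<subseteq> triple e" "card S = 2"
    from X(2) show ?thesis unfolding circuits_at
    proof (elim disjE exE conjE)
      assume "X' \<in> circuits M"
      from dis[OF this] have "S = {}" using x(1,4) X(3) by blast
      then show ?thesis using nonempty[OF x(5)] by simp
    next
      assume "X' = triple e"
      then have "C = {Inl e}" using x(1,3) X(3) dis[OF x(2)] by blast
      then show ?thesis using loop x(2) by simp
    next
      fix C' S' assume h: "X' = (C' - {Inl e}) \<union> S'" "C' \<in> circuits M" "Inl e \<in> C'" "S' \<subseteq> triple e" "card S' = 2"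
      have "C \<subseteq> C'" using x(1) X(3) h(1,3,4) dis[OF x(2)] by blast
      then have "C = C'" using anti x(2) h(2) by blast
      moreover have "S \<subseteq> S'" using x(1,4) X(3) h(1) dis[OF h(2)] by blast
      then have "S = S'"
        using card_seteq[OF finite_subset[OF h(4)], of S] x(5) h(5) by simp
      ultimately show ?thesis using x(1) h(1) by simp
    qed
  qed
qed

text \<open>In the converse direction only the 2-sum is known to come from a graph, so the
  properties of \<open>M\<close> have to be recovered. Replacing \<open>e\<close> by a fixed pair
  \<open>S\<close> preserves inclusions between circuits, and a circuit \<open>{Inl e}\<close> would
  make \<open>S\<close> a circuit properly inside \<open>triple e\<close>.\<close>

lemma two_sum_U24_at_antichain_rev:
  assumes anti: "\<And>X X'. X \<in> circuits (two_sum_U24_at e M) \<Longrightarrow> X' \<in> circuits (two_sum_U24_at e M) \<Longrightarrow>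
      X \<subseteq> X' \<Longrightarrow> X = X'"
  shows "{Inl e} \<notin> circuits M" "\<And>C C'. C \<in> circuits M \<Longrightarrow> C' \<in> circuits M \<Longrightarrow> C \<subseteq> C' \<Longrightarrow> C = C'"
proof -
  obtain S where S: "S \<subseteq> triple e" "card S = 2" by (rule two_elements_of_triple)
  have glue: "(C - {Inl e}) \<union> S \<in> circuits (two_sum_U24_at e M)" if "C \<in> circuits M" "Inl e \<in> C" for C
    unfolding circuits_at using that S by blast
  have old: "C \<in> circuits (two_sum_U24_at e M)" if "C \<in> circuits M" "Inl e \<notin> C" for C
    unfolding circuits_at using that by simp
  have dis: "C \<inter> triple e = {}" if "C \<in> circuits M" for C using circ[OF that] triple_disjoint by blast
  have S0: "S \<noteq> {}" using S(2) by auto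
  show "{Inl e} \<notin> circuits M"
  proof
    assume "{Inl e} \<in> circuits M"
    from glue[OF this] have "S \<in> circuits (two_sum_U24_at e M)" by simp
    moreover have "triple e \<in> circuits (two_sum_U24_at e M)" unfolding circuits_at by simp
    ultimately have "S = triple e" using anti S(1) by blast
    then show False using S(2) by simp
  qed
  fix C C' assume C: "C \<in> circuits M" "C' \<in> circuits M" "C \<subseteq> C'"
  show "C = C'"
  proof (cases "Inl e \<in> C")
    case True
    then have "Inl e \<in> C'" using C(3) by blast
    from anti[OF glue[OF C(1) True] glue[OF C(2) this]] C(3)
    have "(C - {Inl e}) \<union> S = (C' - {Inl e}) \<union> S" by blast
    then have "C' - {Inl e} \<subseteq> C - {Inl e}" using dis[OF C(2)] S(1) by blast
    then show ?thesis using True C(3) by blast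
  next
    case F: False
    show ?thesis
    proof (cases "Inl e \<in> C'")
      case True
      from anti[OF old[OF C(1) F] glue[OF C(2) True]] C(3) F
      have "C = (C' - {Inl e}) \<union> S" by blast
      then have "S \<subseteq> C" by blast
      then show ?thesis using dis[OF C(1)] S(1) S0 by blast
    next
      case False
      then show ?thesis using anti[OF old[OF C(1) F] old[OF C(2)]] C(3) by blast
    qed
  qed
qed

text \<open>\<open>K\<close> records the elements that have to be unbalanced loops for other
  reasons; without it the equivalence could not be iterated.\<close>

lemma matroidal_is_frame_two_sum_U24_at:
  assumes e: "Inl e \<in> ground M" and K: "K \<subseteq> ground M - {Inl e}"
  shows "matroidal_is_frame (two_sum_U24_at e M) K \<longleftrightarrow> matroidal_is_frame M (insert (Inl e) K)"
proof
  have g: "ground (two_sum_U24_at e M) = ground M - {Inl e} \<union> triple e"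
    by (rule ground_two_sum_U24_at[OF fresh])
  {
    assume "matroidal_is_frame M (insert (Inl e) K)"
    then obtain G :: "(nat, 'a + 'a \<times> nat) multigraph" and B where G: "biased_graph G B"
      "frame_matroid G B = M" "\<forall>f\<in>insert (Inl e) K. unbalanced_loop G B f"
      unfolding matroidal_is_frame_def by blast
    have EG: "edges G = ground M" using G(2) by (auto simp: frame_matroid_def)
    have loop: "unbalanced_loop G B (Inl e)" using G(3) by simp
    have tG: "triple e \<inter> edges G = {}" using EG triple_disjoint by simp
    obtain G' :: "(nat, 'a + 'a \<times> nat) multigraph" and B' where G': "biased_graph G' B'"
      "edges G' = edges G - {Inl e} \<union> triple e"
      and dep: "\<And>Y S. Y \<subseteq> edges G - {Inl e} \<Longrightarrow> S \<subseteq> triple e \<Longrightarrow> dependent G' B' (Y \<union> S) \<longleftrightarrow>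
        S = triple e \<or> dependent G B Y \<or> 2 \<le> card S \<and> dependent G B (insert (Inl e) Y)"
      and loops: "\<And>f. unbalanced_loop G B f \<Longrightarrow> f \<noteq> Inl e \<Longrightarrow> unbalanced_loop G' B' f"
      by (rule replace_loop_by_triple[OF G(1) loop card_triple(1) tG]) (rule that; assumption)
    \<comment> \<open>An unbalanced loop is independent, which rules out the degenerate 2-sum at a
      loop of the matroid.\<close>
    have indep: "\<not> dependent G B X" if "X = {} \<or> X = {Inl e}" for X
    proof
      have c1: "card (ends G (Inl e)) = 1" using loop by (simp add: unbalanced_loop_def)
      assume "dependent G B X"
      then show False
      proof (cases rule: dependentE)
        case (balanced C)
        then have "C = {}" using loop_notin_balanced[OF G(1) loop] that by blast
        then show False using balanced(1) G(1) is_cycle_card(2)[of G C] by (auto simp: biased_graph_def)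
      next
        case (overfull Z)
        then have "Z = {} \<or> Z = {Inl e}" using that by blast
        then show False using overfull(2) c1 by auto
      qed
    qed
    have notc: "{} \<notin> circuits M" "{Inl e} \<notin> circuits M"
      using frame_circuit_dependent(2)[OF G(1)] indep G(2) by blast+
    have "circuits (frame_matroid G' B') = circuits (two_sum_U24_at e M)"
    proof (rule frame_circuits_eq[OF G'(1)])
      fix C C' assume "C \<in> circuits (two_sum_U24_at e M)" "C' \<in> circuits (two_sum_U24_at e M)" "C \<subseteq> C'"
      then show "C = C'"
        using two_sum_U24_at_antichain[OF frame_matroid_antichain[OF G(1), unfolded G(2)] notc] by blast
    next
      fix C assume "C \<in> circuits (two_sum_U24_at e M)"
      then show "C \<subseteq> edges G'" using two_sum_U24_at_circuits_subset g G'(2) EG by simp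
    next
      fix X assume X: "X \<subseteq> edges G'"
      define Y where "Y = X - triple e"
      define S where "S = X \<inter> triple e"
      have YS: "X = Y \<union> S" "Y \<subseteq> ground M - {Inl e}" "S \<subseteq> triple e"
        using X G'(2) EG by (auto simp: Y_def S_def)
      have YE: "Y \<subseteq> edges G" "insert (Inl e) Y \<subseteq> edges G" using YS(2) EG e by auto
      show "dependent G' B' X \<longleftrightarrow> (\<exists>C\<in>circuits (two_sum_U24_at e M). C \<subseteq> X)"
        unfolding YS(1) two_sum_U24_at_contains_circuit[OF YS(2,3)] dep[OF YS(2)[folded EG] YS(3)]
          dependent_iff_contains_circuit[OF G(1) YE(1)] dependent_iff_contains_circuit[OF G(1) YE(2)] G(2) ..
    qed
    then have "frame_matroid G' B' = two_sum_U24_at e M"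
      using G'(2) g EG by (intro frame_matroid_eqI) simp_all
    moreover have "\<forall>f\<in>K. unbalanced_loop G' B' f" using loops G(3) K by blast
    ultimately show "matroidal_is_frame (two_sum_U24_at e M) K"
      unfolding matroidal_is_frame_def using G'(1) by blast
  next
    assume "matroidal_is_frame (two_sum_U24_at e M) K"
    then obtain G :: "(nat, 'a + 'a \<times> nat) multigraph" and B where G: "biased_graph G B"
      "frame_matroid G B = two_sum_U24_at e M" "\<forall>f\<in>K. unbalanced_loop G B f"
      unfolding matroidal_is_frame_def by blast
    have EG: "edges G = ground M - {Inl e} \<union> triple e"
      using arg_cong[OF G(2), of ground] g by (simp add: frame_matroid_def)
    have ET: "edges G - triple e = ground M - {Inl e}" using EG triple_disjoint by blast
    have tE: "triple e \<subseteq> edges G" and eG: "Inl e \<notin> edges G" using EG by (auto simp: triple_def)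
    note anti = two_sum_U24_at_antichain_rev[OF frame_matroid_antichain[OF G(1), unfolded G(2)]]
    have dep: "dependent G B (Y \<union> S) \<longleftrightarrow> S = triple e \<or> (\<exists>C\<in>circuits M. C \<subseteq> Y) \<or>
        2 \<le> card S \<and> (\<exists>C\<in>circuits M. C \<subseteq> insert (Inl e) Y)"
      if "Y \<subseteq> edges G - triple e" "S \<subseteq> triple e" for Y S
    proof -
      have "Y \<union> S \<subseteq> edges G" using that tE by blast
      then show ?thesis
        using dependent_iff_contains_circuit[OF G(1)] G(2) two_sum_U24_at_contains_circuit[of Y S] that ET
        by simp
    qed
    have depY: "dependent G B Y \<longleftrightarrow> (\<exists>C\<in>circuits M. C \<subseteq> Y)" if "Y \<subseteq> edges G - triple e" for Y
    proof -
      have "{} \<noteq> triple e" by (simp add: triple_def)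
      then show ?thesis using dep[OF that, of "{}"] by simp
    qed
    have ne: "{} \<notin> circuits M" using depY[of "{}"] not_dependent_empty[OF G(1)] by auto
    \<comment> \<open>Here the recovered fact that \<open>e\<close> is not a loop of
      \<open>M\<close> enters: it makes pairs of the triple independent in \<open>G\<close>.\<close>
    have Q0: "\<not> (\<exists>C\<in>circuits M. C \<subseteq> {Inl e})" using ne anti(1) by (auto simp: subset_singleton_iff)
    have depQ: "dependent G B (Y \<union> S) \<longleftrightarrow> S = triple e \<or> dependent G B Y \<or>
        2 \<le> card S \<and> (\<exists>C\<in>circuits M. C \<subseteq> insert (Inl e) Y)"
      if "Y \<subseteq> edges G - triple e" "S \<subseteq> triple e" for Y S
      using dep[OF that] depY[OF that(1)] by simp
    obtain G' :: "(nat, 'a + 'a \<times> nat) multigraph" and B' where G': "biased_graph G' B'"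
      "edges G' = insert (Inl e) (edges G - triple e)" "unbalanced_loop G' B' (Inl e)"
      and depG': "\<And>Y. Y \<subseteq> edges G - triple e \<Longrightarrow> dependent G' B' Y \<longleftrightarrow> dependent G B Y"
        "\<And>Y. Y \<subseteq> edges G - triple e \<Longrightarrow> dependent G' B' (insert (Inl e) Y) \<longleftrightarrow>
          dependent G B Y \<or> (\<exists>C\<in>circuits M. C \<subseteq> insert (Inl e) Y)"
      and loops: "\<And>f. f \<in> edges G - triple e \<Longrightarrow> unbalanced_loop G B f \<Longrightarrow> unbalanced_loop G' B' f"
      by (rule replace_triple_by_loop[where Q = "\<lambda>Y. \<exists>C\<in>circuits M. C \<subseteq> insert (Inl e) Y", OF G(1) tE card_triple(1) eG depQ Q0])
        (assumption, assumption, (rule that; assumption))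
    have EG': "edges G' = ground M" using G'(2) ET e by auto
    have "circuits (frame_matroid G' B') = circuits M"
    proof (rule frame_circuits_eq[OF G'(1) anti(2)])
      fix C assume "C \<in> circuits M" then show "C \<subseteq> edges G'" using circ EG' by simp
    next
      fix X assume X: "X \<subseteq> edges G'"
      show "dependent G' B' X \<longleftrightarrow> (\<exists>C\<in>circuits M. C \<subseteq> X)"
      proof (cases "Inl e \<in> X")
        case False
        then have "X \<subseteq> edges G - triple e" using X unfolding G'(2) by (simp add: subset_insert)
        then show ?thesis using depG'(1) depY by simp
      next
        case True
        define Y where "Y = X - {Inl e}"
        have Y: "Y \<subseteq> edges G - triple e" "X = insert (Inl e) Y" 
          using X True unfolding G'(2) Y_def by (simp_all add: subset_insert_iff insert_absorb)
        have "(\<exists>C\<in>circuits M. C \<subseteq> Y) \<longrightarrow> (\<exists>C\<in>circuits M. C \<subseteq> X)" using Y(2) by blast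
        then show ?thesis using depG'(2)[OF Y(1)] depY[OF Y(1)] unfolding Y(2) by blast
      qed
    qed
    then have "frame_matroid G' B' = M" using EG' by (intro frame_matroid_eqI) simp_all
    moreover have "\<forall>f\<in>insert (Inl e) K. unbalanced_loop G' B' f"
      using loops G(3) K G'(3) ET by blast
    ultimately show "matroidal_is_frame M (insert (Inl e) K)"
      unfolding matroidal_is_frame_def using G'(1) by blast
  }
qed

end

section \<open>Induction over the elements of L\<close>

lemma two_sum_U24_ground_circuits:
  assumes "finite L" "L \<subseteq> ground N" "circuits N \<subseteq> Pow (ground N)"
  shows "ground (two_sum_U24 N L) = Inl ` (ground N - L) \<union> (\<Union>e\<in>L. triple e) \<and>
    circuits (two_sum_U24 N L) \<subseteq> Pow (ground (two_sum_U24 N L))"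
  using assms(1,2)
proof (induction L rule: finite_induct)
  case empty
  then show ?case using assms(3) by (auto simp: map_matroid_def)
next
  case (insert e L)
  let ?M = "two_sum_U24 N L"
  have "L \<subseteq> ground N" using insert.prems by simp
  note IH = conjunct1[OF insert.IH[OF this]] conjunct2[OF insert.IH[OF this]]
  have fresh: "Inr (e, i) \<notin> ground ?M" for i using IH(1) insert(2) by (auto simp: triple_def)
  have circ: "C \<subseteq> ground ?M" if "C \<in> circuits ?M" for C using IH(2) that by blast
  have "Inl e \<notin> (\<Union>e\<in>L. triple e)" by (auto simp: triple_def)
  then have "ground (two_sum_U24_at e ?M) = Inl ` (ground N - insert e L) \<union> (\<Union>e\<in>insert e L. triple e)"
    unfolding ground_two_sum_U24_at[OF fresh] IH(1) by auto
  moreover have "C \<subseteq> ground (two_sum_U24_at e ?M)" if "C \<in> circuits (two_sum_U24_at e ?M)" for C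
    by (rule two_sum_U24_at_circuits_subset[OF circ fresh that])
  ultimately show ?case using insert(1,2) by (simp add: subset_iff Pow_def)
qed

text \<open>Undoing the 2-sum at \<open>e\<close> turns it into the demand that \<open>e\<close> be
  an unbalanced loop, so \<open>e\<close> passes from \<open>L\<close> to \<open>K\<close>; hence
  \<open>K\<close> varies in the induction.\<close>

lemma matroidal_is_frame_two_sum_U24:
  assumes "finite L" "L \<subseteq> ground N" "circuits N \<subseteq> Pow (ground N)" "K \<subseteq> ground N - L"
  shows "matroidal_is_frame (two_sum_U24 N L) (Inl ` K) \<longleftrightarrow> matroidal_is_frame N (K \<union> L)"
  using assms(1,2,4)
proof (induction L arbitrary: K rule: finite_induct)
  case empty
  then show ?case by (simp add: matroidal_is_frame_Inl)
next
  case (insert e L)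
  let ?M = "two_sum_U24 N L"
  have "L \<subseteq> ground N" using insert.prems by simp
  note IH = two_sum_U24_ground_circuits[OF insert(1) this assms(3)]
  note gM = conjunct1[OF IH] conjunct2[OF IH]
  have fresh: "Inr (e, i) \<notin> ground ?M" for i using gM(1) insert(2) by (auto simp: triple_def)
  have circ: "C \<subseteq> ground ?M" if "C \<in> circuits ?M" for C using gM(2) that by blast
  have "Inl e \<in> ground ?M" "Inl ` K \<subseteq> ground ?M - {Inl e}" using gM(1) insert(2,4,5) by auto
  from matroidal_is_frame_two_sum_U24_at[OF circ fresh this]
  have "matroidal_is_frame (two_sum_U24 N (insert e L)) (Inl ` K) \<longleftrightarrow>
      matroidal_is_frame ?M (Inl ` insert e K)"
    using insert(1,2) by simp
  also have "\<dots> \<longleftrightarrow> matroidal_is_frame N (insert e K \<union> L)"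
    using insert(2,4,5) by (intro insert.IH) auto
  finally show ?case by simp
qed

theorem theorem3p9:
  fixes N :: "'a matroid" and L :: "'a set"
  assumes "is_matroid N" and "L \<subseteq> ground N"
  shows "is_frame (two_sum_U24 N L) \<longleftrightarrow> matroidal_is_frame N L"
proof -
  have "finite L" "circuits N \<subseteq> Pow (ground N)"
    using assms by (auto simp: is_matroid_def intro: finite_subset)
  \<comment> \<open>For \<open>K = {}\<close> no unbalanced loop is prescribed, and the left side
    says just that the 2-sum is frame.\<close>
  from matroidal_is_frame_two_sum_U24[OF this(1) assms(2) this(2), of "{}"]
  show ?thesis by (simp add: is_frame_def matroidal_is_frame_def)
qed

end
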